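(* Let $1<p<\infty$, $q>0$ and let $u$ be a weak subsolution of $\partial_t(|u|^{q-1}u)+\mathcal{L}u=0$ in $\Omega\times(0,T)$. Then $u^*(x,t)=u(x,t)$ at every Lebesgue point $(x,t)\in\Omega\times(0,T)$ of $u$. In particular, $u^*$ is an upper semicontinuous representative of $u$ in $\Omega\times(0,T)$ (that is, $u^*$ is upper semicontinuous in $\Omega\times(0,T)$ and $u^*=u$ almost everywhere in $\Omega\times(0,T)$).
   Context: Setting. $\Omega\subset\mathbb{R}^n$ is a bounded domain, $T>0$, $1<p<\infty$, $q>0$, $s\in(0,1)$, $\Lambda\ge 1$. The kernel $K(x,y,t)$ is measurable, symmetric in $x$ and $y$, and satisfies $\frac{\Lambda^{-1}}{|x-y|^{n+ps}}\le K(x,y,t)\le\frac{\Lambda}{|x-y|^{n+ps}}$ for almost every $x,y\in\mathbb{R}^n$, uniformly in $t\in(0,T)$. The operator is $\mathcal{L}u(x,t)=\mathrm{P.V.}\int_{\mathbb{R}^n}|u(x,t)-u(y,t)|^{p-2}(u(x,t)-u(y,t))K(x,y,t)\,dy$. Write $\mathcal{A}(u(x,y,t))=|u(x,t)-u(y,t)|^{p-2}(u(x,t)-u(y,t))$ and $d\mu=K(x,y,t)\,dx\,dy$. Function spaces. For an open set $D\subset\mathbb{R}^n$, $W^{s,p}(D)$ is the space of $u\in L^p(D)$ with $\frac{|u(x)-u(y)|}{|x-y|^{n/p+s}}\in L^p(D\times D)$, with norm $\|u\|_{W^{s,p}(D)}=\big(\int_D|u|^p\,dx+\int_D\int_D\frac{|u(x)-u(y)|^p}{|x-y|^{n+ps}}\,dx\,dy\big)^{1/p}$,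 and $W_0^{s,p}(D)=\{u\in W^{s,p}(\mathbb{R}^n):u=0\text{ in }\mathbb{R}^n\setminus D\}$. $L^p(0,T;W^{s,p}(D))$ consists of measurable $u$ on $D\times(0,T)$ with $\int_0^T\|u(\cdot,t)\|_{W^{s,p}(D)}^p\,dt<\infty$; local versions require this on every $\Omega'\times[t_1,t_2]\Subset\Omega\times(0,T)$. Weak subsolution. A function $u:\mathbb{R}^n\times(0,T)\to\mathbb{R}$, $u\in L^\infty(0,T;L^\infty(\mathbb{R}^n))$, is a weak subsolution of $\partial_t(|u|^{q-1}u)+\mathcal{L}u=0$ in $\Omega\times(0,T)$ if $u\in L^{q+1}_{\mathrm{loc}}(0,T;L^{q+1}_{\mathrm{loc}}(\Omega))\cap L^p_{\mathrm{loc}}(0,T;W^{s,p}_{\mathrm{loc}}(\Omega))$ and for every $\Omega'\times[t_1,t_2]\Subset\Omega\times(0,T)$ and every nonnegative test function $\phi\in W^{1,q+1}_{\mathrm{loc}}(0,T;L^{q+1}(\Omega'))\cap L^p_{\mathrm{loc}}(0,T;W_0^{s,p}(\Omega'))$, $$\int_{t_1}^{t_2}\int_{\mathbb{R}^n}\int_{\mathbb{R}^n}\mathcal{A}(u(x,y,t))(\phi(x,t)-\phi(y,t))\,d\mu\,dt-\int_{t_1}^{t_2}\int_{\Omega'}|u|^{q-1}u\,\partial_t\phi\,dx\,dt+\int_{\Omega'}|u(x,t_2)|^{q-1}u(x,t_2)\phi(x,t_2)\,dx-\int_{\Omega'}|u(x,t_1)|^{q-1}u(x,t_1)\phi(x,t_1)\,dx\le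 0.$$ The boundary terms at $t_1$ and $t_2$ are understood as $\lim_{h\to0}\frac1h\int_{t_1}^{t_1+h}\int_{\Omega'}|u|^{q-1}u\,\phi\,dx\,dt$ and $\lim_{h\to0}\frac1h\int_{t_2-h}^{t_2}\int_{\Omega'}|u|^{q-1}u\,\phi\,dx\,dt$, respectively. Cylinders and regularization. For $r,\theta>0$, $\mathcal{Q}_r(x_0,t_0;\theta)=B_r(x_0)\times(t_0-\theta r^{sp},t_0+\theta r^{sp})$, where $B_r(x_0)$ is the open ball. For $u$ locally essentially bounded above in $\Omega\times(0,T)$, the upper semicontinuous regularization is $u^*(x,t)=\operatorname{ess\,lim\,sup}_{(y,\hat t)\to(x,t)}u(y,\hat t)=\lim_{r\to0}\operatorname{ess\,sup}_{\mathcal{Q}_r(x,t;\theta)}u$ for every $(x,t)\in\Omega\times(0,T)$ (this does not depend on $\theta$). Lebesgue points. A point $(x,t)\in\Omega\times(0,T)$ is a Lebesgue point of $u$ if $|u(x,t)|<\infty$ and $\lim_{r\to0}\frac{1}{|\mathcal{Q}_r(x,t;\theta)|}\int_{\mathcal{Q}_r(x,t;\theta)}|u(x,t)-u(y,\hat t)|\,dy\,d\hat t=0$ (this does not depend on the fixed $\theta>0$). *)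

theory Defs
  imports "HOL-Analysis.Analysis" "HOL-Probability.Essential_Supremum"
begin

text \<open>
  The ambient space \<open>\<real>\<^sup>n\<close> is a Euclidean space \<open>'a\<close> with \<open>n = DIM('a)\<close>. Functions of \<open>(x, t)\<close> are total
  functions on \<open>'a \<times> real\<close>; only their values for \<open>t \<in> (0, T)\<close> matter. Measurability and
  \<open>almost everywhere\<close> refer to the (complete) Lebesgue measure.
\<close>

text \<open>\<open>spow a z = |z|\<^sup>a\<^sup>-\<^sup>1 z\<close>; since \<open>0 powr b = 0\<close>, it vanishes at \<open>z = 0\<close> also for \<open>a < 1\<close>.\<close>

definition spow :: "real \<Rightarrow> real \<Rightarrow> real" where
  "spow a z = \<bar>z\<bar> powr (a - 1) * z"

definition nonlocal_kernel :: "real \<Rightarrow> real \<Rightarrow> real \<Rightarrow> real \<Rightarrow> ('a::euclidean_space \<times> 'a \<times> real \<Rightarrow> real) \<Rightarrow> bool"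
  where
  "nonlocal_kernel s p \<Lambda> T K \<longleftrightarrow>
     K \<in> borel_measurable (lebesgue_on (UNIV \<times> UNIV \<times> {0<..<T})) \<and>
     (\<forall>x y. \<forall>t\<in>{0<..<T}. K (x, y, t) = K (y, x, t)) \<and>
     (\<forall>t\<in>{0<..<T}. AE z in lebesgue. case z of (x, y) \<Rightarrow>
        inverse \<Lambda> / norm (x - y) powr (real DIM('a) + p * s) \<le> K (x, y, t) \<and>
        K (x, y, t) \<le> \<Lambda> / norm (x - y) powr (real DIM('a) + p * s))"

text \<open>The \<open>p\<close>-th power of the norm of \<open>W\<^sup>s\<^sup>,\<^sup>p(D)\<close>; for measurable \<open>f\<close> it is \<open>\<infinity>\<close> outside of the space.\<close>

definition Wsp_norm_pow :: "real \<Rightarrow> real \<Rightarrow> 'a::euclidean_space set \<Rightarrow> ('a \<Rightarrow> real) \<Rightarrow> ennreal" where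
  "Wsp_norm_pow s p D f =
     (\<integral>\<^sup>+x\<in>D. ennreal (\<bar>f x\<bar> powr p) \<partial>lebesgue) +
     (\<integral>\<^sup>+x\<in>D. (\<integral>\<^sup>+y\<in>D. ennreal (\<bar>f x - f y\<bar> powr p / norm (x - y) powr (real DIM('a) + p * s))
        \<partial>lebesgue) \<partial>lebesgue)"

definition Wsp :: "real \<Rightarrow> real \<Rightarrow> 'a::euclidean_space set \<Rightarrow> ('a \<Rightarrow> real) set" where
  "Wsp s p D = {f \<in> borel_measurable (lebesgue_on D). Wsp_norm_pow s p D f < \<infinity>}"

definition W0sp :: "real \<Rightarrow> real \<Rightarrow> 'a::euclidean_space set \<Rightarrow> ('a \<Rightarrow> real) set" where
  "W0sp s p D = {f \<in> Wsp s p UNIV. AE x in lebesgue. x \<notin> D \<longrightarrow> f x = 0}"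

text \<open>The spaces \<open>L\<^sup>r(a, b; L\<^sup>r(D))\<close>, \<open>L\<^sup>p(a, b; W\<^sup>s\<^sup>,\<^sup>p(D))\<close> and \<open>L\<^sup>p(a, b; W\<^sub>0\<^sup>s\<^sup>,\<^sup>p(D))\<close>.\<close>

definition L_L :: "real \<Rightarrow> real \<Rightarrow> real \<Rightarrow> 'a::euclidean_space set \<Rightarrow> ('a \<times> real \<Rightarrow> real) set" where
  "L_L a b r D = {v \<in> borel_measurable (lebesgue_on (D \<times> {a<..<b})).
     (\<integral>\<^sup>+t\<in>{a<..<b}. (\<integral>\<^sup>+x\<in>D. ennreal (\<bar>v (x, t)\<bar> powr r) \<partial>lebesgue) \<partial>lebesgue) < \<infinity>}"

definition L_Wsp :: "real \<Rightarrow> real \<Rightarrow> real \<Rightarrow> real \<Rightarrow> 'a::euclidean_space set \<Rightarrow> ('a \<times> real \<Rightarrow> real) set"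
  where
  "L_Wsp a b s p D = {v \<in> borel_measurable (lebesgue_on (D \<times> {a<..<b})).
     (\<integral>\<^sup>+t\<in>{a<..<b}. Wsp_norm_pow s p D (\<lambda>x. v (x, t)) \<partial>lebesgue) < \<infinity>}"

definition L_W0sp :: "real \<Rightarrow> real \<Rightarrow> real \<Rightarrow> real \<Rightarrow> 'a::euclidean_space set \<Rightarrow> ('a \<times> real \<Rightarrow> real) set"
  where
  "L_W0sp a b s p D = {v \<in> L_Wsp a b s p UNIV.
     AE t in lebesgue_on {a<..<b}. (\<lambda>x. v (x, t)) \<in> W0sp s p D}"

definition test_fun_time :: "real \<Rightarrow> (real \<Rightarrow> real) set" where
  "test_fun_time T = {\<eta>. (\<forall>k t. (deriv ^^ k) \<eta> differentiable (at t)) \<and>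
     (\<exists>a b. 0 < a \<and> a < b \<and> b < T \<and> (\<forall>t. t \<notin> {a..b} \<longrightarrow> \<eta> t = 0))}"

text \<open>
  \<open>\<psi>\<close> is the weak derivative \<open>\<partial>\<^sub>t\<phi>\<close> and \<open>\<phi> \<in> W\<^sup>1\<^sup>,\<^sup>r\<^sub>l\<^sub>o\<^sub>c(0, T; L\<^sup>r(D))\<close>. The vector-valued identity
  \<open>\<integral> \<phi> \<eta>' dt = - \<integral> \<psi> \<eta> dt\<close> in \<open>L\<^sup>r(D)\<close> is stated pointwise for almost every \<open>x \<in> D\<close>.
\<close>

definition W1r_loc_deriv ::
    "real \<Rightarrow> real \<Rightarrow> 'a::euclidean_space set \<Rightarrow> ('a \<times> real \<Rightarrow> real) \<Rightarrow> ('a \<times> real \<Rightarrow> real) \<Rightarrow> bool" where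
  "W1r_loc_deriv T r D \<phi> \<psi> \<longleftrightarrow>
     (\<forall>a b. 0 < a \<and> a < b \<and> b < T \<longrightarrow> \<phi> \<in> L_L a b r D \<and> \<psi> \<in> L_L a b r D) \<and>
     (\<forall>\<eta>\<in>test_fun_time T. AE x in lebesgue_on D.
        (\<integral>t\<in>{0<..<T}. \<phi> (x, t) * deriv \<eta> t \<partial>lebesgue) =
        - (\<integral>t\<in>{0<..<T}. \<psi> (x, t) * \<eta> t \<partial>lebesgue))"

text \<open>\<open>D \<times> [t\<^sub>1, t\<^sub>2]\<close> is compactly contained in \<open>\<Omega> \<times> (0, T)\<close>.\<close>

definition inner_cylinder ::
    "'a::euclidean_space set \<Rightarrow> real \<Rightarrow> 'a set \<Rightarrow> real \<Rightarrow> real \<Rightarrow> bool" where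
  "inner_cylinder \<Omega> T D t1 t2 \<longleftrightarrow>
     open D \<and> compact (closure D) \<and> closure D \<subseteq> \<Omega> \<and> 0 < t1 \<and> t1 < t2 \<and> t2 < T"

text \<open>
  \<open>B1\<close> and \<open>B2\<close> are the boundary terms at \<open>t1\<close> and \<open>t2\<close>, given as one-sided limits of time averages.
  For \<open>u\<close> and \<open>\<phi>\<close> as below, all integrals converge absolutely.
\<close>

definition weak_subsolution ::
    "real \<Rightarrow> real \<Rightarrow> real \<Rightarrow> ('a::euclidean_space \<times> 'a \<times> real \<Rightarrow> real) \<Rightarrow> 'a set \<Rightarrow> real \<Rightarrow>
     ('a \<times> real \<Rightarrow> real) \<Rightarrow> bool" where
  "weak_subsolution s p q K \<Omega> T u \<longleftrightarrow>
     u \<in> borel_measurable (lebesgue_on (UNIV \<times> {0<..<T})) \<and>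
     (\<exists>M. AE t in lebesgue_on {0<..<T}. AE x in lebesgue. \<bar>u (x, t)\<bar> \<le> M) \<and>
     (\<forall>D t1 t2. inner_cylinder \<Omega> T D t1 t2 \<longrightarrow>
        u \<in> L_L t1 t2 (q + 1) D \<and> u \<in> L_Wsp t1 t2 s p D) \<and>
     (\<forall>D t1 t2 \<phi> \<psi>.
        inner_cylinder \<Omega> T D t1 t2 \<and>
        W1r_loc_deriv T (q + 1) D \<phi> \<psi> \<and>
        (\<forall>a b. 0 < a \<and> a < b \<and> b < T \<longrightarrow> \<phi> \<in> L_W0sp a b s p D) \<and>
        (AE z in lebesgue_on (UNIV \<times> {0<..<T}). 0 \<le> \<phi> z) \<longrightarrow>
        (\<exists>B1 B2.
           ((\<lambda>h. 1 / h * (\<integral>t\<in>{t1..t1 + h}. (\<integral>x\<in>D. spow q (u (x, t)) * \<phi> (x, t) \<partial>lebesgue)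
              \<partial>lebesgue)) \<longlongrightarrow> B1) (at_right 0) \<and>
           ((\<lambda>h. 1 / h * (\<integral>t\<in>{t2 - h..t2}. (\<integral>x\<in>D. spow q (u (x, t)) * \<phi> (x, t) \<partial>lebesgue)
              \<partial>lebesgue)) \<longlongrightarrow> B2) (at_right 0) \<and>
           (\<integral>t\<in>{t1..t2}. (\<integral>x. (\<integral>y. spow (p - 1) (u (x, t) - u (y, t)) * (\<phi> (x, t) - \<phi> (y, t))
              * K (x, y, t) \<partial>lebesgue) \<partial>lebesgue) \<partial>lebesgue)
           - (\<integral>t\<in>{t1..t2}. (\<integral>x\<in>D. spow q (u (x, t)) * \<psi> (x, t) \<partial>lebesgue) \<partial>lebesgue)
           + B2 - B1 \<le> 0))"

definition cylinder :: "real \<Rightarrow> real \<Rightarrow> real \<Rightarrow> 'a::euclidean_space \<times> real \<Rightarrow> real \<Rightarrow> ('a \<times> real) set" where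
  "cylinder s p \<theta> z r =
     ball (fst z) r \<times> {snd z - \<theta> * r powr (s * p) <..< snd z + \<theta> * r powr (s * p)}"

definition usc_reg ::
    "real \<Rightarrow> real \<Rightarrow> real \<Rightarrow> ('a::euclidean_space \<times> real \<Rightarrow> real) \<Rightarrow> 'a \<times> real \<Rightarrow> ereal" where
  "usc_reg s p \<theta> u z =
     Lim (at_right 0) (\<lambda>r. esssup (lebesgue_on (cylinder s p \<theta> z r)) (\<lambda>w. ereal (u w)))"

definition lebesgue_point ::
    "real \<Rightarrow> real \<Rightarrow> real \<Rightarrow> ('a::euclidean_space \<times> real \<Rightarrow> real) \<Rightarrow> 'a \<times> real \<Rightarrow> bool" where
  "lebesgue_point s p \<theta> u z \<longleftrightarrow>
     ((\<lambda>r. 1 / measure lebesgue (cylinder s p \<theta> z r) *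
          (\<integral>w\<in>cylinder s p \<theta> z r. \<bar>u z - u w\<bar> \<partial>lebesgue)) \<longlongrightarrow> 0) (at_right 0)"

definition usc_on :: "'b::topological_space set \<Rightarrow> ('b \<Rightarrow> ereal) \<Rightarrow> bool" where
  "usc_on S f \<longleftrightarrow> (\<forall>z\<in>S. \<forall>c. f z < c \<longrightarrow> (\<forall>\<^sub>F w in at z within S. f w < c))"

end

theory Submission
  imports Defs
begin

text \<open>
  The proof is a De Giorgi iteration. Testing the equation with the forward Steklov average of
  \<open>\<eta>(x)\<^sup>p \<xi>(t) (u - k)\<^sub>+\<close> and letting the averaging parameter tend to \<open>0\<close> gives an energy estimate.
  Convexity handles the difference quotient in time. In the limit of the nonlocal term a Young
  majorant of the same size allows Fatou's lemma, so only one inequality is needed.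

  No Sobolev inequality enters: if \<open>A = {u(\<cdot>, t) > k}\<close> has small measure, each point of a higher
  superlevel set sees much of the complement of \<open>A\<close> nearby, so the part of the nonlocal energy
  that jumps across the level is at least \<open>c |A|\<^sup>-\<^sup>s\<^sup>p\<^sup>/\<^sup>n\<close> times the measure of the higher superlevel
  set. This gain, together with the bound of \<open>|A|\<close> uniformly in \<open>t\<close>, closes the iteration. As \<open>u\<close> is
  globally bounded and all levels stay in an interval \<open>[k\<^sub>0, k\<^sub>1]\<close> that does not contain \<open>0\<close>, neither the
  tail of \<open>u\<close> nor the degeneracy of \<open>|u|\<^sup>q\<^sup>-\<^sup>1u\<close> needs an intrinsic scaling. Hence \<open>u \<le> c + \<epsilon>\<close> almost
  everywhere near any point where the relative measure of \<open>{u > c}\<close> in some small cylinder is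
  below a threshold.
\<close>

section \<open>Elementary inequalities\<close>

text \<open>A subsolution has no time derivative, so only averages in time of its truncations are
  admissible. The direction of the average is forced: with the forward one, the increment of
  |u|^(q-1) u is multiplied by the truncation at the later time, and convexity estimates this
  product from the side that a subsolution needs; a backward average would give the opposite
  inequality. Averaging destroys the sign structure of the nonlocal term, so the truncation
  inequality can be applied only after the limit h \<rightarrow> 0. There the averages need not have
  a common integrable bound, but Jensen's inequality keeps the integral of the majorant from
  growing. The test gives no supremum over time directly. A descent of the time cutoff of free
  length e, starting at an arbitrary time, bounds the mean measure of the slices just after that
  time, and differentiation turns the means into almost every slice. This bound must be in hand
  before the jump energy becomes useful, so one De Giorgi cycle consumes two steps of the sequence
  of levels.\<close>

lemma powr_diff_le:
  fixes \<alpha> \<beta> p :: real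
  assumes "1 \<le> p" "0 \<le> \<alpha>" "\<alpha> \<le> \<beta>"
  shows "\<beta> powr p - \<alpha> powr p \<le> p * \<beta> powr (p - 1) * (\<beta> - \<alpha>)"
proof (cases "\<alpha> = 0 \<or> \<alpha> = \<beta>")
  case True
  have "\<beta> powr p = \<beta> powr (p - 1) * \<beta>" if "\<beta> > 0"
    using that by (simp add: powr_diff)
  then show ?thesis using True assms
    by (cases "\<beta> = 0") (auto simp: mult_le_cancel_right1 intro: order_trans)
next
  case False
  then have "0 < \<alpha>" "\<alpha> < \<beta>" using assms by auto
  moreover have "((\<lambda>x. x powr p) has_real_derivative p * x powr (p - 1)) (at x)" if "\<alpha> \<le> x" for x
    using that \<open>0 < \<alpha>\<close> by (auto intro!: derivative_eq_intros)
  ultimately obtain z where z: "\<alpha> < z" "z < \<beta>" "\<beta> powr p - \<alpha> powr p = (\<beta> - \<alpha>) * (p * z powr (p - 1))"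
    using MVT2[of \<alpha> \<beta> "\<lambda>x. x powr p" "\<lambda>x. p * x powr (p - 1)"] by auto
  have "z powr (p - 1) \<le> \<beta> powr (p - 1)"
    using z \<open>0 < \<alpha>\<close> assms by (intro powr_mono2) auto
  then show ?thesis using z assms by (simp add: mult_left_mono mult.commute)
qed

section \<open>Signed powers\<close>

lemma spow_uminus [simp]: "spow a (- z) = - spow a z"
  by (simp add: spow_def)

lemma spow_zero [simp]: "spow a 0 = 0"
  by (simp add: spow_def)

lemma spow_pos: "0 < z \<Longrightarrow> spow a z = z powr a"
  by (simp add: spow_def powr_diff)

lemma abs_spow: "\<bar>spow a z\<bar> = \<bar>z\<bar> powr a"
  by (cases "z = 0") (auto simp: spow_def abs_mult powr_diff)

lemma spow_mult_self: "spow a z * z = \<bar>z\<bar> powr (a + 1)"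
proof (cases "z = 0")
  case False
  have "spow a z * z = \<bar>z\<bar> powr (a - 1) * (\<bar>z\<bar> * \<bar>z\<bar>)"
    by (simp add: spow_def)
  also have "\<dots> = \<bar>z\<bar> powr (a - 1) * \<bar>z\<bar> powr 2"
    using False by (simp add: powr_numeral power2_eq_square)
  also have "\<dots> = \<bar>z\<bar> powr (a + 1)" by (simp only: powr_add[symmetric]) (simp add: add.commute)
  finally show ?thesis .
qed (simp add: spow_def)

lemma spow_nonneg: "0 \<le> z \<Longrightarrow> 0 \<le> spow a z"
  by (simp add: spow_def)

lemma spow_measurable [measurable]: "spow a \<in> borel_measurable borel"
  unfolding spow_def by measurable

lemma spow_mono:
  assumes "0 < a" "x \<le> y"
  shows "spow a x \<le> spow a y"
proof -
  consider "0 < x" | "x \<le> 0" "0 \<le> y" | "y < 0" by linarith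
  then show ?thesis
  proof cases
    case 1 then show ?thesis using assms by (auto simp: spow_pos intro: powr_mono2)
  next
    case 2
    then have "spow a x \<le> 0" using spow_nonneg[of "-x" a] by simp
    then show ?thesis using spow_nonneg[OF 2(2), of a] by simp
  next
    case 3
    then have "(- y) powr a \<le> (- x) powr a" using assms by (intro powr_mono2) auto
    then have "spow a (- y) \<le> spow a (- x)" using 3 assms by (simp only: spow_pos)
    then show ?thesis by simp
  qed
qed

text \<open>If \<beta> \<le> \<alpha>, the right side is nonnegative. Otherwise put d = a - b and w
  = a - k; since b - k = w - d, the bracket is d \<beta>^p - w (\<beta>^p - \<alpha>^p), and the
  mean value bound for the last difference leaves a gain (d \<beta>)^p and a loss to be compared as
  in Young's inequality.\<close>

lemma truncated_form_lower_aux: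
  fixes a b k p \<alpha> \<beta> M :: real
  assumes p: "1 < p" and ab: "b \<le> a" and nonneg: "0 \<le> \<alpha>" "0 \<le> \<beta>" and M: "a - k \<le> M"
    and kb: "k < b"
  shows "- (p powr p * M powr p * \<bar>\<alpha> - \<beta>\<bar> powr p)
    \<le> spow (p - 1) (a - b) * ((a - k) * \<alpha> powr p - (b - k) * \<beta> powr p)"
proof (cases "\<beta> \<le> \<alpha>")
  case True
  have "(b - k) * \<beta> powr p \<le> (a - k) * \<alpha> powr p"
    using True assms by (intro mult_mono powr_mono2) auto
  then have "0 \<le> spow (p - 1) (a - b) * ((a - k) * \<alpha> powr p - (b - k) * \<beta> powr p)"
    using spow_nonneg[of "a - b" "p - 1"] ab by simp
  then show ?thesis
    by (smt (verit) mult_nonneg_nonneg powr_ge_zero)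
next
  case False
  define d where "d = a - b"
  define w where "w = a - k"
  have w: "0 < w" "w \<le> M" using assms by (auto simp: w_def)
  have split: "spow (p - 1) d * (w * \<alpha> powr p - (b - k) * \<beta> powr p)
      = spow (p - 1) d * d * \<beta> powr p - spow (p - 1) d * w * (\<beta> powr p - \<alpha> powr p)"
    by (simp add: d_def w_def algebra_simps)
  have main: "- (p powr p * w powr p * (\<beta> - \<alpha>) powr p)
      \<le> spow (p - 1) d * d * \<beta> powr p - spow (p - 1) d * w * (\<beta> powr p - \<alpha> powr p)"
  proof (cases "d = 0")
    case True then show ?thesis using w by simp
  next
    case False
    then have d: "0 < d" using ab by (simp add: d_def)
    have \<beta>: "0 < \<beta>" using \<open>\<not> \<beta> \<le> \<alpha>\<close> nonneg by simp
    \<comment> \<open>Chosen so that the loss is at most (d \<beta>)^(p-1) e: for e \<le> d \<beta>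
      the gain (d \<beta>)^p absorbs it, otherwise it is at most e^p, which is the allowed
      error.\<close>
    define e where "e = p * w * (\<beta> - \<alpha>)"
    have e: "0 < e" using \<open>\<not> \<beta> \<le> \<alpha>\<close> w p by (simp add: e_def)
    have "spow (p - 1) d * w * (\<beta> powr p - \<alpha> powr p) \<le> spow (p - 1) d * w * (p * \<beta> powr (p - 1) * (\<beta> - \<alpha>))"
      using p nonneg \<open>\<not> \<beta> \<le> \<alpha>\<close> w d by (intro mult_left_mono powr_diff_le mult_nonneg_nonneg spow_nonneg) auto
    also have "\<dots> = (d * \<beta>) powr (p - 1) * e"
      using d \<beta> by (simp add: spow_pos powr_mult e_def)
    finally have 1: "spow (p - 1) d * w * (\<beta> powr p - \<alpha> powr p) \<le> (d * \<beta>) powr (p - 1) * e" .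
    have 2: "spow (p - 1) d * d * \<beta> powr p = (d * \<beta>) powr (p - 1) * (d * \<beta>)"
      using d \<beta> by (simp add: spow_pos powr_mult powr_diff)
    have 3: "p powr p * w powr p * (\<beta> - \<alpha>) powr p = e powr (p - 1) * e"
      using p w \<open>\<not> \<beta> \<le> \<alpha>\<close> e by (simp add: e_def powr_mult powr_diff)
    show ?thesis
    proof (cases "e \<le> d * \<beta>")
      case True
      then have "(d * \<beta>) powr (p - 1) * e \<le> (d * \<beta>) powr (p - 1) * (d * \<beta>)"
        by (intro mult_left_mono) auto
      moreover have "0 \<le> e powr (p - 1) * e" using e by simp
      ultimately show ?thesis using 1 2 3 by linarith
    next
      case False
      then have "(d * \<beta>) powr (p - 1) * e \<le> e powr (p - 1) * e"
        using d \<beta> p e by (intro mult_right_mono powr_mono2) auto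
      moreover have "0 \<le> (d * \<beta>) powr (p - 1) * (d * \<beta>)" using d \<beta> by simp
      ultimately show ?thesis using 1 2 3 by linarith
    qed
  qed
  have "p powr p * w powr p * (\<beta> - \<alpha>) powr p \<le> p powr p * M powr p * \<bar>\<alpha> - \<beta>\<bar> powr p"
    using w p False by (intro mult_mono powr_mono2) auto
  then show ?thesis using main split by (simp add: d_def w_def)
qed

text \<open>A cutoff error arises only if both values exceed \<open>k\<close>. Of the mixed pairs,
  the orientation with \<open>a\<close> above and \<open>b\<close> below is kept as a gain, because
  then a - b \<ge> a - k; the opposite orientation is dropped as nonnegative. The second level
  \<open>k'\<close> turns the gain into a constant multiple of \<alpha>^p, which
  \<open>jump_lower\<close> will exploit.\<close>

lemma truncated_form_lower:
  fixes a b k k' p \<alpha> \<beta> M :: real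
  assumes p: "1 < p" and nonneg: "0 \<le> \<alpha>" "0 \<le> \<beta>" and M: "a - k \<le> M" "b - k \<le> M" and kk: "k \<le> k'"
  shows "(if k' < a \<and> b \<le> k then (k' - k) powr p * \<alpha> powr p else 0)
      - (if k < a \<and> k < b then p powr p * M powr p * \<bar>\<alpha> - \<beta>\<bar> powr p else 0)
    \<le> spow (p - 1) (a - b) * (max 0 (a - k) * \<alpha> powr p - max 0 (b - k) * \<beta> powr p)"
proof -
  consider "k < a" "k < b" "b \<le> a" | "k < a" "k < b" "a \<le> b" | "k < a" "b \<le> k"
    | "a \<le> k" "k < b" | "a \<le> k" "b \<le> k"
    by linarith
  then show ?thesis
  proof cases
    case 1
    then show ?thesis using truncated_form_lower_aux[of p b a \<alpha> \<beta> k M] assms by auto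
  next
    case 2
    have "spow (p - 1) (a - b) = - spow (p - 1) (b - a)" by (metis minus_diff_eq spow_uminus)
    then show ?thesis using truncated_form_lower_aux[of p a b \<beta> \<alpha> k M] 2 assms
      by (auto simp: abs_minus_commute algebra_simps)
  next
    case 3
    have *: "(a - b) powr (p - 1) * ((a - k) * \<alpha> powr p) = (a - b) powr (p - 1) * (a - k) * \<alpha> powr p" by simp
    have "(k' - k) powr p * \<alpha> powr p \<le> (a - b) powr (p - 1) * (a - k) * \<alpha> powr p" if "k' < a"
    proof (intro mult_right_mono)
      have "(k' - k) powr p \<le> (a - k) powr p" using that kk p by (intro powr_mono2) auto
      also have "\<dots> = (a - k) powr (p - 1) * (a - k)" using 3 by (simp add: powr_diff)
      also have "\<dots> \<le> (a - b) powr (p - 1) * (a - k)"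
        using 3 p by (intro mult_right_mono powr_mono2) auto
      finally show "(k' - k) powr p \<le> (a - b) powr (p - 1) * (a - k)" .
    qed auto
    then show ?thesis using 3 by (auto simp: spow_pos max_def)
  next
    case 4
    then have "spow (p - 1) (a - b) \<le> 0" using spow_nonneg[of "b - a" "p - 1"]
      by (metis diff_ge_0_iff_ge dual_order.strict_trans2 less_imp_le minus_diff_eq neg_0_le_iff_le spow_uminus)
    then show ?thesis using 4 kk by (auto simp: max_def mult_nonpos_nonneg intro!: mult_nonneg_nonneg)
  next
    case 5 then show ?thesis using kk by (auto simp: max_def)
  qed
qed

section \<open>Convex potential of the signed power and its Bregman distance\<close>

definition bpot :: "real \<Rightarrow> real \<Rightarrow> real" where
  "bpot q z = \<bar>z\<bar> powr (q + 1) / (q + 1)"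

text \<open>Convexity of the primitive of \<open>spow q\<close>, read off from Young's inequality
  with the exponents (q + 1) / q and q + 1, which treats all signs and all q > 0 at once. With q = p
  - 1 it also serves as the tangent inequality of |y|^p in Jensen's inequality.\<close>

lemma bpot_tangent:
  assumes "0 < q"
  shows "spow q x * (y - x) \<le> bpot q y - bpot q x"
proof -
  have "\<bar>x\<bar> powr q * \<bar>y\<bar> \<le> (\<bar>x\<bar> powr q) powr ((q + 1) / q) / ((q + 1) / q) + \<bar>y\<bar> powr (q + 1) / (q + 1)"
    using assms by (intro Youngs_inequality) (auto simp: field_simps)
  also have "(\<bar>x\<bar> powr q) powr ((q + 1) / q) = \<bar>x\<bar> powr (q + 1)"
    using assms by (simp add: powr_powr)
  finally have 1: "\<bar>x\<bar> powr q * \<bar>y\<bar> \<le> q * \<bar>x\<bar> powr (q + 1) / (q + 1) + \<bar>y\<bar> powr (q + 1) / (q + 1)"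
    by (simp add: mult.commute)
  have 2: "spow q x * y \<le> \<bar>x\<bar> powr q * \<bar>y\<bar>"
    by (metis abs_ge_self abs_mult abs_spow)
  have 3: "q * \<bar>x\<bar> powr (q + 1) / (q + 1) - \<bar>x\<bar> powr (q + 1) = - (\<bar>x\<bar> powr (q + 1) / (q + 1))"
    using assms by (simp add: field_simps)
  show ?thesis using 1 2 3 by (simp add: bpot_def right_diff_distrib spow_mult_self)
qed

text \<open>For \<open>z \<ge> k\<close> this is the Bregman distance \<open>\<integral>\<^sub>k\<^sup>z (spow q z - spow q \<tau>) d\<tau>\<close>, the primitive
  of \<open>(z - k)\<^sub>+\<close> with respect to \<open>d(spow q z)\<close>.\<close>

definition bregman :: "real \<Rightarrow> real \<Rightarrow> real \<Rightarrow> real" where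
  "bregman q k z = spow q z * max 0 (z - k) - (bpot q (max z k) - bpot q k)"

lemma bpot_measurable [measurable]: "bpot q \<in> borel_measurable borel"
  unfolding bpot_def by measurable

lemma bregman_measurable [measurable]: "bregman q k \<in> borel_measurable borel"
  unfolding bregman_def by measurable

text \<open>A discrete chain rule: the tangent of the potential at \<open>max w k\<close> gives it,
  and for w < k the slope \<open>spow q k\<close> may be lowered to \<open>spow q w\<close> because
  \<open>max u k\<close> is then at least \<open>max w k\<close>. The truncation is taken at
  \<open>u\<close>, which is the value at the later time in \<open>time_term_le\<close>.\<close>

lemma bregman_diff_le:
  assumes "0 < q"
  shows "bregman q k u - bregman q k w \<le> (spow q u - spow q w) * max 0 (u - k)"
proof -
  have "spow q w * (max u k - max w k) \<le> spow q (max w k) * (max u k - max w k)"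
  proof (cases "k \<le> w")
    case False
    then show ?thesis using spow_mono[OF assms, of w k] by (auto simp: max_def intro!: mult_right_mono)
  qed (simp add: max_def)
  also have "\<dots> \<le> bpot q (max u k) - bpot q (max w k)" by (rule bpot_tangent[OF assms])
  finally have "spow q w * (max u k - max w k) \<le> bpot q (max u k) - bpot q (max w k)" .
  moreover have "max u k - max w k = max 0 (u - k) - max 0 (w - k)" by auto
  ultimately show ?thesis by (simp add: bregman_def algebra_simps)
qed

lemma bregman_eq_0: "z \<le> k \<Longrightarrow> bregman q k z = 0"
  by (simp add: bregman_def max_def)

lemma bregman_nonneg: "0 < q \<Longrightarrow> 0 \<le> bregman q k z"
  using bregman_diff_le[of q k k z] by (simp add: bregman_eq_0)

lemma bregman_le:
  assumes "0 < q" "\<bar>z\<bar> \<le> M" "\<bar>k\<bar> \<le> M"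
  shows "bregman q k z \<le> 4 * M * M powr q"
proof -
  have "bregman q k z \<le> (spow q z - spow q k) * max 0 (z - k)"
    using bregman_diff_le[OF assms(1), of k z k] by (simp add: bregman_eq_0)
  also have "\<dots> \<le> (2 * M powr q) * (2 * M)"
  proof (rule mult_mono)
    have "\<bar>spow q z\<bar> \<le> M powr q" "\<bar>spow q k\<bar> \<le> M powr q"
      using assms by (auto simp: abs_spow intro!: powr_mono2)
    then show "spow q z - spow q k \<le> 2 * M powr q" by linarith
  qed (use assms in auto)
  finally show ?thesis by (simp add: mult_ac)
qed

text \<open>Restrict the integral behind \<open>bregman\<close> to the lower half [k, m] of [k, k']:
  there the integrand is at least \<open>spow q u - spow q m\<close>, and u \<ge> k' makes this at
  least c0 (k' - m). So the slope bound is used only on [k, k'], however large \<open>u\<close>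
  is.\<close>

lemma bregman_lower:
  assumes q: "0 < q" and "0 \<le> c0" and kk: "k < k'" "k' \<le> u"
    and slope: "\<And>x y. k \<le> x \<Longrightarrow> x \<le> y \<Longrightarrow> y \<le> k' \<Longrightarrow> c0 * (y - x) \<le> spow q y - spow q x"
  shows "c0 * (k' - k)\<^sup>2 / 4 \<le> bregman q k u"
proof -
  define m where "m = (k + k') / 2"
  have m: "k < m" "m < k'" using kk by (auto simp: m_def)
  have 1: "bpot q u - bpot q m \<le> spow q u * (u - m)"
    using bpot_tangent[OF q, of u m] by (simp add: algebra_simps)
  have 2: "bpot q m - bpot q k \<le> spow q m * (m - k)"
    using bpot_tangent[OF q, of m k] by (simp add: algebra_simps)
  have "bregman q k u = spow q u * (u - k) - (bpot q u - bpot q k)"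
    using kk by (simp add: bregman_def)
  then have "(spow q u - spow q m) * (m - k) \<le> bregman q k u"
    using 1 2 by (simp add: algebra_simps)
  moreover have "c0 * (k' - m) * (m - k) \<le> (spow q u - spow q m) * (m - k)"
    using slope[of m k'] spow_mono[OF q kk(2)] m by (intro mult_right_mono) auto
  moreover have "c0 * (k' - m) * (m - k) = c0 * (k' - k)\<^sup>2 / 4"
    by (simp add: m_def field_simps power2_eq_square)
  ultimately show ?thesis by linarith
qed

text \<open>The derivative q |z|^(q-1) is monotone in |z|, so on an interval on one side of 0 it is
  bounded below by its value at an end point; which one depends on the sign of q - 1, hence the
  minimum. An interval around 0 is impossible for q > 1, where the derivative vanishes at 0. The
  negative side follows from oddness.\<close>

lemma spow_slope:
  assumes q: "0 < q" and kk: "k0 < k1" and "0 < k0 \<or> k1 < 0"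
  obtains c0 where "0 < c0"
    "\<And>x y. k0 \<le> x \<Longrightarrow> x \<le> y \<Longrightarrow> y \<le> k1 \<Longrightarrow> c0 * (y - x) \<le> spow q y - spow q x"
proof -
  have pos: "\<exists>c0>0. \<forall>x y. l \<le> x \<longrightarrow> x \<le> y \<longrightarrow> y \<le> m \<longrightarrow> c0 * (y - x) \<le> spow q y - spow q x"
    if "0 < l" "l < m" for l m
  proof -
    define c0 where "c0 = q * min (l powr (q - 1)) (m powr (q - 1))"
    have c0: "0 < c0" using that q by (simp add: c0_def)
    have "c0 * (y - x) \<le> spow q y - spow q x" if xy: "l \<le> x" "x \<le> y" "y \<le> m" for x y
    proof (cases "x = y")
      case False
      have "((\<lambda>x. x powr q) has_real_derivative q * z powr (q - 1)) (at z)" if "x \<le> z" for z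
        using that \<open>0 < l\<close> xy by (auto intro!: derivative_eq_intros)
      then obtain z where z: "x < z" "z < y" "y powr q - x powr q = (y - x) * (q * z powr (q - 1))"
        using MVT2[of x y "\<lambda>x. x powr q" "\<lambda>x. q * x powr (q - 1)"] False xy by auto
      have "min (l powr (q - 1)) (m powr (q - 1)) \<le> z powr (q - 1)"
      proof (cases "1 \<le> q")
        case True
        then have "l powr (q - 1) \<le> z powr (q - 1)" using z xy \<open>0 < l\<close> by (intro powr_mono2) auto
        then show ?thesis by simp
      next
        case False
        then have "m powr (q - 1) \<le> z powr (q - 1)" using z xy \<open>0 < l\<close> by (intro powr_mono2') auto
        then show ?thesis by simp
      qed
      then have "c0 \<le> q * z powr (q - 1)" using q by (simp add: c0_def)
      then have "c0 * (y - x) \<le> (q * z powr (q - 1)) * (y - x)" using xy by (intro mult_right_mono) auto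
      then show ?thesis using z xy \<open>0 < l\<close> by (simp add: spow_pos mult.commute)
    qed simp
    then show ?thesis using c0 by blast
  qed
  show ?thesis
  proof (cases "0 < k0")
    case True then show ?thesis using pos[of k0 k1] kk that by blast
  next
    case False
    then have "0 < - k1" "- k1 < - k0" using assms by auto
    from pos[OF this] obtain c0 where c0: "0 < c0"
      "\<And>x y. - k1 \<le> x \<Longrightarrow> x \<le> y \<Longrightarrow> y \<le> - k0 \<Longrightarrow> c0 * (y - x) \<le> spow q y - spow q x" by blast
    show ?thesis
    proof (rule that[OF c0(1)])
      fix x y assume "k0 \<le> x" "x \<le> y" "y \<le> k1"
      then show "c0 * (y - x) \<le> spow q y - spow q x" using c0(2)[of "- y" "- x"] by simp
    qed
  qed
qed

text \<open>The starting bound is the number \<nu> with C \<nu>^\<kappa> = l, where l^\<kappa> = 1 /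
  B. Then the bound \<nu> l^i reproduces itself: the growing factor B^i is cancelled by
  (l^i)^\<kappa>.\<close>

lemma fast_geometric_convergence:
  fixes Y :: "nat \<Rightarrow> real"
  assumes Y: "\<And>i. 0 \<le> Y i" and C: "0 < C" and B: "1 < B" and \<kappa>: "0 < \<kappa>"
    and rec: "\<And>i. Y (Suc i) \<le> C * B ^ i * Y i powr (1 + \<kappa>)"
    and start: "Y 0 \<le> (B powr (- 1 / \<kappa>) / C) powr (1 / \<kappa>)"
  shows "Y \<longlonglongrightarrow> 0"
proof -
  define l where "l = B powr (- 1 / \<kappa>)"
  define \<nu> where "\<nu> = (l / C) powr (1 / \<kappa>)"
  have l: "0 < l" "l < 1" using B \<kappa> powr_less_one[of B "- 1 / \<kappa>"] by (auto simp: l_def)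
  have \<nu>: "0 < \<nu>" using l C by (simp add: \<nu>_def)
  have \<nu>\<kappa>: "C * \<nu> powr \<kappa> = l" using l C \<kappa> by (simp add: \<nu>_def powr_powr)
  have "l powr \<kappa> = B powr (- 1)" using \<kappa> unfolding l_def powr_powr by simp
  then have l\<kappa>: "l powr \<kappa> = 1 / B" using B by (simp add: powr_minus_divide)
  have Yl: "Y i \<le> \<nu> * l ^ i" for i
  proof (induction i)
    case 0 then show ?case using start by (simp add: \<nu>_def l_def)
  next
    case (Suc i)
    have pos: "0 < \<nu> * l ^ i" using \<nu> l by simp
    have "Y (Suc i) \<le> C * B ^ i * Y i powr (1 + \<kappa>)" by (rule rec)
    also have "\<dots> \<le> C * B ^ i * (\<nu> * l ^ i) powr (1 + \<kappa>)"
      using Suc Y C B \<kappa> by (intro mult_left_mono powr_mono2) auto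
    also have "(\<nu> * l ^ i) powr (1 + \<kappa>) = \<nu> * l ^ i * (\<nu> powr \<kappa> * (l ^ i) powr \<kappa>)"
      using pos \<nu> l by (simp add: powr_add powr_mult)
    also have "(l ^ i) powr \<kappa> = (1 / B) ^ i"
      using l by (simp add: l\<kappa>[symmetric] powr_realpow[symmetric] powr_powr mult.commute)
    also have "C * B ^ i * (\<nu> * l ^ i * (\<nu> powr \<kappa> * (1 / B) ^ i)) = (C * \<nu> powr \<kappa>) * (\<nu> * l ^ i) * (B * (1 / B)) ^ i"
      by (simp add: power_mult_distrib mult_ac del: mult_1_right times_divide_eq_right)
    also have "\<dots> = \<nu> * l ^ Suc i" using B by (simp add: \<nu>\<kappa>)
    finally show ?case .
  qed
  have "(\<lambda>i. \<nu> * l ^ i) \<longlonglongrightarrow> \<nu> * 0"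
    using l by (intro tendsto_mult tendsto_const LIMSEQ_power_zero) auto
  then have "(\<lambda>i. \<nu> * l ^ i) \<longlonglongrightarrow> 0" by simp
  then show ?thesis
    by (rule tendsto_sandwich[OF _ _ tendsto_const, rotated 2]) (use Y Yl in auto)
qed

section \<open>Integrals of the fractional kernel\<close>

lemma dyadic_shell_ge_1:
  fixes d :: real assumes "1 \<le> d"
  obtains i where "2 ^ i \<le> d" "d < 2 ^ Suc i"
proof -
  obtain n where n: "d < 2 ^ n" using real_arch_pow[of 2 d] by auto
  define n0 where "n0 = (LEAST n. d < 2 ^ n)"
  have "d < 2 ^ n0" unfolding n0_def using n by (rule LeastI)
  moreover from this have "n0 \<noteq> 0" using assms by (intro notI) simp
  then obtain i where i: "n0 = Suc i" by (cases n0) auto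
  moreover have "\<not> d < 2 ^ i" using not_less_Least[of i "\<lambda>n. d < 2 ^ n"] i by (simp add: n0_def)
  ultimately show ?thesis using that[of i] by auto
qed

lemma dyadic_shell_less_1:
  fixes d :: real assumes "0 < d" "d < 1"
  obtains i where "(1/2) ^ Suc i \<le> d" "d < (1/2) ^ i"
proof -
  obtain n where n: "(1/2) ^ n < d" using real_arch_pow_inv[of d "1/2"] assms by auto
  define n0 where "n0 = (LEAST n. (1/2) ^ n \<le> d)"
  have "(1/2) ^ n0 \<le> d" unfolding n0_def by (rule LeastI[of _ n]) (rule less_imp_le[OF n])
  moreover from this have "n0 \<noteq> 0" using assms by (intro notI) simp
  then obtain i where i: "n0 = Suc i" by (cases n0) auto
  moreover have "\<not> (1/2) ^ i \<le> d" using not_less_Least[of i "\<lambda>n. (1/2) ^ n \<le> d"] i by (simp add: n0_def)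
  ultimately show ?thesis using that[of i] by auto
qed

lemma ennreal_le_suminf: "f i \<le> (\<Sum>i. f i)" for f :: "nat \<Rightarrow> ennreal"
  using sum_le_suminf[of f "{i}"] by simp

lemma emeasure_ball_powr:
  fixes x :: "'a::euclidean_space"
  assumes "0 < r"
  shows "emeasure lborel (ball x r) = ennreal (unit_ball_vol (real DIM('a)) * r powr real DIM('a))"
  using assms by (simp add: emeasure_ball powr_realpow)

text \<open>The numerator bounds the p-th power of an increment of a cutoff with Lipschitz constant
  L. Split into dyadic shells of d = L |x - y|: outside d = 1 they contribute with ratio
  2^(-\<sigma>), inside with ratio 2^(\<sigma> - p), so the two restrictions on \<sigma> make the
  two series converge, and the scale 1 / L produces the factor L^\<sigma>.\<close>

lemma cutoff_kernel_integral:
  fixes \<sigma> p :: real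
  assumes "0 < \<sigma>" "\<sigma> < p"
  obtains C where "0 < C"
    "\<And>L (x::'a::euclidean_space). 0 < L \<Longrightarrow>
      (\<integral>\<^sup>+y. ennreal (min 1 (L * norm (x - y)) powr p / norm (x - y) powr (real DIM('a) + \<sigma>)) \<partial>lborel)
        \<le> ennreal (C * L powr \<sigma>)"
proof -
  define n where "n = real DIM('a)"
  define m where "m = n + \<sigma>"
  define \<omega> where "\<omega> = unit_ball_vol n"
  have n: "0 < n" by (simp add: n_def)
  have \<omega>: "0 < \<omega>" using n by (simp add: \<omega>_def)
  define r1 where "r1 = 2 powr (- \<sigma>)"
  define r2 where "r2 = (1/2) powr (p - \<sigma>)"
  have r1: "0 < r1" "r1 < 1" using assms powr_less_one[of 2 "- \<sigma>"] by (auto simp: r1_def)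
  have r2: "0 < r2" "r2 < 1" using assms powr_less_one[of 2 "- (p - \<sigma>)"]
    by (auto simp: r2_def powr_divide powr_minus_divide)
  define C where "C = \<omega> * 2 powr n * (1 / (1 - r1)) + \<omega> * 2 powr m * (1 / (1 - r2))"
  have "0 < C" unfolding C_def using \<omega> r1 r2 by (intro add_pos_pos mult_pos_pos) auto
  moreover have "(\<integral>\<^sup>+y. ennreal (min 1 (L * norm (x - y)) powr p / norm (x - y) powr (real DIM('a) + \<sigma>)) \<partial>lborel)
        \<le> ennreal (C * L powr \<sigma>)" if L: "0 < L" for L and x :: 'a
  proof -
    \<comment> \<open>Bounds on a shell: the singular power is taken at the inner radius and, for d
      < 1, the numerator at the outer radius. The shell is then enlarged to the full ball of its
      outer radius.\<close>
    define c1 where "c1 i = (2 ^ i / L) powr (- m)" for i :: nat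
    define c2 where "c2 i = ((1/2) ^ i) powr p * ((1/2) ^ i / L / 2) powr (- m)" for i :: nat
    define T1 where "T1 i y = ennreal (c1 i) * indicator (ball x (2 * (2 ^ i / L))) y" for i and y :: 'a
    define T2 where "T2 i y = ennreal (c2 i) * indicator (ball x ((1/2) ^ i / L)) y" for i and y :: 'a
    have [measurable]: "T1 i \<in> borel_measurable borel" "T2 i \<in> borel_measurable borel" for i
        unfolding T1_def T2_def
      by (auto intro!: borel_measurable_times_ennreal borel_measurable_const borel_measurable_indicator)
    have ptw: "ennreal (min 1 (L * norm (x - y)) powr p / norm (x - y) powr m) \<le> (\<Sum>i. T1 i y) + (\<Sum>i. T2 i y)"
      (is "?f \<le> _") for y
    proof -
      define d where "d = L * norm (x - y)"
      have nd: "norm (x - y) = d / L" using L by (simp add: d_def)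
      have "0 \<le> d" using L by (simp add: d_def)
      then consider "d = 0" | "0 < d" "d < 1" | "1 \<le> d" by linarith
      then show ?thesis
      proof cases
        case 1 then show ?thesis using nd by simp
      next
        case 2
        then obtain i where i: "(1/2) ^ Suc i \<le> d" "d < (1/2) ^ i" using dyadic_shell_less_1 by metis
        have "min 1 d powr p / (d / L) powr m = d powr p * (d / L) powr (- m)"
          using 2 by (simp add: powr_minus divide_inverse)
        also have "\<dots> \<le> c2 i"
          unfolding c2_def using i 2 assms L n
          by (intro mult_mono powr_mono2 powr_mono2') (auto simp: m_def field_simps)
        finally have "?f \<le> ennreal (c2 i)" unfolding nd using L by (auto simp: d_def intro: ennreal_leI)
        also have "\<dots> = T2 i y" using divide_strict_right_mono[OF i(2) L] nd by (simp add: T2_def dist_norm)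
        also have "\<dots> \<le> (\<Sum>i. T2 i y)" by (rule ennreal_le_suminf)
        finally show ?thesis by (simp add: add_increasing)
      next
        case 3
        then obtain i where i: "2 ^ i \<le> d" "d < 2 ^ Suc i" using dyadic_shell_ge_1 by metis
        have "min 1 d powr p / (d / L) powr m = (d / L) powr (- m)"
          using 3 by (simp add: powr_minus divide_inverse)
        also have "\<dots> \<le> c1 i"
          unfolding c1_def using i 3 assms L n
          by (intro powr_mono2') (auto simp: m_def field_simps)
        finally have "?f \<le> ennreal (c1 i)" unfolding nd using L by (auto simp: d_def intro: ennreal_leI)
        also have "\<dots> = T1 i y" using divide_strict_right_mono[OF i(2) L] nd by (simp add: T1_def dist_norm)
        also have "\<dots> \<le> (\<Sum>i. T1 i y)" by (rule ennreal_le_suminf)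
        finally show ?thesis by (simp add: add_increasing2)
      qed
    qed
    have 1: "(\<integral>\<^sup>+y. T1 i y \<partial>lborel) = ennreal (\<omega> * 2 powr n * L powr \<sigma> * r1 ^ i)" for i
    proof -
      define e where "e = 2 ^ i / L"
      have e: "0 < e" using L by (simp add: e_def)
      have "(\<integral>\<^sup>+y. T1 i y \<partial>lborel) = ennreal (c1 i) * ennreal (\<omega> * (2 * e) powr n)"
        using e by (simp add: T1_def nn_integral_cmult_indicator emeasure_ball_powr \<omega>_def n_def e_def[symmetric])
      also have "\<dots> = ennreal (c1 i * (\<omega> * (2 * e) powr n))"
        using \<omega> by (simp add: ennreal_mult c1_def)
      also have "c1 i * (\<omega> * (2 * e) powr n) = \<omega> * 2 powr n * (e powr (- m) * e powr n)"
        using e by (simp add: c1_def e_def[symmetric] powr_mult mult_ac)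
      also have "e powr (- m) * e powr n = e powr (- \<sigma>)" by (simp add: powr_add[symmetric] m_def)
      also have "e powr (- \<sigma>) = L powr \<sigma> * r1 ^ i"
      proof -
        have "(2 ^ i :: real) powr (- \<sigma>) = (2 powr real i) powr (- \<sigma>)" by (subst powr_realpow) auto
        also have "\<dots> = (2 powr (- \<sigma>)) powr real i" by (simp only: powr_powr mult.commute)
        also have "\<dots> = r1 ^ i" using r1 by (subst powr_realpow) (auto simp: r1_def)
        finally have "(2 ^ i :: real) powr (- \<sigma>) = r1 ^ i" .
        moreover have "e powr (- \<sigma>) = L powr \<sigma> * (2 ^ i) powr (- \<sigma>)"
          using L by (simp add: e_def powr_divide powr_minus_divide)
        ultimately show ?thesis by simp
      qed
      finally show ?thesis by (simp add: mult.assoc)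
    qed
    have 2: "(\<integral>\<^sup>+y. T2 i y \<partial>lborel) = ennreal (\<omega> * 2 powr m * L powr \<sigma> * r2 ^ i)" for i
    proof -
      define e where "e = (1/2) ^ i / L"
      have e: "0 < e" using L by (simp add: e_def)
      have "(\<integral>\<^sup>+y. T2 i y \<partial>lborel) = ennreal (c2 i) * ennreal (\<omega> * e powr n)"
        using e by (simp add: T2_def nn_integral_cmult_indicator emeasure_ball_powr \<omega>_def n_def e_def[symmetric])
      also have "\<dots> = ennreal (c2 i * (\<omega> * e powr n))"
        using \<omega> by (simp add: ennreal_mult c2_def)
      also have "c2 i * (\<omega> * e powr n) = \<omega> * 2 powr m * ((1/2) ^ i) powr p * (e powr (- m) * e powr n)"
      proof -
        have "c2 i = ((1/2) ^ i) powr p * (e / 2) powr (- m)" by (simp only: c2_def e_def)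
        moreover have "(e / 2) powr (- m) = 2 powr m * e powr (- m)"
          using e by (simp add: powr_divide powr_minus_divide)
        ultimately show ?thesis by (simp only: mult_ac)
      qed
      also have "e powr (- m) * e powr n = e powr (- \<sigma>)" by (simp add: powr_add[symmetric] m_def)
      also have "e powr (- \<sigma>) = L powr \<sigma> * ((1/2) ^ i) powr (- \<sigma>)"
      proof -
        have "0 < (1/2::real) ^ i" by simp
        then show ?thesis using L unfolding e_def
          by (simp add: powr_divide powr_minus_divide del: power_one_over)
      qed
      also have "\<omega> * 2 powr m * ((1/2) ^ i) powr p * (L powr \<sigma> * ((1/2) ^ i) powr (- \<sigma>))
         = \<omega> * 2 powr m * L powr \<sigma> * (((1/2) ^ i) powr p * ((1/2) ^ i) powr (- \<sigma>))" by (simp add: mult_ac)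
      also have "((1/2) ^ i) powr p * ((1/2) ^ i) powr (- \<sigma>) = ((1/2::real) ^ i) powr (p - \<sigma>)"
        by (simp add: powr_add[symmetric] del: power_one_over)
      also have "\<dots> = r2 ^ i"
      proof -
        have "((1/2::real) ^ i) powr (p - \<sigma>) = ((1/2) powr real i) powr (p - \<sigma>)" by (subst powr_realpow) auto
        also have "\<dots> = ((1/2) powr (p - \<sigma>)) powr real i" by (simp only: powr_powr mult.commute)
        also have "\<dots> = r2 ^ i" using r2 by (subst powr_realpow) (auto simp: r2_def)
        finally show ?thesis .
      qed
      finally show ?thesis .
    qed
    have "(\<integral>\<^sup>+y. ennreal (min 1 (L * norm (x - y)) powr p / norm (x - y) powr m) \<partial>lborel)
        \<le> (\<integral>\<^sup>+y. (\<Sum>i. T1 i y) + (\<Sum>i. T2 i y) \<partial>lborel)"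
      by (intro nn_integral_mono ptw)
    also have "\<dots> = (\<Sum>i. \<integral>\<^sup>+y. T1 i y \<partial>lborel) + (\<Sum>i. \<integral>\<^sup>+y. T2 i y \<partial>lborel)"
      by (simp add: nn_integral_add nn_integral_suminf)
    also have "(\<Sum>i. \<integral>\<^sup>+y. T1 i y \<partial>lborel) = ennreal (\<omega> * 2 powr n * L powr \<sigma> * (1 / (1 - r1)))"
      unfolding 1 using r1 \<omega> by (intro suminf_ennreal_eq sums_mult geometric_sums) auto
    also have "(\<Sum>i. \<integral>\<^sup>+y. T2 i y \<partial>lborel) = ennreal (\<omega> * 2 powr m * L powr \<sigma> * (1 / (1 - r2)))"
      unfolding 2 using r2 \<omega> by (intro suminf_ennreal_eq sums_mult geometric_sums) auto
    also have "ennreal (\<omega> * 2 powr n * L powr \<sigma> * (1 / (1 - r1))) + ennreal (\<omega> * 2 powr m * L powr \<sigma> * (1 / (1 - r2)))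
        = ennreal (C * L powr \<sigma>)"
      using r1 r2 \<omega> by (subst ennreal_plus[symmetric]) (auto simp: C_def algebra_simps)
    finally show ?thesis by (simp add: m_def n_def)
  qed
  ultimately show ?thesis using that by blast
qed

text \<open>For |x - y| \<ge> \<rho> the cutoff factor with L = 1 / \<rho> equals 1, so the tail is
  part of the previous integral; the exponent \<sigma> + 1 there is just some number above
  \<sigma>.\<close>

lemma kernel_tail_integral:
  fixes \<sigma> :: real
  assumes "0 < \<sigma>"
  obtains C where "0 < C"
    "\<And>\<rho> (x::'a::euclidean_space). 0 < \<rho> \<Longrightarrow>
      (\<integral>\<^sup>+y. ennreal (1 / norm (x - y) powr (real DIM('a) + \<sigma>)) * indicator {y. \<rho> \<le> norm (x - y)} y \<partial>lborel)
        \<le> ennreal (C * \<rho> powr (- \<sigma>))"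
proof -
  obtain C where C: "0 < C" "\<And>L (x::'a). 0 < L \<Longrightarrow>
      (\<integral>\<^sup>+y. ennreal (min 1 (L * norm (x - y)) powr (\<sigma> + 1) / norm (x - y) powr (real DIM('a) + \<sigma>)) \<partial>lborel)
        \<le> ennreal (C * L powr \<sigma>)"
    using cutoff_kernel_integral[of \<sigma> "\<sigma> + 1", where 'a='a] assms by auto
  show ?thesis
  proof (rule that[OF C(1)])
    fix \<rho> :: real and x :: 'a assume \<rho>: "0 < \<rho>"
    have "(\<integral>\<^sup>+y. ennreal (1 / norm (x - y) powr (real DIM('a) + \<sigma>)) * indicator {y. \<rho> \<le> norm (x - y)} y \<partial>lborel)
      \<le> (\<integral>\<^sup>+y. ennreal (min 1 (1 / \<rho> * norm (x - y)) powr (\<sigma> + 1) / norm (x - y) powr (real DIM('a) + \<sigma>)) \<partial>lborel)"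
      using \<rho> by (intro nn_integral_mono) (auto simp: indicator_def field_simps min_def)
    also have "\<dots> \<le> ennreal (C * (1 / \<rho>) powr \<sigma>)" using \<rho> by (intro C(2)) auto
    also have "(1 / \<rho>) powr \<sigma> = \<rho> powr (- \<sigma>)" using \<rho> by (simp add: powr_divide powr_minus_divide)
    finally show "(\<integral>\<^sup>+y. ennreal (1 / norm (x - y) powr (real DIM('a) + \<sigma>)) * indicator {y. \<rho> \<le> norm (x - y)} y \<partial>lborel)
        \<le> ennreal (C * \<rho> powr (- \<sigma>))" .
  qed
qed

section \<open>Steklov averages\<close>

lemma fst_borel_measurable [measurable]:
  "(fst :: 'a::second_countable_topology \<times> 'b::second_countable_topology \<Rightarrow> 'a) \<in> borel \<rightarrow>\<^sub>M borel"
  by (simp add: borel_prod[symmetric])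

lemma snd_borel_measurable [measurable]:
  "(snd :: 'a::second_countable_topology \<times> 'b::second_countable_topology \<Rightarrow> 'b) \<in> borel \<rightarrow>\<^sub>M borel"
  by (simp add: borel_prod[symmetric])

lemma nn_integral_lborel_shift:
  fixes f :: "'a::euclidean_space \<Rightarrow> ennreal"
  assumes [measurable]: "f \<in> borel_measurable borel"
  shows "(\<integral>\<^sup>+z. f (c + z) \<partial>lborel) = (\<integral>\<^sup>+z. f z \<partial>lborel)"
proof -
  have "(\<integral>\<^sup>+z. f z \<partial>lborel) = (\<integral>\<^sup>+z. f z \<partial>distr lborel borel ((+) c))"
    by (simp add: lborel_distr_plus)
  also have "\<dots> = (\<integral>\<^sup>+z. f (c + z) \<partial>lborel)" by (rule nn_integral_distr) auto
  finally show ?thesis by simp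
qed

lemma integral_lborel_shift:
  fixes f :: "'a::euclidean_space \<Rightarrow> real"
  assumes [measurable]: "f \<in> borel_measurable borel"
  shows "(\<integral>z. f (c + z) \<partial>lborel) = (\<integral>z. f z \<partial>lborel)"
proof -
  have "(\<integral>z. f z \<partial>lborel) = (\<integral>z. f z \<partial>distr lborel borel ((+) c))"
    by (simp add: lborel_distr_plus)
  also have "\<dots> = (\<integral>z. f (c + z) \<partial>lborel)" by (rule integral_distr) auto
  finally show ?thesis by simp
qed

lemma integrable_bounded_support:
  fixes f :: "'a::euclidean_space \<Rightarrow> real"
  assumes [measurable]: "f \<in> borel_measurable borel" "S \<in> sets borel" and S: "bounded S"
    and f: "\<And>x. \<bar>f x\<bar> \<le> C" "\<And>x. x \<notin> S \<Longrightarrow> f x = 0"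
  shows "integrable lborel f"
proof (rule Bochner_Integration.integrable_bound[of _ "\<lambda>x. indicator S x * C"])
  have "emeasure lborel S < \<infinity>" using S by (rule emeasure_bounded_finite)
  then show "integrable lborel (\<lambda>x. indicator S x * C)" by (intro integrable_mult_left) auto
  show "AE x in lborel. norm (f x) \<le> norm (indicator S x * C)"
    using f by (intro AE_I2) (auto simp: indicator_def, metis abs_ge_self order_trans)
qed simp

text \<open>The average over times [t, t + h]. A function supported in the times [a, b] is averaged
  into one supported in [a - h, b], so room of size h is needed before \<open>a\<close> and none
  after \<open>b\<close>; the derivative in time is the forward difference quotient.\<close>

definition steklov :: "real \<Rightarrow> (real \<times> 'a \<Rightarrow> real) \<Rightarrow> real \<times> 'a \<Rightarrow> real" where
  "steklov h g z = (1 / h) * (\<integral>\<tau>. indicator {0..h} \<tau> * g (fst z + \<tau>, snd z) \<partial>lborel)"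

lemma steklov_measurable [measurable]:
  fixes g :: "real \<times> 'a::euclidean_space \<Rightarrow> real"
  assumes [measurable]: "g \<in> borel_measurable borel"
  shows "steklov h g \<in> borel_measurable borel"
  unfolding steklov_def by measurable

lemma steklov_section_integrable:
  fixes g :: "real \<times> 'a::euclidean_space \<Rightarrow> real"
  assumes [measurable]: "g \<in> borel_measurable borel" and "\<And>z. \<bar>g z\<bar> \<le> C"
  shows "integrable lborel (\<lambda>\<tau>. indicator {0..h} \<tau> * g (t + \<tau>, x))"
  by (rule integrable_bounded_support[of _ "{0..h}" C])
     (use assms order_trans[OF abs_ge_zero assms(2)] in \<open>auto simp: indicator_def\<close>)

lemma integrable_indicator_Icc [simp]: "integrable lborel (indicat_real {a..b::real})"
  by (rule integrable_real_indicator) (auto simp: emeasure_lborel_Icc_eq)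

lemma average_le:
  fixes f :: "real \<Rightarrow> real"
  assumes "0 < h" and int: "integrable lborel (\<lambda>\<tau>. indicator {0..h} \<tau> * f \<tau>)" and "\<And>\<tau>. f \<tau> \<le> C"
  shows "(1 / h) * (\<integral>\<tau>. indicator {0..h} \<tau> * f \<tau> \<partial>lborel) \<le> C"
proof -
  have "(\<integral>\<tau>. indicator {0..h} \<tau> * f \<tau> \<partial>lborel) \<le> (\<integral>\<tau>. indicator {0..h} \<tau> * C \<partial>lborel)"
    using assms by (intro integral_mono int integrable_mult_left integrable_indicator_Icc) (auto simp: indicator_def)
  also have "\<dots> = h * C" using assms by simp
  finally show ?thesis using assms by (simp add: field_simps)
qed

lemma steklov_abs_le:
  fixes g :: "real \<times> 'a::euclidean_space \<Rightarrow> real"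
  assumes [measurable]: "g \<in> borel_measurable borel" and "\<And>z. \<bar>g z\<bar> \<le> C" "0 < h"
  shows "\<bar>steklov h g z\<bar> \<le> C"
proof -
  have "steklov h g z \<le> C"
    unfolding steklov_def using assms steklov_section_integrable[of g C]
    by (intro average_le) (auto simp: abs_le_iff)
  moreover have "steklov h (\<lambda>z. - g z) z \<le> C"
    unfolding steklov_def using assms steklov_section_integrable[of "\<lambda>z. - g z" C]
    by (intro average_le) (auto simp: abs_le_iff)
  moreover have "steklov h (\<lambda>z. - g z) z = - steklov h g z" by (simp add: steklov_def)
  ultimately show ?thesis by (simp add: abs_le_iff)
qed

lemma steklov_nonneg: "(\<And>z. 0 \<le> g z) \<Longrightarrow> 0 < h \<Longrightarrow> 0 \<le> steklov h g z"
  unfolding steklov_def by (intro mult_nonneg_nonneg Bochner_Integration.integral_nonneg) auto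

lemma steklov_eq_0:
  assumes "\<And>\<tau>. 0 \<le> \<tau> \<Longrightarrow> \<tau> \<le> h \<Longrightarrow> g (t + \<tau>, x) = 0"
  shows "steklov h g (t, x) = 0"
proof -
  have "(\<lambda>\<tau>. indicator {0..h} \<tau> * g (t + \<tau>, x)) = (\<lambda>_. 0)" using assms by (auto simp: indicator_def)
  then show ?thesis by (simp add: steklov_def)
qed

text \<open>Jensen's inequality: integrate the tangent of |y|^p at the mean m, whose linear part has
  mean zero. The right side is a nonnegative extended integral, so that Tonelli can be applied to it
  directly.\<close>

lemma average_powr_le:
  fixes f :: "real \<Rightarrow> real"
  assumes h: "0 < h" and p: "1 < p" and [measurable]: "f \<in> borel_measurable borel" and f: "\<And>\<tau>. \<bar>f \<tau>\<bar> \<le> C"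
  shows "ennreal (\<bar>(1 / h) * (\<integral>\<tau>. indicator {0..h} \<tau> * f \<tau> \<partial>lborel)\<bar> powr p)
    \<le> (\<integral>\<^sup>+\<tau>. ennreal (1 / h) * indicator {0..h} \<tau> * ennreal (\<bar>f \<tau>\<bar> powr p) \<partial>lborel)"
proof -
  define m where "m = (1 / h) * (\<integral>\<tau>. indicator {0..h} \<tau> * f \<tau> \<partial>lborel)"
  have C: "0 \<le> C" using order_trans[OF abs_ge_zero f] .
  have i1: "integrable lborel (\<lambda>\<tau>. indicator {0..h} \<tau> * f \<tau>)"
    by (rule integrable_bounded_support[of _ "{0..h}" C]) (use f C in \<open>auto simp: indicator_def\<close>)
  have i2: "integrable lborel (\<lambda>\<tau>. indicator {0..h} \<tau> * \<bar>f \<tau>\<bar> powr p)"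
    by (rule integrable_bounded_support[of _ "{0..h}" "C powr p"])
       (use f C p in \<open>auto simp: indicator_def intro!: powr_mono2\<close>)
  have i3: "integrable lborel (\<lambda>\<tau>. indicator {0..h} \<tau> * c)" for c :: real by simp
  have tangent: "\<bar>m\<bar> powr p + p * spow (p - 1) m * (y - m) \<le> \<bar>y\<bar> powr p" for y
    using bpot_tangent[of "p - 1" m y] p by (simp add: bpot_def field_simps)
  have "(\<integral>\<tau>. indicator {0..h} \<tau> * (\<bar>m\<bar> powr p - p * spow (p - 1) m * m) + p * spow (p - 1) m * (indicator {0..h} \<tau> * f \<tau>) \<partial>lborel)
      \<le> (\<integral>\<tau>. indicator {0..h} \<tau> * \<bar>f \<tau>\<bar> powr p \<partial>lborel)"
  proof (intro integral_mono i2 Bochner_Integration.integrable_add integrable_mult_right i1 i3)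
    fix \<tau> show "indicator {0..h} \<tau> * (\<bar>m\<bar> powr p - p * spow (p - 1) m * m) + p * spow (p - 1) m * (indicator {0..h} \<tau> * f \<tau>)
      \<le> indicator {0..h} \<tau> * \<bar>f \<tau>\<bar> powr p"
      using tangent[of "f \<tau>"] by (auto simp: indicator_def algebra_simps)
  qed
  also have "(\<integral>\<tau>. indicator {0..h} \<tau> * (\<bar>m\<bar> powr p - p * spow (p - 1) m * m) + p * spow (p - 1) m * (indicator {0..h} \<tau> * f \<tau>) \<partial>lborel)
    = h * (\<bar>m\<bar> powr p - p * spow (p - 1) m * m) + p * spow (p - 1) m * (h * m)"
    using h i1 i3 by (subst Bochner_Integration.integral_add) (auto simp: m_def)
  also have "\<dots> = h * \<bar>m\<bar> powr p" by (simp add: algebra_simps)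
  finally have "\<bar>m\<bar> powr p \<le> (\<integral>\<tau>. (1 / h) * (indicator {0..h} \<tau> * \<bar>f \<tau>\<bar> powr p) \<partial>lborel)"
    using h by (simp add: field_simps)
  then have "ennreal (\<bar>m\<bar> powr p) \<le> ennreal (\<integral>\<tau>. (1 / h) * (indicator {0..h} \<tau> * \<bar>f \<tau>\<bar> powr p) \<partial>lborel)"
    by (rule ennreal_leI)
  also have "\<dots> = (\<integral>\<^sup>+\<tau>. ennreal ((1 / h) * (indicator {0..h} \<tau> * \<bar>f \<tau>\<bar> powr p)) \<partial>lborel)"
    using h by (intro nn_integral_eq_integral[symmetric] integrable_mult_right i2) auto
  also have "\<dots> = (\<integral>\<^sup>+\<tau>. ennreal (1 / h) * indicator {0..h} \<tau> * ennreal (\<bar>f \<tau>\<bar> powr p) \<partial>lborel)"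
    using h by (intro nn_integral_cong) (auto simp: indicator_def ennreal_mult[symmetric])
  finally show ?thesis by (simp add: m_def)
qed

text \<open>Jensen in the averaging variable for each pair (x, y), then Tonelli: as the weight does
  not depend on time, every shifted copy of the energy has the same value.\<close>

lemma steklov_energy_le:
  fixes g :: "real \<times> 'a::euclidean_space \<Rightarrow> real" and w :: "'a \<times> 'a \<Rightarrow> ennreal"
  assumes h: "0 < h" and p: "1 < p" and [measurable]: "g \<in> borel_measurable borel" "w \<in> borel_measurable borel"
    and g: "\<And>z. \<bar>g z\<bar> \<le> C"
  shows "(\<integral>\<^sup>+(t, x, y). ennreal (\<bar>steklov h g (t, x) - steklov h g (t, y)\<bar> powr p) * w (x, y) \<partial>lborel)
    \<le> (\<integral>\<^sup>+(t, x, y). ennreal (\<bar>g (t, x) - g (t, y)\<bar> powr p) * w (x, y) \<partial>lborel)"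
proof -
  define F :: "real \<times> 'a \<times> 'a \<Rightarrow> ennreal" where
    "F = (\<lambda>(t, x, y). ennreal (\<bar>g (t, x) - g (t, y)\<bar> powr p) * w (x, y))"
  have [measurable]: "F \<in> borel_measurable borel" unfolding F_def split_beta' by measurable
  have "(\<integral>\<^sup>+(t, x, y). ennreal (\<bar>steklov h g (t, x) - steklov h g (t, y)\<bar> powr p) * w (x, y) \<partial>lborel)
    \<le> (\<integral>\<^sup>+z. (\<integral>\<^sup>+\<tau>. ennreal (1 / h) * indicator {0..h} \<tau> * F ((\<tau>, 0, 0) + z) \<partial>lborel) \<partial>lborel)"
  proof (intro nn_integral_mono, clarify)
    fix t :: real and x y :: 'a
    have "steklov h g (t, x) - steklov h g (t, y) = (1 / h) * (\<integral>\<tau>. indicator {0..h} \<tau> * (g (t + \<tau>, x) - g (t + \<tau>, y)) \<partial>lborel)"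
      using steklov_section_integrable[of g C h] g
      by (simp add: steklov_def right_diff_distrib Bochner_Integration.integral_diff)
    moreover have "\<bar>g (t + \<tau>, x) - g (t + \<tau>, y)\<bar> \<le> 2 * C" for \<tau>
      using g[of "(t + \<tau>, x)"] g[of "(t + \<tau>, y)"] by linarith
    ultimately have "ennreal (\<bar>steklov h g (t, x) - steklov h g (t, y)\<bar> powr p) * w (x, y)
      \<le> (\<integral>\<^sup>+\<tau>. ennreal (1 / h) * indicator {0..h} \<tau> * ennreal (\<bar>g (t + \<tau>, x) - g (t + \<tau>, y)\<bar> powr p) \<partial>lborel) * w (x, y)"
      using average_powr_le[OF h p, of "\<lambda>\<tau>. g (t + \<tau>, x) - g (t + \<tau>, y)" "2 * C"] by (intro mult_right_mono) auto
    also have "\<dots> = (\<integral>\<^sup>+\<tau>. ennreal (1 / h) * indicator {0..h} \<tau> * F ((\<tau>, 0, 0) + (t, x, y)) \<partial>lborel)"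
      by (subst nn_integral_multc[symmetric]) (auto simp: F_def mult.assoc add.commute)
    finally show "ennreal (\<bar>steklov h g (t, x) - steklov h g (t, y)\<bar> powr p) * w (x, y)
      \<le> (\<integral>\<^sup>+\<tau>. ennreal (1 / h) * indicator {0..h} \<tau> * F ((\<tau>, 0, 0) + (t, x, y)) \<partial>lborel)" .
  qed
  also have "\<dots> = (\<integral>\<^sup>+\<tau>. (\<integral>\<^sup>+z. ennreal (1 / h) * indicator {0..h} \<tau> * F ((\<tau>, 0, 0) + z) \<partial>lborel) \<partial>lborel)"
    by (rule lborel_pair.Fubini') measurable
  also have "\<dots> = (\<integral>\<^sup>+\<tau>. ennreal (1 / h) * indicator {0..h} \<tau> * (\<integral>\<^sup>+z. F z \<partial>lborel) \<partial>lborel)"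
    by (simp add: nn_integral_cmult nn_integral_lborel_shift)
  also have "\<dots> = (\<integral>\<^sup>+z. F z \<partial>lborel)"
    using h by (simp add: nn_integral_multc nn_integral_cmult ennreal_mult[symmetric])
  finally show ?thesis by (simp add: F_def)
qed

text \<open>One-dimensional differentiation of integrals on each line with fixed x, where the null
  set of times depends on x; Tonelli joins these null sets once the set of convergence is known to
  be measurable.\<close>

lemma steklov_tendsto:
  fixes g :: "real \<times> 'a::euclidean_space \<Rightarrow> real"
  assumes [measurable]: "g \<in> borel_measurable borel" and g: "\<And>z. \<bar>g z\<bar> \<le> C"
    and h: "\<And>n. 0 < h n" "h \<longlonglongrightarrow> 0"
  shows "AE z in lborel. (\<lambda>n. steklov (h n) g z) \<longlonglongrightarrow> g z"
proof -
  have sec: "AE t in lborel. (\<lambda>n. steklov (h n) g (t, x)) \<longlonglongrightarrow> g (t, x)" for x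
  proof -
    have int: "set_integrable lborel {a..b} (\<lambda>t. g (t, x))" for a b
      unfolding set_integrable_def
      by (rule integrable_bounded_support[of _ "{a..b}" C])
         (use g order_trans[OF abs_ge_zero g] in \<open>auto simp: indicator_def\<close>)
    have "(\<lambda>t. g (t, x)) integrable_on cbox a b" for a b
      using set_borel_integral_eq_integral(1)[OF int] by simp
    then obtain N where N: "negligible N" "\<And>t e. t \<notin> N \<Longrightarrow> 0 < e \<Longrightarrow>
       \<exists>d>0. \<forall>h. 0 < h \<and> h < d \<longrightarrow>
         norm (integral (cbox t (t + h *\<^sub>R One)) (\<lambda>t. g (t, x)) /\<^sub>R h ^ DIM(real) - g (t, x)) < e"
      using integrable_ccontinuous_explicit[of "\<lambda>t. g (t, x)"] by blast
    have steklov_eq: "steklov k g (t, x) = integral (cbox t (t + k *\<^sub>R One)) (\<lambda>t. g (t, x)) /\<^sub>R k ^ DIM(real)" for k t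
    proof -
      have "integral {t..t + k} (\<lambda>t. g (t, x)) = (\<integral>s. indicator {t..t + k} s *\<^sub>R g (s, x) \<partial>lborel)"
        using set_borel_integral_eq_integral(2)[OF int, of t "t + k"] by (simp add: set_lebesgue_integral_def)
      also have "\<dots> = (\<integral>\<tau>. indicator {t..t + k} (t + \<tau>) *\<^sub>R g (t + \<tau>, x) \<partial>lborel)"
        by (rule integral_lborel_shift[symmetric]) measurable
      also have "\<dots> = (\<integral>\<tau>. indicator {0..k} \<tau> * g (t + \<tau>, x) \<partial>lborel)"
        by (intro Bochner_Integration.integral_cong) (auto simp: indicator_def)
      finally show ?thesis by (simp add: steklov_def divide_inverse)
    qed
    have conv: "(\<lambda>n. steklov (h n) g (t, x)) \<longlonglongrightarrow> g (t, x)" if tN: "t \<notin> N" for t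
    proof (rule tendstoI)
      fix e :: real assume "0 < e"
      then obtain d where d: "d > 0" "\<And>k. 0 < k \<Longrightarrow> k < d \<Longrightarrow> norm (steklov k g (t, x) - g (t, x)) < e"
        using N(2)[OF tN \<open>0 < e\<close>] unfolding steklov_eq by blast
      have "\<forall>\<^sub>F n in sequentially. h n < d" using h(2) d(1) by (rule order_tendstoD)
      then show "\<forall>\<^sub>F n in sequentially. dist (steklov (h n) g (t, x)) (g (t, x)) < e"
        by eventually_elim (use d(2) h(1) in \<open>auto simp: dist_norm\<close>)
    qed
    have "AE t in lebesgue. t \<notin> N" using N(1) by (simp add: negligible_iff_null_sets AE_not_in)
    then have "AE t in lborel. t \<notin> N" by (simp add: AE_completion_iff)
    then show ?thesis by eventually_elim (rule conv)
  qed
  \<comment> \<open>A condition on the upper limit of Borel functions visibly defines a Borel set,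
    which the passage between iterated and joint null sets requires.\<close>
  have lim_iff: "(\<lambda>n. steklov (h n) g z) \<longlonglongrightarrow> g z \<longleftrightarrow> limsup (\<lambda>n. ereal \<bar>steklov (h n) g z - g z\<bar>) \<le> 0" for z
  proof -
    have "(\<lambda>n. steklov (h n) g z) \<longlonglongrightarrow> g z \<longleftrightarrow> (\<lambda>n. \<bar>steklov (h n) g z - g z\<bar>) \<longlonglongrightarrow> 0"
      by (metis LIM_zero_iff tendsto_rabs_zero_iff)
    also have "\<dots> \<longleftrightarrow> (\<lambda>n. ereal \<bar>steklov (h n) g z - g z\<bar>) \<longlonglongrightarrow> ereal 0" by simp
    also have "\<dots> \<longleftrightarrow> limsup (\<lambda>n. ereal \<bar>steklov (h n) g z - g z\<bar>) \<le> 0"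
    proof
      assume A: "(\<lambda>n. ereal \<bar>steklov (h n) g z - g z\<bar>) \<longlonglongrightarrow> ereal 0"
      have "limsup (\<lambda>n. ereal \<bar>steklov (h n) g z - g z\<bar>) = ereal 0" by (rule lim_imp_Limsup[OF _ A]) simp
      then show "limsup (\<lambda>n. ereal \<bar>steklov (h n) g z - g z\<bar>) \<le> 0" by (simp add: zero_ereal_def)
    next
      assume "limsup (\<lambda>n. ereal \<bar>steklov (h n) g z - g z\<bar>) \<le> 0"
      then show "(\<lambda>n. ereal \<bar>steklov (h n) g z - g z\<bar>) \<longlonglongrightarrow> ereal 0"
        unfolding lim_ereal by (intro limsup_le_liminf_real) (auto intro!: Liminf_bounded simp: zero_ereal_def)
    qed
    finally show ?thesis .
  qed
  have "AE z in lborel \<Otimes>\<^sub>M lborel. (\<lambda>n. steklov (h n) g z) \<longlonglongrightarrow> g z"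
  proof (rule lborel_pair.AE_pair_measure)
    show "{z \<in> space (lborel \<Otimes>\<^sub>M lborel). (\<lambda>n. steklov (h n) g z) \<longlonglongrightarrow> g z} \<in> sets (lborel \<Otimes>\<^sub>M lborel)"
      unfolding lim_iff lborel_prod by measurable
    have "AE x in lborel. AE t in lborel. (\<lambda>n. steklov (h n) g (t, x)) \<longlonglongrightarrow> g (t, x)"
      by (rule AE_I2) (rule sec)
    then show "AE t in lborel. AE x in lborel. (\<lambda>n. steklov (h n) g (t, x)) \<longlonglongrightarrow> g (t, x)"
      by (subst lborel_pair.AE_commute) (unfold lim_iff lborel_prod prod.collapse, measurable)
  qed
  then show ?thesis unfolding lborel_prod .
qed

text \<open>Fubini and a translation put the average on \<open>deriv \<eta>\<close>, the fundamental
  theorem of calculus turns it into a difference of values of \<eta>, and a second translation hands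
  the difference back to g. The margins 0 < a - h and b < T keep all supports inside (0, T), so
  integrals over (0, T) and over the line agree.\<close>

lemma steklov_weak_derivative:
  fixes g :: "real \<times> 'a::euclidean_space \<Rightarrow> real"
  assumes [measurable]: "g \<in> borel_measurable borel" and g: "\<And>z. \<bar>g z\<bar> \<le> C"
    and supp: "\<And>t x. t \<notin> {a..b} \<Longrightarrow> g (t, x) = 0" and h: "0 < h" "0 < a - h" "b < T"
    and \<eta>: "\<eta> \<in> test_fun_time T"
  shows "(\<integral>t\<in>{0<..<T}. steklov h g (t, x) * deriv \<eta> t \<partial>lebesgue)
    = - (\<integral>t\<in>{0<..<T}. (g (t + h, x) - g (t, x)) / h * \<eta> t \<partial>lebesgue)"
proof -
  have "(deriv ^^ 0) \<eta> differentiable (at t)" "(deriv ^^ 1) \<eta> differentiable (at t)" for t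
    using \<eta> unfolding test_fun_time_def by blast+
  then have diff: "\<eta> differentiable (at t)" "deriv \<eta> differentiable (at t)" for t by auto
  have D: "(\<eta> has_real_derivative deriv \<eta> t) (at t)" for t
    using diff(1) by (simp add: DERIV_deriv_iff_real_differentiable)
  have cont: "continuous_on UNIV \<eta>" "continuous_on UNIV (deriv \<eta>)"
    using diff by (auto simp: differentiable_imp_continuous_within continuous_on_eq_continuous_within)
  have [measurable]: "\<eta> \<in> borel_measurable borel" "deriv \<eta> \<in> borel_measurable borel"
    using cont by (auto intro: borel_measurable_continuous_onI)
  define f where "f t = g (t, x)" for t
  have [measurable]: "f \<in> borel_measurable borel" unfolding f_def by measurable
  have f: "\<bar>f t\<bar> \<le> C" "t \<notin> {a..b} \<Longrightarrow> f t = 0" for t using g supp by (auto simp: f_def)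
  have C: "0 \<le> C" using order_trans[OF abs_ge_zero g] .
  obtain E where E: "\<And>t. t \<in> {a - h..b + h} \<Longrightarrow> \<bar>\<eta> t\<bar> \<le> E" "\<And>t. t \<in> {a - h..b + h} \<Longrightarrow> \<bar>deriv \<eta> t\<bar> \<le> E" "0 \<le> E"
  proof -
    have "bounded (\<eta> ` {a - h..b + h})" "bounded (deriv \<eta> ` {a - h..b + h})"
      using cont by (auto intro!: compact_imp_bounded compact_continuous_image intro: continuous_on_subset)
    then obtain E1 E2 where "\<forall>t\<in>{a - h..b + h}. \<bar>\<eta> t\<bar> \<le> E1" "\<forall>t\<in>{a - h..b + h}. \<bar>deriv \<eta> t\<bar> \<le> E2"
      by (auto simp: bounded_iff)
    then show ?thesis using that[of "max 0 (max E1 E2)"] by fastforce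
  qed
  have "(\<integral>t\<in>{0<..<T}. steklov h g (t, x) * deriv \<eta> t \<partial>lebesgue)
    = (\<integral>t. indicator {0<..<T} t *\<^sub>R (steklov h g (t, x) * deriv \<eta> t) \<partial>lborel)"
    unfolding set_lebesgue_integral_def by (rule integral_completion) measurable
  also have "\<dots> = (\<integral>t. (\<integral>\<tau>. (1 / h) * (indicator {0..h} \<tau> * f (t + \<tau>)) * deriv \<eta> t \<partial>lborel) \<partial>lborel)"
  proof (rule Bochner_Integration.integral_cong[OF refl])
    fix t
    have "steklov h g (t, x) = 0" if "t \<notin> {0<..<T}"
      using that h by (intro steklov_eq_0 supp) auto
    then have "indicator {0<..<T} t *\<^sub>R (steklov h g (t, x) * deriv \<eta> t) = steklov h g (t, x) * deriv \<eta> t"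
      by (auto simp: indicator_def)
    then show "indicator {0<..<T} t *\<^sub>R (steklov h g (t, x) * deriv \<eta> t)
      = (\<integral>\<tau>. (1 / h) * (indicator {0..h} \<tau> * f (t + \<tau>)) * deriv \<eta> t \<partial>lborel)"
      by (simp add: steklov_def f_def)
  qed
  also have "\<dots> = (\<integral>\<tau>. (\<integral>t. (1 / h) * (indicator {0..h} \<tau> * f (t + \<tau>)) * deriv \<eta> t \<partial>lborel) \<partial>lborel)"
  proof (rule lborel_pair.Fubini_integral[symmetric])
    have "integrable lborel (\<lambda>(t, \<tau>). (1 / h) * (indicator {0..h} \<tau> * f (t + \<tau>)) * deriv \<eta> t)"
    proof (rule integrable_bounded_support[of _ "{a - h..b + h} \<times> {0..h}" "(1 / h) * C * E"])
      show "{a - h..b + h} \<times> {0..h} \<in> sets borel" by (intro borel_closed closed_Times) auto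
      show "bounded ({a - h..b + h} \<times> {0..h})" by (intro bounded_Times) auto
      show z: "(case z of (t, \<tau>) \<Rightarrow> (1 / h) * (indicator {0..h} \<tau> * f (t + \<tau>)) * deriv \<eta> t) = 0"
        if "z \<notin> {a - h..b + h} \<times> {0..h}" for z
        using that f(2) h by (force simp: indicator_def split: prod.splits)
      show "\<bar>case z of (t, \<tau>) \<Rightarrow> (1 / h) * (indicator {0..h} \<tau> * f (t + \<tau>)) * deriv \<eta> t\<bar> \<le> (1 / h) * C * E" for z
      proof (cases "z \<in> {a - h..b + h} \<times> {0..h}")
        case True
        then show ?thesis using f(1) E C h
          by (auto simp: indicator_def abs_mult intro!: divide_right_mono mult_mono)
      next
        case False then show ?thesis using z[OF False] C E h by simp
      qed
    qed (unfold split_beta', measurable)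
    then show "integrable (lborel \<Otimes>\<^sub>M lborel) (\<lambda>(t, \<tau>). (1 / h) * (indicator {0..h} \<tau> * f (t + \<tau>)) * deriv \<eta> t)"
      by (simp add: lborel_prod)
  qed
  also have "\<dots> = (\<integral>\<tau>. (\<integral>s. (1 / h) * f s * (indicator {0..h} \<tau> * deriv \<eta> (s - \<tau>)) \<partial>lborel) \<partial>lborel)"
  proof (rule Bochner_Integration.integral_cong[OF refl])
    fix \<tau>
    have "(\<integral>s. (1 / h) * f s * (indicator {0..h} \<tau> * deriv \<eta> (s - \<tau>)) \<partial>lborel)
      = (\<integral>t. (1 / h) * f (\<tau> + t) * (indicator {0..h} \<tau> * deriv \<eta> (\<tau> + t - \<tau>)) \<partial>lborel)"
      by (rule integral_lborel_shift[symmetric]) measurable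
    also have "\<dots> = (\<integral>t. (1 / h) * (indicator {0..h} \<tau> * f (t + \<tau>)) * deriv \<eta> t \<partial>lborel)"
      by (intro Bochner_Integration.integral_cong) (auto simp: mult_ac add.commute)
    finally show "(\<integral>t. (1 / h) * (indicator {0..h} \<tau> * f (t + \<tau>)) * deriv \<eta> t \<partial>lborel)
      = (\<integral>s. (1 / h) * f s * (indicator {0..h} \<tau> * deriv \<eta> (s - \<tau>)) \<partial>lborel)" ..
  qed
  also have "\<dots> = (\<integral>s. (\<integral>\<tau>. (1 / h) * f s * (indicator {0..h} \<tau> * deriv \<eta> (s - \<tau>)) \<partial>lborel) \<partial>lborel)"
  proof (rule lborel_pair.Fubini_integral)
    have "integrable lborel (\<lambda>(s, \<tau>). (1 / h) * f s * (indicator {0..h} \<tau> * deriv \<eta> (s - \<tau>)))"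
    proof (rule integrable_bounded_support[of _ "{a..b} \<times> {0..h}" "(1 / h) * C * E"])
      show "{a..b} \<times> {0..h} \<in> sets borel" by (intro borel_closed closed_Times) auto
      show "bounded ({a..b} \<times> {0..h})" by (intro bounded_Times) auto
      show z: "(case z of (s, \<tau>) \<Rightarrow> (1 / h) * f s * (indicator {0..h} \<tau> * deriv \<eta> (s - \<tau>))) = 0"
        if "z \<notin> {a..b} \<times> {0..h}" for z
        using that f(2) h by (force simp: indicator_def split: prod.splits)
      show "\<bar>case z of (s, \<tau>) \<Rightarrow> (1 / h) * f s * (indicator {0..h} \<tau> * deriv \<eta> (s - \<tau>))\<bar> \<le> (1 / h) * C * E" for z
      proof (cases "z \<in> {a..b} \<times> {0..h}")
        case True
        then show ?thesis using f(1) E C h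
          by (auto simp: indicator_def abs_mult intro!: divide_right_mono mult_mono)
      next
        case False then show ?thesis using z[OF False] C E h by simp
      qed
    qed (unfold split_beta', measurable)
    then show "integrable (lborel \<Otimes>\<^sub>M lborel) (\<lambda>(s, \<tau>). (1 / h) * f s * (indicator {0..h} \<tau> * deriv \<eta> (s - \<tau>)))"
      by (simp add: lborel_prod)
  qed
  also have "\<dots> = (\<integral>s. (1 / h) * f s * (\<eta> s - \<eta> (s - h)) \<partial>lborel)"
  proof (rule Bochner_Integration.integral_cong[OF refl])
    fix s
    have "has_bochner_integral lborel (\<lambda>\<tau>. indicator {0..h} \<tau> *\<^sub>R deriv \<eta> (s - \<tau>)) (- \<eta> (s - h) - (- \<eta> (s - 0)))"
    proof (rule has_bochner_integral_FTC_Icc)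
      show "((\<lambda>\<tau>. - \<eta> (s - \<tau>)) has_vector_derivative deriv \<eta> (s - \<tau>)) (at \<tau> within {0..h})" for \<tau>
        unfolding has_real_derivative_iff_has_vector_derivative[symmetric]
        by (rule DERIV_subset[of _ _ _ UNIV]) (auto intro!: derivative_eq_intros DERIV_chain2[OF D])
      show "continuous_on {0..h} (\<lambda>\<tau>. deriv \<eta> (s - \<tau>))"
        by (rule continuous_on_compose2[OF cont(2)]) (auto intro!: continuous_intros)
    qed (use h in auto)
    then have "(\<integral>\<tau>. indicator {0..h} \<tau> * deriv \<eta> (s - \<tau>) \<partial>lborel) = \<eta> s - \<eta> (s - h)"
      by (simp add: has_bochner_integral_iff)
    then show "(\<integral>\<tau>. (1 / h) * f s * (indicator {0..h} \<tau> * deriv \<eta> (s - \<tau>)) \<partial>lborel) = (1 / h) * f s * (\<eta> s - \<eta> (s - h))"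
      by simp
  qed
  also have "\<dots> = (\<integral>s. (1 / h) * (f s * \<eta> s) \<partial>lborel) - (\<integral>s. (1 / h) * (f s * \<eta> (s - h)) \<partial>lborel)"
  proof -
    have "integrable lborel (\<lambda>s. (1 / h) * (f s * \<eta> (s - k)))" if "0 \<le> k" "k \<le> h" for k
    proof (rule integrable_bounded_support[of _ "{a..b}" "(1 / h) * (C * E)"])
      show "\<bar>(1 / h) * (f s * \<eta> (s - k))\<bar> \<le> (1 / h) * (C * E)" for s
      proof (cases "s \<in> {a..b}")
        case True
        then show ?thesis using f(1) E C h that
          by (auto simp: abs_mult intro!: divide_right_mono mult_mono)
      qed (use f(2) C E h in simp)
    qed (use f(2) in auto)
    from this[of 0] this[of h] show ?thesis
      using h by (subst Bochner_Integration.integral_diff[symmetric]) (auto simp: algebra_simps)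
  qed
  also have "(\<integral>s. (1 / h) * (f s * \<eta> (s - h)) \<partial>lborel) = (\<integral>s. (1 / h) * (f (h + s) * \<eta> (h + s - h)) \<partial>lborel)"
    by (rule integral_lborel_shift[symmetric]) measurable
  also have "(\<integral>s. (1 / h) * (f s * \<eta> s) \<partial>lborel) - (\<integral>s. (1 / h) * (f (h + s) * \<eta> (h + s - h)) \<partial>lborel)
    = - (\<integral>t. (f (t + h) - f t) / h * \<eta> t \<partial>lborel)"
  proof -
    have "integrable lborel (\<lambda>s. (1 / h) * (f (k + s) * \<eta> s))" if "0 \<le> k" "k \<le> h" for k
    proof (rule integrable_bounded_support[of _ "{a - k..b - k}" "(1 / h) * (C * E)"])
      show "\<bar>(1 / h) * (f (k + s) * \<eta> s)\<bar> \<le> (1 / h) * (C * E)" for s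
      proof (cases "s \<in> {a - k..b - k}")
        case True
        then show ?thesis using f(1) E C h that
          by (auto simp: abs_mult intro!: divide_right_mono mult_mono)
      next
        case False
        then have "f (k + s) = 0" by (intro f(2)) auto
        then show ?thesis using C E h by simp
      qed
    next
      show "(1 / h) * (f (k + s) * \<eta> s) = 0" if "s \<notin> {a - k..b - k}" for s
        using that f(2)[of "k + s"] by auto
    qed auto
    from this[of 0] this[of h] have "(\<integral>s. (1 / h) * (f s * \<eta> s) \<partial>lborel) - (\<integral>s. (1 / h) * (f (h + s) * \<eta> (h + s - h)) \<partial>lborel)
      = (\<integral>s. (1 / h) * (f s * \<eta> s) - (1 / h) * (f (h + s) * \<eta> s) \<partial>lborel)"
      using h by (subst Bochner_Integration.integral_diff[symmetric]) auto
    also have "\<dots> = (\<integral>s. - ((f (s + h) - f s) / h * \<eta> s) \<partial>lborel)"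
      using h by (intro Bochner_Integration.integral_cong) (auto simp: field_simps add.commute)
    finally show ?thesis by simp
  qed
  also have "(\<integral>t. (f (t + h) - f t) / h * \<eta> t \<partial>lborel)
    = (\<integral>t. indicator {0<..<T} t *\<^sub>R ((g (t + h, x) - g (t, x)) / h * \<eta> t) \<partial>lborel)"
  proof (rule Bochner_Integration.integral_cong[OF refl])
    fix t
    have "f (t + h) = 0" "f t = 0" if "t \<notin> {0<..<T}" using that h by (auto intro!: f(2))
    then show "(f (t + h) - f t) / h * \<eta> t = indicator {0<..<T} t *\<^sub>R ((g (t + h, x) - g (t, x)) / h * \<eta> t)"
      by (cases "t \<in> {0<..<T}") (auto simp: f_def)
  qed
  also have "\<dots> = (\<integral>t\<in>{0<..<T}. (g (t + h, x) - g (t, x)) / h * \<eta> t \<partial>lebesgue)"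
    unfolding set_lebesgue_integral_def by (rule integral_completion[symmetric]) measurable
  finally show ?thesis .
qed

section \<open>The nonlocal energy\<close>

lemma nn_integral_lborel_pair:
  fixes F :: "'b::euclidean_space \<times> 'c::euclidean_space \<Rightarrow> ennreal"
  assumes "F \<in> borel_measurable borel"
  shows "(\<integral>\<^sup>+z. F z \<partial>lborel) = (\<integral>\<^sup>+x. (\<integral>\<^sup>+y. F (x, y) \<partial>lborel) \<partial>lborel)"
proof -
  have "F \<in> borel_measurable (lborel \<Otimes>\<^sub>M lborel)" using assms by (simp add: lborel_prod)
  from lborel.nn_integral_fst[OF this] show ?thesis by (simp add: lborel_prod)
qed

lemma nn_integral_lborel_pair_snd:
  fixes F :: "'b::euclidean_space \<times> 'c::euclidean_space \<Rightarrow> ennreal"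
  assumes "F \<in> borel_measurable borel"
  shows "(\<integral>\<^sup>+z. F z \<partial>lborel) = (\<integral>\<^sup>+y. (\<integral>\<^sup>+x. F (x, y) \<partial>lborel) \<partial>lborel)"
proof -
  have "F \<in> borel_measurable (lborel \<Otimes>\<^sub>M lborel)" using assms by (simp add: lborel_prod)
  from lborel_pair.nn_integral_snd[OF this] show ?thesis by (simp add: lborel_prod)
qed

lemma nn_integral_lborel_triple:
  fixes F :: "'b::euclidean_space \<times> 'c::euclidean_space \<times> 'd::euclidean_space \<Rightarrow> ennreal"
  assumes [measurable]: "F \<in> borel_measurable borel"
  shows "(\<integral>\<^sup>+z. F z \<partial>lborel) = (\<integral>\<^sup>+t. (\<integral>\<^sup>+x. (\<integral>\<^sup>+y. F (t, x, y) \<partial>lborel) \<partial>lborel) \<partial>lborel)"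
  by (simp add: nn_integral_lborel_pair)

lemma nn_integral_lborel_triple_swap:
  fixes F :: "'b::euclidean_space \<times> 'c::euclidean_space \<times> 'd::euclidean_space \<Rightarrow> ennreal"
  assumes [measurable]: "F \<in> borel_measurable borel"
  shows "(\<integral>\<^sup>+z. F z \<partial>lborel) = (\<integral>\<^sup>+t. (\<integral>\<^sup>+y. (\<integral>\<^sup>+x. F (t, x, y) \<partial>lborel) \<partial>lborel) \<partial>lborel)"
  by (subst nn_integral_lborel_pair) (auto intro!: nn_integral_cong nn_integral_lborel_pair_snd)

text \<open>At x = y the division by zero makes the value 0, so two-sided bounds of a kernel by
  multiples of \<open>fker\<close> can be demanded at every point and not only almost
  everywhere.\<close>

definition fker :: "real \<Rightarrow> 'a::euclidean_space \<times> 'a \<Rightarrow> real" where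
  "fker \<sigma> w = 1 / norm (fst w - snd w) powr (real DIM('a) + \<sigma>)"

lemma fker_measurable [measurable]: "fker \<sigma> \<in> borel_measurable borel"
  unfolding fker_def by measurable

lemma fker_nonneg: "0 \<le> fker \<sigma> w"
  by (simp add: fker_def)

lemma powr_Young_le:
  fixes x y p :: real
  assumes "1 < p" "0 \<le> x" "0 \<le> y"
  shows "x powr (p - 1) * y \<le> x powr p + y powr p"
proof (cases "y \<le> x")
  case True
  then have "x powr (p - 1) * y \<le> x powr (p - 1) * x" by (intro mult_left_mono) auto
  also have "\<dots> = x powr p" using assms by (cases "x = 0") (auto simp: powr_diff)
  finally show ?thesis by (smt (verit) powr_ge_zero)
next
  case False
  then have "x powr (p - 1) * y \<le> y powr (p - 1) * y" using assms by (intro mult_right_mono powr_mono2) auto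
  also have "\<dots> = y powr p" using False assms by (auto simp: powr_diff)
  finally show ?thesis by (smt (verit) powr_ge_zero)
qed

lemma powr_add_le:
  fixes x y p :: real
  assumes "0 < p" "0 \<le> x" "0 \<le> y"
  shows "(x + y) powr p \<le> 2 powr p * (x powr p + y powr p)"
proof -
  have "(x + y) powr p \<le> (2 * max x y) powr p" using assms by (intro powr_mono2) auto
  also have "\<dots> = 2 powr p * max x y powr p" using assms by (simp add: powr_mult)
  also have "max x y powr p \<le> x powr p + y powr p" by (auto simp: max_def)
  finally show ?thesis by (auto simp: mult_left_mono)
qed

lemma real_nn_bound_integrable:
  fixes f :: "'b \<Rightarrow> real"
  assumes "f \<in> borel_measurable N" "\<And>z. ennreal \<bar>f z\<bar> \<le> G z" "(\<integral>\<^sup>+z. G z \<partial>N) < \<infinity>"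
  shows "integrable N f"
proof (rule integrableI_bounded[OF assms(1)])
  have "(\<integral>\<^sup>+z. ennreal (norm (f z)) \<partial>N) \<le> (\<integral>\<^sup>+z. G z \<partial>N)"
    using assms(2) by (intro nn_integral_mono) auto
  then show "(\<integral>\<^sup>+z. ennreal (norm (f z)) \<partial>N) < \<infinity>" using assms(3) by (rule le_less_trans)
qed

text \<open>Time comes first: \<open>V (t, x)\<close> is a Borel version of \<open>u (x, t)\<close>, and \<open>\<sigma> = p s\<close>.\<close>

lemma ball_sets_borel [measurable]: "ball x r \<in> sets borel"
  by (rule borel_open) simp

locale nonlocal_energy =
  fixes p \<sigma> q \<Lambda> M :: real and \<kappa> :: "real \<times> 'a::euclidean_space \<times> 'a \<Rightarrow> real"
    and V :: "real \<times> 'a \<Rightarrow> real" and x0 :: 'a and R0 t1 t2 :: real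
  assumes p: "1 < p" and \<sigma>: "0 < \<sigma>" "\<sigma> < p" and q: "0 < q" and \<Lambda>: "1 \<le> \<Lambda>"
    and \<kappa>_measurable [measurable]: "\<kappa> \<in> borel_measurable borel"
    and \<kappa>: "\<And>t x y. fker \<sigma> (x, y) / \<Lambda> \<le> \<kappa> (t, x, y)" "\<And>t x y. \<kappa> (t, x, y) \<le> \<Lambda> * fker \<sigma> (x, y)"
    and V_measurable [measurable]: "V \<in> borel_measurable borel"
    and V: "\<And>z. \<bar>V z\<bar> \<le> M"
    and t12: "t1 < t2"
    and energy: "(\<integral>\<^sup>+(t, x, y). indicator {t1<..<t2} t * indicator (ball x0 R0) x * indicator (ball x0 R0) y
        * ennreal (\<bar>V (t, x) - V (t, y)\<bar> powr p * fker \<sigma> (x, y)) \<partial>lborel) < \<infinity>"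
begin

lemma M_nonneg: "0 \<le> M"
  using order_trans[OF abs_ge_zero V] .

lemma \<kappa>_nonneg: "0 \<le> \<kappa> (t, x, y)"
  using order_trans[OF _ \<kappa>(1)] fker_nonneg[of \<sigma> "(x, y)"] \<Lambda> by simp

lemma abs_V_diff: "\<bar>V z - V w\<bar> \<le> 2 * M"
  using V[of z] V[of w] by linarith

text \<open>The pairs at which an increment of a function supported in the ball can be nonzero. One
  of the two points may be far away, so the energy over these pairs also sees V outside the
  ball.\<close>

definition touch :: "real \<Rightarrow> 'a \<Rightarrow> 'a \<Rightarrow> bool" where
  "touch R x y \<longleftrightarrow> x \<in> ball x0 R \<or> y \<in> ball x0 R"

lemma touch_measurable [measurable]: "Measurable.pred borel (\<lambda>(t::real, x, y). touch R x y)"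
  unfolding touch_def split_beta' by measurable

text \<open>By symmetry of f both indicators contribute equally, and for one of them the free
  variable is integrated first. It is applied to the tail of the kernel and to the kernel damped by
  the increment of a cutoff.\<close>

lemma nn_integral_touch:
  fixes f :: "'a \<times> 'a \<Rightarrow> ennreal" and E :: "(real \<times> 'a) set"
  assumes [measurable]: "f \<in> borel_measurable borel" "E \<in> sets borel"
    and sym: "\<And>x y. f (x, y) = f (y, x)" and f: "\<And>x. (\<integral>\<^sup>+y. f (x, y) \<partial>lborel) \<le> c"
  shows "(\<integral>\<^sup>+(t, x, y). (indicator E (t, x) + indicator E (t, y)) * f (x, y) \<partial>lborel) \<le> 2 * c * emeasure lborel E"
proof -
  have 1: "(\<integral>\<^sup>+(t, x, y). indicator E (t, x) * f (x, y) \<partial>lborel) \<le> c * emeasure lborel E"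
  proof -
    have "(\<integral>\<^sup>+(t, x, y). indicator E (t, x) * f (x, y) \<partial>lborel)
      = (\<integral>\<^sup>+t. (\<integral>\<^sup>+x. indicator E (t, x) * (\<integral>\<^sup>+y. f (x, y) \<partial>lborel) \<partial>lborel) \<partial>lborel)"
      by (subst nn_integral_lborel_triple) (auto simp: nn_integral_cmult split_beta')
    also have "\<dots> \<le> (\<integral>\<^sup>+t. (\<integral>\<^sup>+x. indicator E (t, x) * c \<partial>lborel) \<partial>lborel)"
      by (intro nn_integral_mono mult_left_mono f) auto
    also have "\<dots> = (\<integral>\<^sup>+z. indicator E z * c \<partial>lborel)"
      by (rule nn_integral_lborel_pair[of "\<lambda>z. indicator E z * c", symmetric]) measurable
    also have "\<dots> = c * emeasure lborel E" by (simp add: nn_integral_cmult_indicator mult.commute[of _ c])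
    finally show ?thesis .
  qed
  have 2: "(\<integral>\<^sup>+(t, x, y). indicator E (t, y) * f (x, y) \<partial>lborel) = (\<integral>\<^sup>+(t, x, y). indicator E (t, x) * f (x, y) \<partial>lborel)"
    using sym by (subst nn_integral_lborel_triple_swap, unfold split_beta', measurable)
      (subst nn_integral_lborel_triple, auto)
  have "(\<integral>\<^sup>+(t, x, y). (indicator E (t, x) + indicator E (t, y)) * f (x, y) \<partial>lborel)
    = (\<integral>\<^sup>+(t, x, y). indicator E (t, x) * f (x, y) \<partial>lborel) + (\<integral>\<^sup>+(t, x, y). indicator E (t, y) * f (x, y) \<partial>lborel)"
    unfolding split_beta' by (subst nn_integral_add[symmetric]) (auto simp: distrib_right)
  also have "\<dots> \<le> c * emeasure lborel E + c * emeasure lborel E"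
    unfolding 2 by (intro add_mono 1)
  finally show ?thesis by (simp add: mult_2 distrib_right)
qed

text \<open>A touching pair either lies inside \<open>ball x0 R0\<close>, where the energy is finite
  by assumption, or has one point outside it, at distance at least R0 - R from the other; there the
  increment is at most 2M and the tail of the kernel is integrable. This is how global boundedness
  controls the long jumps.\<close>

lemma cross_energy:
  assumes "R < R0"
  shows "(\<integral>\<^sup>+(t, x, y). (if t1 < t \<and> t < t2 \<and> touch R x y then ennreal (\<bar>V (t, x) - V (t, y)\<bar> powr p * fker \<sigma> (x, y)) else 0) \<partial>lborel) < \<infinity>"
    (is "?L < _")
proof -
  obtain C where C: "0 < C" "\<And>\<rho> (x::'a). 0 < \<rho> \<Longrightarrow>
      (\<integral>\<^sup>+y. ennreal (1 / norm (x - y) powr (real DIM('a) + \<sigma>)) * indicator {y. \<rho> \<le> norm (x - y)} y \<partial>lborel) \<le> ennreal (C * \<rho> powr (- \<sigma>))"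
    using kernel_tail_integral[OF \<sigma>(1)] by blast
  define \<rho> where "\<rho> = R0 - R"
  have \<rho>: "0 < \<rho>" using assms by (simp add: \<rho>_def)
  define f where "f w = ennreal ((2 * M) powr p * fker \<sigma> w) * indicator {w. \<rho> \<le> norm (fst w - snd w)} w" for w :: "'a \<times> 'a"
  define E where "E = {t1<..<t2} \<times> ball x0 R"
  define c where "c = ennreal ((2 * M) powr p * (C * \<rho> powr (- \<sigma>)))"
  have [measurable]: "f \<in> borel_measurable borel" unfolding f_def by measurable
  have [measurable]: "E \<in> sets borel" unfolding E_def by (intro borel_open open_Times) auto
  have f: "(\<integral>\<^sup>+y. f (x, y) \<partial>lborel) \<le> c" for x
  proof -
    have "(\<integral>\<^sup>+y. f (x, y) \<partial>lborel) = (\<integral>\<^sup>+y. ennreal ((2 * M) powr p) * (ennreal (1 / norm (x - y) powr (real DIM('a) + \<sigma>)) * indicator {y. \<rho> \<le> norm (x - y)} y) \<partial>lborel)"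
      by (intro nn_integral_cong) (auto simp: f_def fker_def indicator_def ennreal_mult[symmetric])
    also have "\<dots> = ennreal ((2 * M) powr p) * (\<integral>\<^sup>+y. ennreal (1 / norm (x - y) powr (real DIM('a) + \<sigma>)) * indicator {y. \<rho> \<le> norm (x - y)} y \<partial>lborel)"
      by (rule nn_integral_cmult) measurable
    also have "\<dots> \<le> ennreal ((2 * M) powr p) * ennreal (C * \<rho> powr (- \<sigma>))"
      by (intro mult_left_mono C \<rho>) auto
    also have "\<dots> = c" using C by (simp add: c_def ennreal_mult)
    finally show ?thesis .
  qed
  have E: "emeasure lborel E < \<infinity>"
    unfolding E_def by (intro emeasure_bounded_finite bounded_Times) auto
  have "(\<integral>\<^sup>+(t, x, y). (indicator E (t, x) + indicator E (t, y)) * f (x, y) \<partial>lborel) \<le> 2 * c * emeasure lborel E"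
    by (rule nn_integral_touch) (use f in \<open>auto simp: f_def fker_def indicator_def norm_minus_commute\<close>)
  also have "\<dots> < \<infinity>" using E by (simp add: c_def ennreal_mult_less_top)
  finally have fin: "(\<integral>\<^sup>+(t, x, y). (indicator E (t, x) + indicator E (t, y)) * f (x, y) \<partial>lborel) < \<infinity>" .
  have "?L \<le> (\<integral>\<^sup>+(t, x, y). indicator {t1<..<t2} t * indicator (ball x0 R0) x * indicator (ball x0 R0) y
        * ennreal (\<bar>V (t, x) - V (t, y)\<bar> powr p * fker \<sigma> (x, y)) + (indicator E (t, x) + indicator E (t, y)) * f (x, y) \<partial>lborel)"
  proof (intro nn_integral_mono, clarify)
    fix t x y
    let ?e = "ennreal (\<bar>V (t, x) - V (t, y)\<bar> powr p * fker \<sigma> (x, y))"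
    show "(if t1 < t \<and> t < t2 \<and> touch R x y then ?e else 0)
      \<le> indicator {t1<..<t2} t * indicator (ball x0 R0) x * indicator (ball x0 R0) y * ?e
        + (indicator E (t, x) + indicator E (t, y)) * f (x, y)"
    proof (cases "t1 < t \<and> t < t2 \<and> touch R x y")
      case True
      show ?thesis
      proof (cases "x \<in> ball x0 R0 \<and> y \<in> ball x0 R0")
        case True then show ?thesis using \<open>t1 < t \<and> t < t2 \<and> touch R x y\<close> by (simp add: add_increasing2)
      next
        case False
        have "\<rho> \<le> norm (x - y)"
          using False True dist_triangle[of x0 x y] dist_triangle[of x0 y x]
          by (auto simp: touch_def \<rho>_def dist_norm[symmetric] dist_commute)
        moreover have "\<bar>V (t, x) - V (t, y)\<bar> powr p * fker \<sigma> (x, y) \<le> (2 * M) powr p * fker \<sigma> (x, y)"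
          using p abs_V_diff by (intro mult_right_mono powr_mono2 fker_nonneg) auto
        ultimately have "?e \<le> f (x, y)" by (auto simp: f_def indicator_def intro: ennreal_leI)
        also have "\<dots> \<le> (indicator E (t, x) + indicator E (t, y)) * f (x, y)"
          using True by (auto simp: E_def touch_def indicator_def distrib_right add_increasing add_increasing2)
        finally show ?thesis using True by (simp add: add_increasing)
      qed
    next
      case False
      then show ?thesis by (subst if_not_P) auto
    qed
  qed
  also have "\<dots> = (\<integral>\<^sup>+(t, x, y). indicator {t1<..<t2} t * indicator (ball x0 R0) x * indicator (ball x0 R0) y
        * ennreal (\<bar>V (t, x) - V (t, y)\<bar> powr p * fker \<sigma> (x, y)) \<partial>lborel)
      + (\<integral>\<^sup>+(t, x, y). (indicator E (t, x) + indicator E (t, y)) * f (x, y) \<partial>lborel)"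
    unfolding split_beta' by (rule nn_integral_add) measurable
  also have "\<dots> < \<infinity>" using energy fin by simp
  finally show ?thesis .
qed

section \<open>The tested form, its Young majorant and the limit of vanishing averages\<close>

definition elliptic :: "(real \<times> 'a \<Rightarrow> real) \<Rightarrow> real \<times> 'a \<times> 'a \<Rightarrow> real" where
  "elliptic g = (\<lambda>(t, x, y). spow (p - 1) (V (t, x) - V (t, y)) * (g (t, x) - g (t, y)) * \<kappa> (t, x, y))"

definition seminorm :: "(real \<times> 'a \<Rightarrow> real) \<Rightarrow> ennreal" where
  "seminorm g = (\<integral>\<^sup>+(t, x, y). ennreal (\<bar>g (t, x) - g (t, y)\<bar> powr p) * ennreal (fker \<sigma> (x, y)) \<partial>lborel)"

lemma elliptic_measurable [measurable]:
  assumes [measurable]: "g \<in> borel_measurable borel"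
  shows "elliptic g \<in> borel_measurable borel"
  unfolding elliptic_def split_beta' by measurable

text \<open>Young's inequality splits the tested form into a part independent of g, finite by
  \<open>cross_energy\<close>, and the density of \<open>seminorm g\<close>. Averaging g in time
  affects only the second part, whose integral it cannot increase.\<close>

definition majorant :: "real \<Rightarrow> (real \<times> 'a \<Rightarrow> real) \<Rightarrow> real \<times> 'a \<times> 'a \<Rightarrow> real" where
  "majorant R g = (\<lambda>(t, x, y). \<Lambda> * ((if t1 < t \<and> t < t2 \<and> touch R x y then \<bar>V (t, x) - V (t, y)\<bar> powr p * fker \<sigma> (x, y) else 0)
     + \<bar>g (t, x) - g (t, y)\<bar> powr p * fker \<sigma> (x, y)))"

lemma majorant_measurable [measurable]: "g \<in> borel_measurable borel \<Longrightarrow> majorant R g \<in> borel_measurable borel"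
proof -
  assume [measurable]: "g \<in> borel_measurable borel"
  have [measurable]: "Measurable.pred borel (\<lambda>z::real \<times> 'a \<times> 'a. touch R (fst (snd z)) (snd (snd z)))"
    using touch_measurable[of R] by (simp add: split_beta')
  show ?thesis unfolding majorant_def split_beta' by measurable
qed

lemma majorant_nonneg: "0 \<le> majorant R g z"
  using \<Lambda> by (cases z) (auto simp: majorant_def fker_nonneg intro!: mult_nonneg_nonneg add_nonneg_nonneg)

lemma elliptic_le_majorant:
  assumes supp: "\<And>t x. \<not> (t1 < t \<and> t < t2) \<or> x \<notin> ball x0 R \<Longrightarrow> g (t, x) = 0"
  shows "\<bar>elliptic g z\<bar> \<le> majorant R g z"
proof -
  obtain t x y where z: "z = (t, x, y)" by (cases z) auto
  show ?thesis
  proof (cases "t1 < t \<and> t < t2 \<and> touch R x y")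
    case True
    have "\<bar>elliptic g z\<bar> = (\<bar>V (t, x) - V (t, y)\<bar> powr (p - 1) * \<bar>g (t, x) - g (t, y)\<bar>) * \<kappa> (t, x, y)"
      using \<kappa>_nonneg by (simp add: z elliptic_def abs_mult abs_spow)
    also have "\<dots> \<le> (\<bar>V (t, x) - V (t, y)\<bar> powr p + \<bar>g (t, x) - g (t, y)\<bar> powr p) * (\<Lambda> * fker \<sigma> (x, y))"
      using p \<kappa> \<kappa>_nonneg by (intro mult_mono powr_Young_le) auto
    also have "\<dots> = majorant R g z" using True by (simp add: z majorant_def algebra_simps)
    finally show ?thesis .
  next
    case False
    then have "g (t, x) = 0" "g (t, y) = 0" using supp by (auto simp: touch_def)
    then show ?thesis using False \<Lambda> by (auto simp: z elliptic_def majorant_def)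
  qed
qed

lemma majorant_nn_integral:
  assumes [measurable]: "g \<in> borel_measurable borel"
  shows "(\<integral>\<^sup>+z. ennreal (majorant R g z) \<partial>lborel) = ennreal \<Lambda> *
     ((\<integral>\<^sup>+(t, x, y). (if t1 < t \<and> t < t2 \<and> touch R x y then ennreal (\<bar>V (t, x) - V (t, y)\<bar> powr p * fker \<sigma> (x, y)) else 0) \<partial>lborel)
      + seminorm g)"
proof -
  have [measurable]: "Measurable.pred borel (\<lambda>z::real \<times> 'a \<times> 'a. touch R (fst (snd z)) (snd (snd z)))"
    using touch_measurable[of R] by (simp add: split_beta')
  have "(\<integral>\<^sup>+z. ennreal (majorant R g z) \<partial>lborel) = (\<integral>\<^sup>+z. ennreal \<Lambda> *
     ((case z of (t, x, y) \<Rightarrow> (if t1 < t \<and> t < t2 \<and> touch R x y then ennreal (\<bar>V (t, x) - V (t, y)\<bar> powr p * fker \<sigma> (x, y)) else 0))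
      + (case z of (t, x, y) \<Rightarrow> ennreal (\<bar>g (t, x) - g (t, y)\<bar> powr p) * ennreal (fker \<sigma> (x, y)))) \<partial>lborel)"
    using \<Lambda>
    by (intro nn_integral_cong)
       (auto simp: majorant_def ennreal_mult' fker_nonneg ennreal_plus[OF mult_nonneg_nonneg mult_nonneg_nonneg] split: prod.splits)
  also have "\<dots> = ennreal \<Lambda> *
     ((\<integral>\<^sup>+(t, x, y). (if t1 < t \<and> t < t2 \<and> touch R x y then ennreal (\<bar>V (t, x) - V (t, y)\<bar> powr p * fker \<sigma> (x, y)) else 0) \<partial>lborel)
      + seminorm g)"
    unfolding split_beta' seminorm_def
    by (subst nn_integral_cmult, measurable) (subst nn_integral_add, auto)
  finally show ?thesis .
qed

lemma majorant_integrable: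
  assumes [measurable]: "g \<in> borel_measurable borel" and "R < R0" "seminorm g < \<infinity>"
  shows "integrable lborel (majorant R g)"
proof (rule integrableI_bounded)
  have "(\<integral>\<^sup>+z. ennreal (norm (majorant R g z)) \<partial>lborel) = (\<integral>\<^sup>+z. ennreal (majorant R g z) \<partial>lborel)"
    by (simp add: majorant_nonneg)
  also have "\<dots> < \<infinity>"
    unfolding majorant_nn_integral[OF assms(1)]
    using cross_energy[OF assms(2)] assms(3) by (auto simp: ennreal_mult_less_top)
  finally show "(\<integral>\<^sup>+z. ennreal (norm (majorant R g z)) \<partial>lborel) < \<infinity>" .
qed simp

lemma elliptic_integrable:
  assumes [measurable]: "g \<in> borel_measurable borel" and "R < R0" "seminorm g < \<infinity>"
    and supp: "\<And>t x. \<not> (t1 < t \<and> t < t2) \<or> x \<notin> ball x0 R \<Longrightarrow> g (t, x) = 0"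
  shows "integrable lborel (elliptic g)"
  by (rule Bochner_Integration.integrable_bound[OF majorant_integrable[OF assms(1-3)]])
     (use elliptic_le_majorant[where g=g and R=R, OF supp] in \<open>auto intro!: AE_I2 order_trans[OF _ abs_ge_self]\<close>)

lemma seminorm_steklov:
  assumes "g \<in> borel_measurable borel" "0 < h" and "\<And>z. \<bar>g z\<bar> \<le> C"
  shows "seminorm (steklov h g) \<le> seminorm g"
  unfolding seminorm_def using steklov_energy_le[OF assms(2) p assms(1) _ assms(3), of "\<lambda>w. ennreal (fker \<sigma> w)"]
  by simp

text \<open>Fatou's lemma is applied to the nonnegative sums of form and majorant. The integrals of
  the majorants along the sequence do not exceed that of the limit, so this common quantity can be
  subtracted from both sides; mere convergence of the averages almost everywhere is enough.\<close>

lemma elliptic_limit: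
  assumes [measurable]: "g \<in> borel_measurable borel" and R: "R < R0" and fin: "seminorm g < \<infinity>"
    and g: "\<And>z. \<bar>g z\<bar> \<le> C"
    and supp: "\<And>t x. \<not> (a \<le> t \<and> t \<le> b) \<or> x \<notin> ball x0 R \<Longrightarrow> g (t, x) = 0" and ab: "t1 < a" "b < t2"
    and h0: "0 < h0" and le: "\<And>h. 0 < h \<Longrightarrow> h < h0 \<Longrightarrow> (\<integral>z. elliptic (steklov h g) z \<partial>lborel) \<le> B"
  shows "(\<integral>z. elliptic g z \<partial>lborel) \<le> B"
proof -
  define h1 where "h1 = min h0 (a - t1) / 2"
  have h1: "0 < h1" "h1 < h0" "h1 < a - t1" using h0 ab by (auto simp: h1_def min_def)
  define h where "h n = h1 / real (Suc n)" for n
  have h: "0 < h n" "h n < h0" "h n < a - t1" for n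
  proof -
    have "h n \<le> h1" using h1 by (simp add: h_def divide_le_eq mult_le_cancel_left1)
    then show "0 < h n" "h n < h0" "h n < a - t1" using h1 by (auto simp: h_def)
  qed
  have "h \<longlonglongrightarrow> 0" unfolding h_def using lim_const_over_n[of h1] LIMSEQ_Suc by blast
  then have conv: "AE z in lborel. (\<lambda>n. steklov (h n) g z) \<longlonglongrightarrow> g z"
    by (intro steklov_tendsto[OF _ g] h) auto
  have gsupp: "\<And>t x. \<not> (t1 < t \<and> t < t2) \<or> x \<notin> ball x0 R \<Longrightarrow> g (t, x) = 0"
    using ab by (intro supp) auto
  have ssupp: "\<And>t x. \<not> (t1 < t \<and> t < t2) \<or> x \<notin> ball x0 R \<Longrightarrow> steklov (h n) g (t, x) = 0" for n
    using ab h[of n] by (intro steklov_eq_0 supp) auto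
  have sfin: "seminorm (steklov (h n) g) \<le> seminorm g" for n by (intro seminorm_steklov[OF _ _ g] h) auto
  then have sfin': "seminorm (steklov (h n) g) < \<infinity>" for n using fin by (rule le_less_trans)
  define F where "F k z = elliptic k z + majorant R k z" for k z
  have [measurable]: "F k \<in> borel_measurable borel" if [measurable]: "k \<in> borel_measurable borel" for k
    unfolding F_def by measurable
  have nnint: "(\<integral>\<^sup>+z. ennreal (F k z) \<partial>lborel) = ennreal ((\<integral>z. elliptic k z \<partial>lborel) + (\<integral>z. majorant R k z \<partial>lborel))"
    and maj: "ennreal (\<integral>z. majorant R k z \<partial>lborel) = (\<integral>\<^sup>+z. ennreal (majorant R k z) \<partial>lborel)"
    and elliptic_bd: "\<bar>\<integral>z. elliptic k z \<partial>lborel\<bar> \<le> (\<integral>z. majorant R k z \<partial>lborel)"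
    if [measurable]: "k \<in> borel_measurable borel" and "seminorm k < \<infinity>"
      "\<And>t x. \<not> (t1 < t \<and> t < t2) \<or> x \<notin> ball x0 R \<Longrightarrow> k (t, x) = 0" for k
  proof -
    note ei = elliptic_integrable[OF that(1) R that(2,3)] and mi = majorant_integrable[OF that(1) R that(2)]
    have ab: "\<bar>elliptic k z\<bar> \<le> majorant R k z" for z by (rule elliptic_le_majorant[where g=k and R=R, OF that(3)])
    have nn: "0 \<le> elliptic k z + majorant R k z" for z using ab[of z] by linarith
    have "(\<integral>\<^sup>+z. ennreal (F k z) \<partial>lborel) = ennreal (\<integral>z. F k z \<partial>lborel)"
      unfolding F_def by (intro nn_integral_eq_integral Bochner_Integration.integrable_add ei mi AE_I2 nn)
    then show "(\<integral>\<^sup>+z. ennreal (F k z) \<partial>lborel) = ennreal ((\<integral>z. elliptic k z \<partial>lborel) + (\<integral>z. majorant R k z \<partial>lborel))"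
      using ei mi by (simp add: F_def)
    show "ennreal (\<integral>z. majorant R k z \<partial>lborel) = (\<integral>\<^sup>+z. ennreal (majorant R k z) \<partial>lborel)"
      using ab by (intro nn_integral_eq_integral[symmetric] mi AE_I2) (metis abs_ge_zero order_trans)
    have "\<bar>\<integral>z. elliptic k z \<partial>lborel\<bar> \<le> (\<integral>z. \<bar>elliptic k z\<bar> \<partial>lborel)" by (rule integral_abs_bound)
    also have "\<dots> \<le> (\<integral>z. majorant R k z \<partial>lborel)"
      using ab ei mi by (intro integral_mono) auto
    finally show "\<bar>\<integral>z. elliptic k z \<partial>lborel\<bar> \<le> (\<integral>z. majorant R k z \<partial>lborel)" .
  qed
  \<comment> \<open>The exceptional null set of pairs (t, x) is pulled back to triples (t, x, y)
    along both projections. Each preimage is null although the free variable ranges over a set of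
    infinite measure, since 0 times \<infinity> is 0.\<close>
  have F_conv: "AE z in lborel. (\<lambda>n. F (steklov (h n) g) z) \<longlonglongrightarrow> F g z"
  proof -
    have "AE z in lborel. case z of (t, x, y) \<Rightarrow> (\<lambda>n. steklov (h n) g (t, x)) \<longlonglongrightarrow> g (t, x) \<and> (\<lambda>n. steklov (h n) g (t, y)) \<longlonglongrightarrow> g (t, y)"
    proof -
      obtain N where N: "N \<in> sets borel" "emeasure lborel N = 0" "{z. \<not> (\<lambda>n. steklov (h n) g z) \<longlonglongrightarrow> g z} \<subseteq> N"
        using conv unfolding eventually_ae_filter by (auto simp: null_sets_def)
      have [measurable]: "N \<in> sets borel" by fact
      have "emeasure lborel {z :: real \<times> 'a \<times> 'a. (fst z, fst (snd z)) \<in> N} = (\<integral>\<^sup>+z. indicator N (fst z, fst (snd z)) \<partial>(lborel :: (real \<times> 'a \<times> 'a) measure))"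
        by (subst nn_integral_indicator[symmetric]) (measurable, rule nn_integral_cong, auto split: split_indicator)
      also have "\<dots> = (\<integral>\<^sup>+t. (\<integral>\<^sup>+x. (\<integral>\<^sup>+y. indicator N (t, x) \<partial>(lborel :: 'a measure)) \<partial>lborel) \<partial>lborel)"
        by (subst nn_integral_lborel_triple) auto
      also have "\<dots> = (\<integral>\<^sup>+z. indicator N z * \<infinity> \<partial>lborel)"
        by (subst nn_integral_lborel_pair) auto
      also have "\<dots> = 0" using N by (subst nn_integral_multc) auto
      finally have 1: "AE z in (lborel :: (real \<times> 'a \<times> 'a) measure). (fst z, fst (snd z)) \<notin> N"
        by (intro AE_I[where N="{z. (fst z, fst (snd z)) \<in> N}"]) auto
      have "emeasure lborel {z :: real \<times> 'a \<times> 'a. (fst z, snd (snd z)) \<in> N} = (\<integral>\<^sup>+z. indicator N (fst z, snd (snd z)) \<partial>(lborel :: (real \<times> 'a \<times> 'a) measure))"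
        by (subst nn_integral_indicator[symmetric]) (measurable, rule nn_integral_cong, auto split: split_indicator)
      also have "\<dots> = (\<integral>\<^sup>+t. (\<integral>\<^sup>+y. (\<integral>\<^sup>+x. indicator N (t, y) \<partial>(lborel :: 'a measure)) \<partial>lborel) \<partial>lborel)"
        by (subst nn_integral_lborel_triple_swap) auto
      also have "\<dots> = (\<integral>\<^sup>+z. indicator N z * \<infinity> \<partial>lborel)"
        by (subst nn_integral_lborel_pair) auto
      also have "\<dots> = 0" using N by (subst nn_integral_multc) auto
      finally have 2: "AE z in (lborel :: (real \<times> 'a \<times> 'a) measure). (fst z, snd (snd z)) \<notin> N"
        by (intro AE_I[where N="{z. (fst z, snd (snd z)) \<in> N}"]) auto
      from 1 2 show ?thesis by eventually_elim (use N(3) in \<open>auto split: prod.splits\<close>)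
    qed
    then show ?thesis
    proof eventually_elim
      case (elim z)
      obtain t x y where z: "z = (t, x, y)" by (cases z) auto
      have "(\<lambda>n. \<bar>steklov (h n) g (t, x) - steklov (h n) g (t, y)\<bar> powr p) \<longlonglongrightarrow> \<bar>g (t, x) - g (t, y)\<bar> powr p"
        using elim p by (intro tendsto_powr' tendsto_intros) (auto simp: z)
      then show ?case using elim unfolding F_def z elliptic_def majorant_def
        by (auto intro!: tendsto_intros)
    qed
  qed
  have majb: "(\<integral>z. majorant R (steklov (h n) g) z \<partial>lborel) \<le> (\<integral>z. majorant R g z \<partial>lborel)" for n
  proof -
    have "ennreal (\<integral>z. majorant R (steklov (h n) g) z \<partial>lborel) = (\<integral>\<^sup>+z. ennreal (majorant R (steklov (h n) g) z) \<partial>lborel)"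
      by (rule maj[OF steklov_measurable[OF assms(1)] sfin' ssupp])
    also have "\<dots> \<le> (\<integral>\<^sup>+z. ennreal (majorant R g z) \<partial>lborel)"
      unfolding majorant_nn_integral[OF assms(1)] majorant_nn_integral[OF steklov_measurable[OF assms(1)]]
      by (intro mult_left_mono add_left_mono sfin) auto
    also have "\<dots> = ennreal (\<integral>z. majorant R g z \<partial>lborel)"
      by (rule maj[OF assms(1) fin gsupp, symmetric])
    finally have "ennreal (\<integral>z. majorant R (steklov (h n) g) z \<partial>lborel) \<le> ennreal (\<integral>z. majorant R g z \<partial>lborel)" .
    moreover have "0 \<le> (\<integral>z. majorant R g z \<partial>lborel)"
      using elliptic_bd[OF assms(1) fin gsupp] by linarith
    ultimately show ?thesis by (simp add: ennreal_le_iff)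
  qed
  have "(\<integral>\<^sup>+z. ennreal (F g z) \<partial>lborel) = (\<integral>\<^sup>+z. liminf (\<lambda>n. ennreal (F (steklov (h n) g) z)) \<partial>lborel)"
  proof (rule nn_integral_cong_AE, use F_conv in eventually_elim)
    case (elim z)
    then have "(\<lambda>n. ennreal (F (steklov (h n) g) z)) \<longlonglongrightarrow> ennreal (F g z)" by (rule tendsto_ennrealI)
    then show ?case by (rule lim_imp_Liminf[OF sequentially_bot, symmetric])
  qed
  also have "\<dots> \<le> liminf (\<lambda>n. \<integral>\<^sup>+z. ennreal (F (steklov (h n) g) z) \<partial>lborel)"
    by (rule nn_integral_liminf) measurable
  also have "\<dots> \<le> liminf (\<lambda>n. ennreal (B + (\<integral>z. majorant R g z \<partial>lborel)))"
  proof (intro Liminf_mono always_eventually allI)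
    fix n
    have "(\<integral>\<^sup>+z. ennreal (F (steklov (h n) g) z) \<partial>lborel)
      = ennreal ((\<integral>z. elliptic (steklov (h n) g) z \<partial>lborel) + (\<integral>z. majorant R (steklov (h n) g) z \<partial>lborel))"
      by (rule nnint[OF steklov_measurable[OF assms(1)] sfin' ssupp])
    also have "\<dots> \<le> ennreal (B + (\<integral>z. majorant R g z \<partial>lborel))"
      by (intro ennreal_leI add_mono majb le h)
    finally show "(\<integral>\<^sup>+z. ennreal (F (steklov (h n) g) z) \<partial>lborel) \<le> ennreal (B + (\<integral>z. majorant R g z \<partial>lborel))" .
  qed
  also have "\<dots> = ennreal (B + (\<integral>z. majorant R g z \<partial>lborel))" by (rule Liminf_const) simp
  finally have "(\<integral>\<^sup>+z. ennreal (F g z) \<partial>lborel) \<le> ennreal (B + (\<integral>z. majorant R g z \<partial>lborel))" .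
  then have main: "ennreal ((\<integral>z. elliptic g z \<partial>lborel) + (\<integral>z. majorant R g z \<partial>lborel)) \<le> ennreal (B + (\<integral>z. majorant R g z \<partial>lborel))"
    by (simp only: nnint[OF assms(1) fin gsupp])
  \<comment> \<open>\<open>ennreal\<close> cuts off negative reals, so the inequality can be read
    back in the reals only with a nonnegative right side.\<close>
  have "0 \<le> B + (\<integral>z. majorant R g z \<partial>lborel)"
    using le[OF h(1,2), of 0] majb[of 0] elliptic_bd[OF steklov_measurable[OF assms(1)] sfin' ssupp, of 0] by linarith
  then show ?thesis using main by (simp add: ennreal_le_iff)
qed

end

section \<open>Energy estimate on superlevel sets\<close>

definition space_cutoff :: "'a::euclidean_space \<Rightarrow> real \<Rightarrow> real \<Rightarrow> 'a \<Rightarrow> real" where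
  "space_cutoff x0 R' R x = max 0 (min 1 ((R - dist x0 x) / (R - R')))"

lemma space_cutoff_measurable [measurable]: "space_cutoff x0 R' R \<in> borel_measurable borel"
  unfolding space_cutoff_def by measurable

lemma space_cutoff_range: "0 \<le> space_cutoff x0 R' R x" "space_cutoff x0 R' R x \<le> 1"
  by (auto simp: space_cutoff_def)

lemma space_cutoff_eq_1: "R' < R \<Longrightarrow> x \<in> ball x0 R' \<Longrightarrow> space_cutoff x0 R' R x = 1"
  by (auto simp: space_cutoff_def field_simps)

lemma space_cutoff_eq_0: "R' < R \<Longrightarrow> x \<notin> ball x0 R \<Longrightarrow> space_cutoff x0 R' R x = 0"
  using divide_nonpos_pos[of "R - dist x0 x" "R - R'"] by (auto simp: space_cutoff_def)

lemma space_cutoff_diff: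
  assumes "R' < R"
  shows "\<bar>space_cutoff x0 R' R x - space_cutoff x0 R' R y\<bar> \<le> min 1 (1 / (R - R') * norm (x - y))"
proof -
  have "\<bar>(R - dist x0 x) / (R - R') - (R - dist x0 y) / (R - R')\<bar> = \<bar>dist x0 y - dist x0 x\<bar> / (R - R')"
    using assms by (simp add: diff_divide_distrib[symmetric] abs_divide)
  also have "\<dots> \<le> norm (x - y) / (R - R')"
    using assms abs_dist_diff_le[of x0 y x] dist_triangle[of x0 x y] dist_triangle[of x0 y x]
    by (intro divide_right_mono) (auto simp: dist_norm[symmetric] dist_commute abs_le_iff)
  finally have "\<bar>(R - dist x0 x) / (R - R') - (R - dist x0 y) / (R - R')\<bar> \<le> 1 / (R - R') * norm (x - y)" by simp
  then have "\<bar>space_cutoff x0 R' R x - space_cutoff x0 R' R y\<bar> \<le> 1 / (R - R') * norm (x - y)"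
    unfolding space_cutoff_def by linarith
  then show ?thesis using space_cutoff_range[of x0 R' R x] space_cutoff_range[of x0 R' R y] by simp
qed

text \<open>Rises on [a, a + d], equals 1 up to \<tau> and falls on [\<tau>, \<tau> + e]. The ascent
  is paid for once; the descent is the tool that measures the solution just after \<tau>.\<close>

definition time_cutoff :: "real \<Rightarrow> real \<Rightarrow> real \<Rightarrow> real \<Rightarrow> real \<Rightarrow> real" where
  "time_cutoff a d \<tau> e t = max 0 (min 1 (min ((t - a) / d) ((\<tau> + e - t) / e)))"

lemma time_cutoff_measurable [measurable]: "time_cutoff a d \<tau> e \<in> borel_measurable borel"
  unfolding time_cutoff_def by measurable

lemma time_cutoff_range: "0 \<le> time_cutoff a d \<tau> e t" "time_cutoff a d \<tau> e t \<le> 1"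
  by (auto simp: time_cutoff_def)

lemma time_cutoff_eq_1: "0 < d \<Longrightarrow> 0 < e \<Longrightarrow> a + d < t \<Longrightarrow> t < \<tau> \<Longrightarrow> time_cutoff a d \<tau> e t = 1"
  by (auto simp: time_cutoff_def max_def min_def field_simps)

lemma time_cutoff_eq_0: "0 < d \<Longrightarrow> 0 < e \<Longrightarrow> \<not> (a \<le> t \<and> t \<le> \<tau> + e) \<Longrightarrow> time_cutoff a d \<tau> e t = 0"
  using divide_nonpos_pos[of "t - a" d] divide_nonpos_pos[of "\<tau> + e - t" e]
  by (auto simp: time_cutoff_def not_le)

text \<open>The charge 1 / d extends back to a - d because t + h may already lie on the ascent. The
  credit -1 / e is claimed only on the first half of the descent, where h \<le> e / 2 keeps t + h on
  the descent as well. Elsewhere the quotient is not positive.\<close>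

lemma time_cutoff_quotient:
  assumes "0 < d" "0 < e" "a + d < \<tau>" and h: "0 < h" "h < d" "h \<le> e / 2"
  shows "(time_cutoff a d \<tau> e (t + h) - time_cutoff a d \<tau> e t) / h
    \<le> indicator {a - d<..<a + d} t / d - indicator {\<tau><..<\<tau> + e / 2} t / e"
proof -
  define u where "u = (t - a) / d"
  define v where "v = (\<tau> + e - t) / e"
  have u': "(t + h - a) / d = u + h / d" and v': "(\<tau> + e - (t + h)) / e = v - h / e"
    by (auto simp: u_def v_def add_divide_distrib diff_divide_distrib)
  have hd: "0 < h / d" "0 < h / e" using assms by auto
  have \<xi>: "time_cutoff a d \<tau> e (t + h) = max 0 (min 1 (min (u + h / d) (v - h / e)))"
    "time_cutoff a d \<tau> e t = max 0 (min 1 (min u v))"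
    unfolding time_cutoff_def u' v' by (auto simp: u_def v_def)
  have diff: "time_cutoff a d \<tau> e (t + h) - time_cutoff a d \<tau> e t
    \<le> h * (indicator {a - d<..<a + d} t / d - indicator {\<tau><..<\<tau> + e / 2} t / e)"
  proof -
    consider "t \<le> a - d" | "a - d < t" "t < a + d" | "a + d \<le> t" "\<tau> < t" "t < \<tau> + e / 2"
      | "a + d \<le> t" "\<not> (\<tau> < t \<and> t < \<tau> + e / 2)" by linarith
    then show ?thesis
    proof cases
      case 1
      then have "u \<le> -1" using assms by (simp add: u_def divide_le_eq)
      moreover have "h / d < 1" using assms by simp
      ultimately have "u + h / d \<le> 0" "u \<le> 0" by linarith+
      then show ?thesis using 1 assms unfolding \<xi> by (auto simp: indicator_def)
    next
      case 2
      have "max 0 (min 1 (min (u + h / d) (v - h / e))) - max 0 (min 1 (min u v)) \<le> h / d"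
        using hd by linarith
      then show ?thesis using 2 assms unfolding \<xi> by (simp add: indicator_def)
    next
      case 3
      have "1 \<le> u" using 3 assms by (simp add: u_def le_divide_eq)
      moreover have "v \<le> 1" using 3 assms by (simp add: v_def divide_le_eq)
      moreover have "h / e \<le> v" using 3 assms by (simp add: v_def divide_right_mono)
      ultimately show ?thesis using 3 assms hd unfolding \<xi> by (auto simp: indicator_def)
    next
      case 4
      then have "1 \<le> u" using assms by (simp add: u_def le_divide_eq)
      then have "min 1 (min u v) = min 1 v" by simp
      then have "min 1 (min (u + h / d) (v - h / e)) \<le> min 1 (min u v)"
        using hd by (simp add: min.coboundedI2)
      then have "max 0 (min 1 (min (u + h / d) (v - h / e))) - max 0 (min 1 (min u v)) \<le> 0" by auto
      moreover have "indicator {a - d<..<a + d} t = (0 :: real)" "indicator {\<tau><..<\<tau> + e / 2} t = (0 :: real)"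
        using 4 by (auto simp: indicator_def)
      ultimately show ?thesis unfolding \<xi> by simp
    qed
  qed
  show ?thesis using diff h by (simp add: divide_le_eq mult.commute)
qed

text \<open>All that the following keeps of the weak formulation: the test functions are averages of
  bounded functions supported away from t1 and t2, so the boundary terms are gone, and Borel
  functions with \<open>lborel\<close> replace \<open>u\<close>, \<open>K\<close> and the completed
  measure.\<close>

locale nonlocal_subsolution = nonlocal_energy +
  assumes weak: "\<And>g C a b R h. g \<in> borel_measurable borel \<Longrightarrow> (\<And>z. 0 \<le> g z) \<Longrightarrow> (\<And>z. g z \<le> C) \<Longrightarrow>
      0 < h \<Longrightarrow> t1 < a - h \<Longrightarrow> a \<le> b \<Longrightarrow> b < t2 \<Longrightarrow> R < R0 \<Longrightarrow>
      (\<And>t x. \<not> (a \<le> t \<and> t \<le> b) \<or> x \<notin> ball x0 R \<Longrightarrow> g (t, x) = 0) \<Longrightarrow> seminorm g < \<infinity> \<Longrightarrow>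
      (\<integral>z. elliptic (steklov h g) z \<partial>lborel) \<le> (\<integral>z. spow q (V z) * ((g (fst z + h, snd z) - g z) / h) \<partial>lborel)"
begin

section \<open>Superlevel sets and truncated test functions\<close>

definition superlevel :: "real \<Rightarrow> real \<Rightarrow> real \<Rightarrow> real \<Rightarrow> (real \<times> 'a) set" where
  "superlevel \<alpha> \<beta> R k = {z. \<alpha> < fst z \<and> fst z < \<beta> \<and> snd z \<in> ball x0 R \<and> k < V z}"

lemma superlevel_measurable [measurable]: "superlevel \<alpha> \<beta> R k \<in> sets borel"
  unfolding superlevel_def by measurable

lemma superlevel_finite: "emeasure lborel (superlevel \<alpha> \<beta> R k) < \<infinity>"
proof (rule emeasure_bounded_finite)
  have "superlevel \<alpha> \<beta> R k \<subseteq> {\<alpha><..<\<beta>} \<times> ball x0 R" by (auto simp: superlevel_def)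
  then show "bounded (superlevel \<alpha> \<beta> R k)" by (rule bounded_subset[rotated]) (intro bounded_Times, auto)
qed

lemma superlevel_integrable: "integrable lborel (indicat_real (superlevel \<alpha> \<beta> R k))"
  using superlevel_finite by (intro integrable_real_indicator) auto

text \<open>The spatial cutoff enters with the power p, the form in which
  \<open>truncated_form_lower\<close> bounds the cutoff error by |\<alpha> - \<beta>|^p.\<close>

definition truncation :: "(real \<Rightarrow> real) \<Rightarrow> ('a \<Rightarrow> real) \<Rightarrow> real \<Rightarrow> real \<times> 'a \<Rightarrow> real" where
  "truncation \<xi> \<eta> k z = \<xi> (fst z) * \<eta> (snd z) powr p * max 0 (V z - k)"

lemma truncation_measurable [measurable]:
  assumes [measurable]: "\<xi> \<in> borel_measurable borel" "\<eta> \<in> borel_measurable borel"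
  shows "truncation \<xi> \<eta> k \<in> borel_measurable borel"
  unfolding truncation_def by measurable

lemma min_kernel_integral:
  obtains C where "0 < C"
    "\<And>L (x::'a). 0 < L \<Longrightarrow> (\<integral>\<^sup>+y. ennreal (min 1 (L * norm (x - y)) powr p * fker \<sigma> (x, y)) \<partial>lborel) \<le> ennreal (C * L powr \<sigma>)"
proof -
  obtain C where C: "0 < C" "\<And>L (x::'a). 0 < L \<Longrightarrow>
      (\<integral>\<^sup>+y. ennreal (min 1 (L * norm (x - y)) powr p / norm (x - y) powr (real DIM('a) + \<sigma>)) \<partial>lborel)
        \<le> ennreal (C * L powr \<sigma>)"
    using cutoff_kernel_integral[OF \<sigma>, where 'a='a] by blast
  show ?thesis by (rule that[OF C(1)]) (use C(2) in \<open>simp add: fker_def\<close>)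
qed

text \<open>Product rule for increments: \<eta>^p times the increment of the truncation is
  controlled by the increment of V, hence by \<open>cross_energy\<close>; the truncation, at most
  2M, times the increment of \<eta>^p is controlled by the kernel integral of the cutoff, since z^p
  has Lipschitz constant p on [0, 1]. This explains the constant (2 M p)^p.\<close>

lemma seminorm_truncation:
  assumes [measurable]: "\<xi> \<in> borel_measurable borel" and \<xi>: "\<And>t. 0 \<le> \<xi> t" "\<And>t. \<xi> t \<le> 1"
    and \<xi>0: "\<And>t. \<not> (t1 < t \<and> t < t2) \<Longrightarrow> \<xi> t = 0" and R: "R' < R" "R < R0" and k: "\<bar>k\<bar> \<le> M"
  shows "seminorm (truncation \<xi> (space_cutoff x0 R' R) k) < \<infinity>"
proof -
  obtain C where C: "0 < C"
    "\<And>L (x::'a). 0 < L \<Longrightarrow> (\<integral>\<^sup>+y. ennreal (min 1 (L * norm (x - y)) powr p * fker \<sigma> (x, y)) \<partial>lborel) \<le> ennreal (C * L powr \<sigma>)"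
    using min_kernel_integral by blast
  define L where "L = 1 / (R - R')"
  have L: "0 < L" using R by (simp add: L_def)
  define \<eta> where "\<eta> = space_cutoff x0 R' R"
  have [measurable]: "\<eta> \<in> borel_measurable borel" by (simp add: \<eta>_def)
  define f where "f w = ennreal (min 1 (L * norm (fst w - snd w)) powr p * fker \<sigma> w)" for w :: "'a \<times> 'a"
  have [measurable]: "f \<in> borel_measurable borel" unfolding f_def by measurable
  define E where "E = {t1<..<t2} \<times> ball x0 R"
  have [measurable]: "E \<in> sets borel" unfolding E_def by (intro borel_open open_Times) auto
  have E: "emeasure lborel E < \<infinity>"
    unfolding E_def by (intro emeasure_bounded_finite bounded_Times) auto
  have "(\<integral>\<^sup>+(t, x, y). (indicator E (t, x) + indicator E (t, y)) * f (x, y) \<partial>lborel) \<le> 2 * ennreal (C * L powr \<sigma>) * emeasure lborel E"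
    by (rule nn_integral_touch) (use C(2)[OF L] in \<open>auto simp: f_def fker_def norm_minus_commute\<close>)
  also have "\<dots> < \<infinity>" using E by (simp add: ennreal_mult_less_top)
  finally have fin: "(\<integral>\<^sup>+(t, x, y). (indicator E (t, x) + indicator E (t, y)) * f (x, y) \<partial>lborel) < \<infinity>" .
  define cr where "cr = (\<lambda>(t, x, y). (if t1 < t \<and> t < t2 \<and> touch R x y then ennreal (\<bar>V (t, x) - V (t, y)\<bar> powr p * fker \<sigma> (x, y)) else 0))"
  have [measurable]: "Measurable.pred borel (\<lambda>z::real \<times> 'a \<times> 'a. touch R (fst (snd z)) (snd (snd z)))"
    using touch_measurable[of R] by (simp add: split_beta')
  have [measurable]: "cr \<in> borel_measurable borel" unfolding cr_def split_beta' by measurable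
  define c where "c = (2 * M * p) powr p"
  have "seminorm (truncation \<xi> \<eta> k) \<le> (\<integral>\<^sup>+z. ennreal (2 powr p) * (cr z + ennreal c * (case z of (t, x, y) \<Rightarrow> (indicator E (t, x) + indicator E (t, y)) * f (x, y))) \<partial>lborel)"
    unfolding seminorm_def
  proof (intro nn_integral_mono)
    fix z :: "real \<times> 'a \<times> 'a"
    obtain t x y where z: "z = (t, x, y)" by (cases z) auto
    let ?g = "truncation \<xi> \<eta> k"
    have "ennreal (\<bar>?g (t, x) - ?g (t, y)\<bar> powr p) * ennreal (fker \<sigma> (x, y))
      \<le> ennreal (2 powr p) * (cr (t, x, y) + ennreal c * ((indicator E (t, x) + indicator E (t, y)) * f (x, y)))"
    proof (cases "t1 < t \<and> t < t2 \<and> touch R x y")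
      case False
      then have "?g (t, x) = 0" "?g (t, y) = 0"
        using \<xi>0 space_cutoff_eq_0[OF R(1)] by (auto simp: truncation_def touch_def \<eta>_def)
      then show ?thesis by simp
    next
      case True
      define wx where "wx = max 0 (V (t, x) - k)"
      define wy where "wy = max 0 (V (t, y) - k)"
      have w: "\<bar>wx - wy\<bar> \<le> \<bar>V (t, x) - V (t, y)\<bar>" "0 \<le> wy" "wy \<le> 2 * M"
        using V[of "(t, y)"] k M_nonneg by (auto simp: wx_def wy_def)
      have \<eta>: "0 \<le> \<eta> x" "\<eta> x \<le> 1" "0 \<le> \<eta> y" "\<eta> y \<le> 1"
        using space_cutoff_range by (auto simp: \<eta>_def)
      have \<eta>p: "\<bar>\<eta> x powr p - \<eta> y powr p\<bar> \<le> p * \<bar>\<eta> x - \<eta> y\<bar>"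
      proof -
        have *: "\<bar>\<beta> powr p - \<alpha> powr p\<bar> \<le> p * (\<beta> - \<alpha>)" if "0 \<le> \<alpha>" "\<alpha> \<le> \<beta>" "\<beta> \<le> 1" for \<alpha> \<beta> :: real
        proof -
          have "\<alpha> powr p \<le> \<beta> powr p" using that p by (intro powr_mono2) auto
          moreover have "\<beta> powr (p - 1) \<le> 1" using that p by (intro powr_le1) auto
          then have "p * \<beta> powr (p - 1) * (\<beta> - \<alpha>) \<le> p * 1 * (\<beta> - \<alpha>)"
            using that p by (intro mult_right_mono mult_left_mono) auto
          ultimately show ?thesis using powr_diff_le[of p \<alpha> \<beta>] that p by linarith
        qed
        show ?thesis
        proof (cases "\<eta> x \<le> \<eta> y")
          case True then show ?thesis using *[of "\<eta> x" "\<eta> y"] \<eta> by (simp add: abs_minus_commute)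
        next
          case False then show ?thesis using *[of "\<eta> y" "\<eta> x"] \<eta> by simp
        qed
      qed
      have "?g (t, x) - ?g (t, y) = \<xi> t * (\<eta> x powr p * (wx - wy) + wy * (\<eta> x powr p - \<eta> y powr p))"
        by (simp add: truncation_def wx_def wy_def algebra_simps)
      then have "\<bar>?g (t, x) - ?g (t, y)\<bar> \<le> 1 * \<bar>\<eta> x powr p * (wx - wy) + wy * (\<eta> x powr p - \<eta> y powr p)\<bar>"
        using \<xi> by (simp add: abs_mult mult_left_le_one_le)
      also have "\<dots> \<le> \<bar>\<eta> x powr p * (wx - wy)\<bar> + \<bar>wy * (\<eta> x powr p - \<eta> y powr p)\<bar>" by simp
      also have "\<bar>\<eta> x powr p * (wx - wy)\<bar> \<le> 1 * \<bar>V (t, x) - V (t, y)\<bar>"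
        unfolding abs_mult using w \<eta> p by (intro mult_mono) (auto intro: powr_le1)
      also have "\<bar>wy * (\<eta> x powr p - \<eta> y powr p)\<bar> \<le> (2 * M) * (p * \<bar>\<eta> x - \<eta> y\<bar>)"
        unfolding abs_mult using w \<eta>p M_nonneg by (intro mult_mono) auto
      finally have "\<bar>?g (t, x) - ?g (t, y)\<bar> \<le> \<bar>V (t, x) - V (t, y)\<bar> + 2 * M * p * \<bar>\<eta> x - \<eta> y\<bar>" by simp
      then have "\<bar>?g (t, x) - ?g (t, y)\<bar> powr p \<le> (\<bar>V (t, x) - V (t, y)\<bar> + 2 * M * p * \<bar>\<eta> x - \<eta> y\<bar>) powr p"
        using p by (intro powr_mono2) auto
      also have "\<dots> \<le> 2 powr p * (\<bar>V (t, x) - V (t, y)\<bar> powr p + (2 * M * p * \<bar>\<eta> x - \<eta> y\<bar>) powr p)"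
        using p M_nonneg by (intro powr_add_le) auto
      also have "(2 * M * p * \<bar>\<eta> x - \<eta> y\<bar>) powr p = c * \<bar>\<eta> x - \<eta> y\<bar> powr p"
        using p M_nonneg by (simp add: c_def powr_mult)
      also have "\<bar>\<eta> x - \<eta> y\<bar> powr p \<le> min 1 (L * norm (x - y)) powr p"
        using p space_cutoff_diff[OF R(1)] by (intro powr_mono2) (auto simp: \<eta>_def L_def)
      finally have "\<bar>?g (t, x) - ?g (t, y)\<bar> powr p \<le> 2 powr p * (\<bar>V (t, x) - V (t, y)\<bar> powr p + c * min 1 (L * norm (x - y)) powr p)"
        by (auto simp: c_def mult_left_mono)
      then have "\<bar>?g (t, x) - ?g (t, y)\<bar> powr p * fker \<sigma> (x, y)
        \<le> 2 powr p * (\<bar>V (t, x) - V (t, y)\<bar> powr p + c * min 1 (L * norm (x - y)) powr p) * fker \<sigma> (x, y)"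
        by (intro mult_right_mono fker_nonneg)
      also have "\<dots> = 2 powr p * (\<bar>V (t, x) - V (t, y)\<bar> powr p * fker \<sigma> (x, y) + c * (min 1 (L * norm (x - y)) powr p * fker \<sigma> (x, y)))"
        by (simp add: algebra_simps)
      finally have "ennreal (\<bar>?g (t, x) - ?g (t, y)\<bar> powr p * fker \<sigma> (x, y)) \<le> ennreal \<dots>" by (rule ennreal_leI)
      also have "\<dots> = ennreal (2 powr p) * (cr (t, x, y) + ennreal c * f (x, y))"
      proof -
        have nn: "0 \<le> \<bar>V (t, x) - V (t, y)\<bar> powr p * fker \<sigma> (x, y)" "0 \<le> min 1 (L * norm (x - y)) powr p * fker \<sigma> (x, y)" "0 \<le> c"
          by (auto simp: fker_nonneg c_def)
        then have eq: "cr (t, x, y) + ennreal c * f (x, y) = ennreal (\<bar>V (t, x) - V (t, y)\<bar> powr p * fker \<sigma> (x, y) + c * (min 1 (L * norm (x - y)) powr p * fker \<sigma> (x, y)))"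
          using True by (subst ennreal_plus) (auto simp: cr_def f_def ennreal_mult)
        show ?thesis unfolding eq by (rule ennreal_mult') simp
      qed
      also have "\<dots> \<le> ennreal (2 powr p) * (cr (t, x, y) + ennreal c * ((indicator E (t, x) + indicator E (t, y)) * f (x, y)))"
        using True by (intro mult_left_mono add_left_mono) (auto simp: E_def touch_def indicator_def distrib_right add_increasing add_increasing2)
      finally show ?thesis by (simp add: ennreal_mult fker_nonneg)
    qed
    then show "(case z of (t, x, y) \<Rightarrow> ennreal (\<bar>?g (t, x) - ?g (t, y)\<bar> powr p) * ennreal (fker \<sigma> (x, y)))
      \<le> ennreal (2 powr p) * (cr z + ennreal c * (case z of (t, x, y) \<Rightarrow> (indicator E (t, x) + indicator E (t, y)) * f (x, y)))"
      by (simp add: z)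
  qed
  also have "\<dots> = ennreal (2 powr p) * ((\<integral>\<^sup>+z. cr z \<partial>lborel) + ennreal c * (\<integral>\<^sup>+(t, x, y). (indicator E (t, x) + indicator E (t, y)) * f (x, y) \<partial>lborel))"
    unfolding split_beta' by (subst nn_integral_cmult, measurable) (subst nn_integral_add, auto simp: nn_integral_cmult)
  also have "\<dots> < \<infinity>" using fin cross_energy[OF R(2)] by (auto simp: cr_def ennreal_mult_less_top)
  finally show ?thesis by (simp add: \<eta>_def)
qed

text \<open>Convexity (\<open>bregman_diff_le\<close>) turns the difference quotient of \<open>spow q V\<close> into one of the
  Bregman distance; the shift in time then moves it onto the cutoff.\<close>

lemma time_term_le:
  assumes [measurable]: "\<zeta> \<in> borel_measurable borel" and \<zeta>: "\<And>z. 0 \<le> \<zeta> z" "\<And>z. \<zeta> z \<le> 1"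
    and supp: "\<And>t x. \<not> (a \<le> t \<and> t \<le> b) \<or> x \<notin> ball x0 R \<Longrightarrow> \<zeta> (t, x) = 0" and h: "0 < h" and k: "\<bar>k\<bar> \<le> M"
  shows "(\<integral>z. spow q (V z) * ((\<zeta> (fst z + h, snd z) * max 0 (V (fst z + h, snd z) - k) - \<zeta> z * max 0 (V z - k)) / h) \<partial>lborel)
     \<le> (\<integral>z. bregman q k (V z) * ((\<zeta> (fst z + h, snd z) - \<zeta> z) / h) \<partial>lborel)"
    and "integrable lborel (\<lambda>z. bregman q k (V z) * ((\<zeta> (fst z + h, snd z) - \<zeta> z) / h))"
proof -
  define H where "H z = max 0 (V z - k)" for z
  define b' where "b' z = spow q (V z)" for z
  define \<Psi> where "\<Psi> z = bregman q k (V z)" for z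
  define sh where "sh z = (fst z + h, snd z)" for z :: "real \<times> 'a"
  have [measurable]: "H \<in> borel_measurable borel" "b' \<in> borel_measurable borel" "\<Psi> \<in> borel_measurable borel"
    "sh \<in> borel \<rightarrow>\<^sub>M borel"
    unfolding H_def b'_def \<Psi>_def sh_def by measurable
  have bounds: "\<bar>H z\<bar> \<le> 2 * M" "\<bar>b' z\<bar> \<le> M powr q" "\<bar>\<Psi> z\<bar> \<le> 4 * M * M powr q" for z
  proof -
    show "\<bar>H z\<bar> \<le> 2 * M" using V[of z] k M_nonneg by (auto simp: H_def)
    show "\<bar>b' z\<bar> \<le> M powr q" using V[of z] q by (auto simp: b'_def abs_spow intro!: powr_mono2)
    show "\<bar>\<Psi> z\<bar> \<le> 4 * M * M powr q" using bregman_le[OF q V k] bregman_nonneg[OF q] by (simp add: \<Psi>_def)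
  qed
  define S where "S = {a - h..b + h} \<times> ball x0 R"
  have [measurable]: "S \<in> sets borel" unfolding S_def by (simp add: borel_prod[symmetric])
  have S: "bounded S" unfolding S_def by (intro bounded_Times) auto
  have int: "integrable lborel (\<lambda>z. f z * \<zeta> (w z))"
    if [measurable]: "f \<in> borel_measurable borel" and "\<And>z. \<bar>f z\<bar> \<le> B" and w: "w = id \<or> w = sh" for f w B
  proof (rule integrable_bounded_support[of _ S B])
    have [measurable]: "w \<in> borel \<rightarrow>\<^sub>M borel" using w by auto
    show "(\<lambda>z. f z * \<zeta> (w z)) \<in> borel_measurable borel" by measurable
    have "\<zeta> (w z) = 0" if "z \<notin> S" for z
      using that w h by (cases z) (auto simp: sh_def S_def intro!: supp)
    then show "f z * \<zeta> (w z) = 0" if "z \<notin> S" for z using that by simp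
    show "\<bar>f z * \<zeta> (w z)\<bar> \<le> B" for z
      using \<zeta>[of "w z"] that(2)[of z] mult_mono[of "\<bar>f z\<bar>" B "\<bar>\<zeta> (w z)\<bar>" 1] by (simp add: abs_mult order_trans[OF abs_ge_zero that(2)])
  qed (use S in auto)
  have bb: "\<bar>b' z * H w\<bar> \<le> M powr q * (2 * M)" for z w
    unfolding abs_mult by (intro mult_mono bounds) auto
  have wsh: "sh = id \<or> sh = sh" and wid: "id = id \<or> id = sh" by simp_all
  have i1: "integrable lborel (\<lambda>z. (b' z * H (sh z)) * \<zeta> (sh z))" "integrable lborel (\<lambda>z. (b' z * H z) * \<zeta> (id z))"
    "integrable lborel (\<lambda>z. \<Psi> z * \<zeta> (sh z))" "integrable lborel (\<lambda>z. \<Psi> z * \<zeta> (id z))"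
    "integrable lborel (\<lambda>z. (b' (sh z) * H (sh z)) * \<zeta> (sh z))" "integrable lborel (\<lambda>z. \<Psi> (sh z) * \<zeta> (sh z))"
    by (rule int[OF _ bb wsh] int[OF _ bb wid] int[OF _ bounds(3) wsh] int[OF _ bounds(3) wid], measurable)+
  \<comment> \<open>\<open>bregman_diff_le\<close>, multiplied by the shifted cutoff, bounds the
    terms that mix two times by c at the shifted point. The integral of c is invariant under the
    shift, and what remains is the claim after division by h.\<close>
  define c where "c z = b' z * H z * \<zeta> z - \<Psi> z * \<zeta> z" for z
  have [measurable]: "c \<in> borel_measurable borel" unfolding c_def by measurable
  have shift: "(\<integral>z. c (sh z) \<partial>lborel) = (\<integral>z. c z \<partial>lborel)"
    using integral_lborel_shift[of c "(h, 0)"] by (simp add: sh_def add.commute split_beta' plus_prod_def)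
  have ci: "integrable lborel c" "integrable lborel (\<lambda>z. c (sh z))"
    using i1 by (auto simp: c_def[abs_def])
  have "(\<integral>z. b' z * H (sh z) * \<zeta> (sh z) - \<Psi> z * \<zeta> (sh z) \<partial>lborel) \<le> (\<integral>z. c (sh z) \<partial>lborel)"
  proof (rule integral_mono)
    fix z
    have "(\<Psi> (sh z) - \<Psi> z) * \<zeta> (sh z) \<le> ((b' (sh z) - b' z) * H (sh z)) * \<zeta> (sh z)"
      using bregman_diff_le[OF q, of k "V (sh z)" "V z"] \<zeta> by (intro mult_right_mono) (auto simp: \<Psi>_def b'_def H_def)
    then show "b' z * H (sh z) * \<zeta> (sh z) - \<Psi> z * \<zeta> (sh z) \<le> c (sh z)"
      by (simp add: c_def algebra_simps)
  qed (use i1 ci in auto)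
  then have le: "(\<integral>z. b' z * H (sh z) * \<zeta> (sh z) - \<Psi> z * \<zeta> (sh z) \<partial>lborel) - (\<integral>z. c z \<partial>lborel) \<le> 0"
    by (simp add: shift)
  have e1: "(\<lambda>z. spow q (V z) * ((\<zeta> (fst z + h, snd z) * max 0 (V (fst z + h, snd z) - k) - \<zeta> z * max 0 (V z - k)) / h))
    = (\<lambda>z. (b' z * H (sh z) * \<zeta> (sh z) - b' z * H z * \<zeta> z) / h)"
    and e2: "(\<lambda>z. bregman q k (V z) * ((\<zeta> (fst z + h, snd z) - \<zeta> z) / h)) = (\<lambda>z. (\<Psi> z * \<zeta> (sh z) - \<Psi> z * \<zeta> z) / h)"
    by (auto simp: b'_def H_def sh_def \<Psi>_def algebra_simps)
  show "integrable lborel (\<lambda>z. bregman q k (V z) * ((\<zeta> (fst z + h, snd z) - \<zeta> z) / h))"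
    unfolding e2 using i1 by auto
  have "(\<integral>z. (b' z * H (sh z) * \<zeta> (sh z) - b' z * H z * \<zeta> z) / h \<partial>lborel) - (\<integral>z. (\<Psi> z * \<zeta> (sh z) - \<Psi> z * \<zeta> z) / h \<partial>lborel)
    = ((\<integral>z. b' z * H (sh z) * \<zeta> (sh z) - \<Psi> z * \<zeta> (sh z) \<partial>lborel) - (\<integral>z. c z \<partial>lborel)) / h"
    using i1 h by (simp add: c_def diff_divide_distrib[symmetric] add_divide_distrib[symmetric])
  also have "\<dots> \<le> 0" using le h by (simp add: divide_nonpos_pos)
  finally show "(\<integral>z. spow q (V z) * ((\<zeta> (fst z + h, snd z) * max 0 (V (fst z + h, snd z) - k) - \<zeta> z * max 0 (V z - k)) / h) \<partial>lborel)
     \<le> (\<integral>z. bregman q k (V z) * ((\<zeta> (fst z + h, snd z) - \<zeta> z) / h) \<partial>lborel)"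
    unfolding e1 e2 by simp
qed

text \<open>Only x is localized: y may lie anywhere with V (t, y) \<le> k, because the tested form
  involves all of space in its second variable.\<close>

definition jump :: "real \<Rightarrow> real \<Rightarrow> real \<Rightarrow> real \<Rightarrow> real \<Rightarrow> real \<times> 'a \<times> 'a \<Rightarrow> real" where
  "jump \<alpha> \<beta> R k k' = (\<lambda>(t, x, y). if (t, x) \<in> superlevel \<alpha> \<beta> R k' \<and> V (t, y) \<le> k then fker \<sigma> (x, y) else 0)"

lemma jump_measurable [measurable]: "jump \<alpha> \<beta> R k k' \<in> borel_measurable borel"
  unfolding jump_def split_beta' by measurable

text \<open>One test yields two gains: the jump energy, and the measure of the superlevel set just
  after the arbitrary time \<tau>, with weight 1 / e. As e does not occur on the right, it may be
  sent to 0, which gives a bound for almost every slice and replaces a supremum over time.\<close>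

lemma caccioppoli:
  obtains C where "0 < C"
    "\<And>c0 k k' R R' \<alpha> \<beta> d \<tau> e. \<lbrakk>0 \<le> c0; \<And>x y. k \<le> x \<Longrightarrow> x \<le> y \<Longrightarrow> y \<le> k' \<Longrightarrow> c0 * (y - x) \<le> spow q y - spow q x;
       k < k'; \<bar>k\<bar> \<le> M; R' < R; R < R0; t1 \<le> \<alpha>; \<beta> \<le> t2; 0 < d; 0 < e; \<alpha> + 2 * d < \<tau>; \<tau> + e < \<beta>\<rbrakk> \<Longrightarrow>
     ennreal ((k' - k) powr p / \<Lambda>) * (\<integral>\<^sup>+z. ennreal (jump (\<alpha> + 2 * d) \<tau> R' k k' z) \<partial>lborel)
       + ennreal (c0 * (k' - k)\<^sup>2 / 4 / e * measure lborel (superlevel \<tau> (\<tau> + e / 2) R' k'))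
     \<le> ennreal (C * (1 / d + (1 / (R - R')) powr \<sigma>) * measure lborel (superlevel \<alpha> \<beta> R k))"
proof -
  obtain Ck where Ck: "0 < Ck"
    "\<And>L (x::'a). 0 < L \<Longrightarrow> (\<integral>\<^sup>+y. ennreal (min 1 (L * norm (x - y)) powr p * fker \<sigma> (x, y)) \<partial>lborel) \<le> ennreal (Ck * L powr \<sigma>)"
    using min_kernel_integral by blast
  \<comment> \<open>c1 is the error constant of \<open>truncated_form_lower\<close> for truncations
    of size at most 2M, times the upper kernel bound; c2 bounds the Bregman distance. The summand 1
    in C makes it positive also when M = 0.\<close>
  define c1 where "c1 = \<Lambda> * (p powr p * (2 * M) powr p)"
  define c2 where "c2 = 4 * M * M powr q"
  have c12: "0 \<le> c1" "0 \<le> c2" using \<Lambda> M_nonneg by (auto simp: c1_def c2_def)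
  define C where "C = c2 + 2 * c1 * Ck + 1"
  have "0 < C" using c12 Ck by (auto simp: C_def intro!: add_nonneg_pos)
  then show ?thesis
  proof (rule that)
    show "ennreal ((k' - k) powr p / \<Lambda>) * (\<integral>\<^sup>+z. ennreal (jump (\<alpha> + 2 * d) \<tau> R' k k' z) \<partial>lborel)
       + ennreal (c0 * (k' - k)\<^sup>2 / 4 / e * measure lborel (superlevel \<tau> (\<tau> + e / 2) R' k'))
     \<le> ennreal (C * (1 / d + (1 / (R - R')) powr \<sigma>) * measure lborel (superlevel \<alpha> \<beta> R k))"
    if c0: "0 \<le> c0" and slope: "\<And>x y. k \<le> x \<Longrightarrow> x \<le> y \<Longrightarrow> y \<le> k' \<Longrightarrow> c0 * (y - x) \<le> spow q y - spow q x"
      and kk: "k < k'" "\<bar>k\<bar> \<le> M" and R: "R' < R" "R < R0" and \<alpha>\<beta>: "t1 \<le> \<alpha>" "\<beta> \<le> t2"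
      and de: "0 < d" "0 < e" "\<alpha> + 2 * d < \<tau>" "\<tau> + e < \<beta>"
    for c0 k k' R R' \<alpha> \<beta> d \<tau> e
  proof -
    \<comment> \<open>With the ascent on [\<alpha> + d, \<alpha> + 2d], the charge of the forward
      quotient, which reaches back by d, still lies in the times after \<alpha>.\<close>
    define a where "a = \<alpha> + d"
    define \<xi> where "\<xi> = time_cutoff a d \<tau> e"
    define \<eta> where "\<eta> = space_cutoff x0 R' R"
    define L where "L = 1 / (R - R')"
    have L: "0 < L" using R by (simp add: L_def)
    have [measurable]: "\<xi> \<in> borel_measurable borel" "\<eta> \<in> borel_measurable borel"
      by (auto simp: \<xi>_def \<eta>_def)
    have \<xi>: "0 \<le> \<xi> t" "\<xi> t \<le> 1" for t using time_cutoff_range by (auto simp: \<xi>_def)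
    have \<eta>: "0 \<le> \<eta> x" "\<eta> x \<le> 1" for x using space_cutoff_range by (auto simp: \<eta>_def)
    have \<xi>0: "\<xi> t = 0" if "\<not> (a \<le> t \<and> t \<le> \<tau> + e)" for t
      using time_cutoff_eq_0[OF de(1,2) that] by (simp add: \<xi>_def)
    have \<xi>1: "\<xi> t = 1" if "\<alpha> + 2 * d < t" "t < \<tau>" for t
      using time_cutoff_eq_1[OF de(1,2), of a t \<tau>] that by (simp add: \<xi>_def a_def)
    have \<eta>0: "\<eta> x = 0" if "x \<notin> ball x0 R" for x using space_cutoff_eq_0[OF R(1) that] by (simp add: \<eta>_def)
    have \<eta>1: "\<eta> x = 1" if "x \<in> ball x0 R'" for x using space_cutoff_eq_1[OF R(1) that] by (simp add: \<eta>_def)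
    define g where "g = truncation \<xi> \<eta> k"
    have [measurable]: "g \<in> borel_measurable borel" unfolding g_def by measurable
    have gfin: "seminorm g < \<infinity>"
      unfolding g_def \<eta>_def using \<xi> kk R \<xi>0 \<alpha>\<beta> de by (intro seminorm_truncation) (auto simp: a_def)
    have gnn: "0 \<le> g z" for z using \<xi> by (simp add: g_def truncation_def)
    have gle: "g z \<le> 2 * M" for z
    proof -
      have "\<xi> (fst z) * \<eta> (snd z) powr p * max 0 (V z - k) \<le> 1 * 1 * (2 * M)"
        using \<xi> \<eta> V[of z] kk M_nonneg p by (intro mult_mono powr_le1) auto
      then show ?thesis by (simp add: g_def truncation_def)
    qed
    have gsupp: "g (t, x) = 0" if "\<not> (a \<le> t \<and> t \<le> \<tau> + e) \<or> x \<notin> ball x0 R" for t x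
      using that \<xi>0 \<eta>0 by (auto simp: g_def truncation_def)
    define m where "m = measure lborel (superlevel \<alpha> \<beta> R k)"
    define m' where "m' = measure lborel (superlevel \<tau> (\<tau> + e / 2) R' k')"
    define c where "c = c0 * (k' - k)\<^sup>2 / 4"
    have m: "0 \<le> m" "0 \<le> m'" and c: "0 \<le> c" using c0 by (auto simp: m_def m'_def c_def)
    \<comment> \<open>A bound free of h, as the limit requires: the ascent costs at most c2 / d on
      the superlevel set of k, and the first half of the descent gains at least c / e on the set of
      k' in the smaller ball, where \<eta> = 1 and the Bregman distance is at least c.\<close>
    define B where "B = c2 / d * m - c / e * m'"
    have ell_le: "(\<integral>z. elliptic g z \<partial>lborel) \<le> B"
    proof (rule elliptic_limit[where ?h0.0="min d (e / 2)"])
      fix h assume h: "0 < h" "h < min d (e / 2)"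
      define \<zeta> where "\<zeta> z = \<xi> (fst z) * \<eta> (snd z) powr p" for z
      have [measurable]: "\<zeta> \<in> borel_measurable borel" unfolding \<zeta>_def by measurable
      have \<zeta>: "0 \<le> \<zeta> z" "\<zeta> z \<le> 1" for z
        using \<xi> \<eta> p mult_mono[of "\<xi> (fst z)" 1 "\<eta> (snd z) powr p" 1] by (auto simp: \<zeta>_def powr_le1)
      have \<zeta>supp: "\<And>t x. \<not> (a \<le> t \<and> t \<le> \<tau> + e) \<or> x \<notin> ball x0 R \<Longrightarrow> \<zeta> (t, x) = 0"
        using \<xi>0 \<eta>0 by (auto simp: \<zeta>_def)
      have "(\<integral>z. elliptic (steklov h g) z \<partial>lborel) \<le> (\<integral>z. spow q (V z) * ((g (fst z + h, snd z) - g z) / h) \<partial>lborel)"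
        using gnn gle h de R \<alpha>\<beta> gfin gsupp by (intro weak[where a=a and b="\<tau> + e" and R=R]) (auto simp: a_def)
      also have "\<dots> = (\<integral>z. spow q (V z) * ((\<zeta> (fst z + h, snd z) * max 0 (V (fst z + h, snd z) - k) - \<zeta> z * max 0 (V z - k)) / h) \<partial>lborel)"
        by (simp add: g_def truncation_def \<zeta>_def)
      also have "\<dots> \<le> (\<integral>z. bregman q k (V z) * ((\<zeta> (fst z + h, snd z) - \<zeta> z) / h) \<partial>lborel)"
        by (rule time_term_le(1)[where \<zeta>=\<zeta> and a=a and b="\<tau> + e" and R=R, OF _ \<zeta> \<zeta>supp h(1) kk(2)]) measurable
      also have "\<dots> \<le> (\<integral>z. c2 / d * indicator (superlevel \<alpha> \<beta> R k) z - c / e * indicator (superlevel \<tau> (\<tau> + e / 2) R' k') z \<partial>lborel)"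
      proof (rule integral_mono)
        show "integrable lborel (\<lambda>z. bregman q k (V z) * ((\<zeta> (fst z + h, snd z) - \<zeta> z) / h))"
          by (rule time_term_le(2)[where \<zeta>=\<zeta> and a=a and b="\<tau> + e" and R=R, OF _ \<zeta> \<zeta>supp h(1) kk(2)]) measurable
        show "integrable lborel (\<lambda>z. c2 / d * indicator (superlevel \<alpha> \<beta> R k) z - c / e * indicator (superlevel \<tau> (\<tau> + e / 2) R' k') z)"
          by (intro Bochner_Integration.integrable_diff integrable_mult_right superlevel_integrable)
      next
        fix z :: "real \<times> 'a"
        obtain t x where z: "z = (t, x)" by (cases z)
        define \<Psi> where "\<Psi> = bregman q k (V z)"
        have \<Psi>: "0 \<le> \<Psi>" "\<Psi> \<le> c2" using bregman_nonneg[OF q] bregman_le[OF q V kk(2)] by (auto simp: \<Psi>_def c2_def)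
        have quot: "(\<xi> (t + h) - \<xi> t) / h \<le> indicator {a - d<..<a + d} t / d - indicator {\<tau><..<\<tau> + e / 2} t / e"
          unfolding \<xi>_def using de h by (intro time_cutoff_quotient) (auto simp: a_def)
        have ep: "0 \<le> \<eta> x powr p" "\<eta> x powr p \<le> 1" using \<eta> p by (auto intro: powr_le1)
        have "\<Psi> * ((\<zeta> (t + h, x) - \<zeta> (t, x)) / h) = (\<Psi> * \<eta> x powr p) * ((\<xi> (t + h) - \<xi> t) / h)"
          by (simp add: \<zeta>_def algebra_simps)
        also have "\<dots> \<le> (\<Psi> * \<eta> x powr p) * (indicator {a - d<..<a + d} t / d - indicator {\<tau><..<\<tau> + e / 2} t / e)"
          using \<Psi> by (intro mult_left_mono quot) auto
        also have "\<dots> = \<Psi> * \<eta> x powr p * indicator {a - d<..<a + d} t / d - \<Psi> * \<eta> x powr p * indicator {\<tau><..<\<tau> + e / 2} t / e"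
          by (simp add: algebra_simps)
        also have "\<dots> \<le> c2 / d * indicator (superlevel \<alpha> \<beta> R k) z - c / e * indicator (superlevel \<tau> (\<tau> + e / 2) R' k') z"
        proof (rule diff_mono)
          show "\<Psi> * \<eta> x powr p * indicator {a - d<..<a + d} t / d \<le> c2 / d * indicator (superlevel \<alpha> \<beta> R k) z"
          proof (cases "z \<in> superlevel \<alpha> \<beta> R k")
            case True
            have "\<Psi> * \<eta> x powr p * indicator {a - d<..<a + d} t \<le> c2 * 1 * 1"
              using \<Psi> ep c12 by (intro mult_mono) (auto simp: indicator_def)
            then show ?thesis using True de by (simp add: divide_right_mono)
          next
            case False
            have "\<Psi> * \<eta> x powr p * indicator {a - d<..<a + d} t = 0"
            proof (cases "V z \<le> k \<or> x \<notin> ball x0 R")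
              case True then show ?thesis using bregman_eq_0[of "V z" k q] \<eta>0 p by (auto simp: \<Psi>_def)
            next
              case F: False
              then have "t \<notin> {a - d<..<a + d}" using False de by (auto simp: superlevel_def z a_def)
              then show ?thesis by simp
            qed
            then show ?thesis using False by (simp only: indicator_simps(2)) simp
          qed
          show "c / e * indicator (superlevel \<tau> (\<tau> + e / 2) R' k') z \<le> \<Psi> * \<eta> x powr p * indicator {\<tau><..<\<tau> + e / 2} t / e"
          proof (cases "z \<in> superlevel \<tau> (\<tau> + e / 2) R' k'")
            case True
            then have "c \<le> \<Psi>" using bregman_lower[OF q c0 kk(1) _ slope, of "V z"] by (auto simp: c_def \<Psi>_def superlevel_def)
            then show ?thesis using True de \<eta>1 by (auto simp: superlevel_def z divide_right_mono)
          next
            case False then show ?thesis using \<Psi> de ep by simp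
          qed
        qed
        finally show "bregman q k (V z) * ((\<zeta> (fst z + h, snd z) - \<zeta> z) / h)
          \<le> c2 / d * indicator (superlevel \<alpha> \<beta> R k) z - c / e * indicator (superlevel \<tau> (\<tau> + e / 2) R' k') z"
          by (simp add: z \<Psi>_def)
      qed
      also have "\<dots> = B"
        using superlevel_integrable superlevel_finite by (simp add: B_def m_def m'_def)
      finally show "(\<integral>z. elliptic (steklov h g) z \<partial>lborel) \<le> B" .
    next
      show "\<bar>g z\<bar> \<le> 2 * M" for z using gnn gle by simp
      show "g (t, x) = 0" if "\<not> (a \<le> t \<and> t \<le> \<tau> + e) \<or> x \<notin> ball x0 R" for t x by (rule gsupp[OF that])
    qed (use R gfin \<alpha>\<beta> de in \<open>auto simp: a_def\<close>)
    define f where "f w = ennreal (min 1 (L * norm (fst w - snd w)) powr p * fker \<sigma> w)" for w :: "'a \<times> 'a"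
    have [measurable]: "f \<in> borel_measurable borel" unfolding f_def by measurable
    define A where "A = superlevel \<alpha> \<beta> R k"
    have [measurable]: "A \<in> sets borel" unfolding A_def by measurable
    define Er where "Er = (\<lambda>(t, x, y). c1 * ((indicat_real A (t, x) + indicat_real A (t, y)) * (min 1 (L * norm (x - y)) powr p * fker \<sigma> (x, y))))"
    have [measurable]: "Er \<in> borel_measurable borel" unfolding Er_def split_beta' by measurable
    have Er_nn: "0 \<le> Er z" for z using c12 by (auto simp: Er_def fker_nonneg split: prod.splits)
    have Er_int: "(\<integral>\<^sup>+z. ennreal (Er z) \<partial>lborel) \<le> ennreal (2 * c1 * Ck * L powr \<sigma> * m)"
    proof -
      have "(\<integral>\<^sup>+z. ennreal (Er z) \<partial>lborel) = (\<integral>\<^sup>+z. ennreal c1 * (case z of (t, x, y) \<Rightarrow> (indicator A (t, x) + indicator A (t, y)) * f (x, y)) \<partial>lborel)"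
        using c12 by (intro nn_integral_cong)
          (auto simp: Er_def f_def ennreal_mult' fker_nonneg indicator_def distrib_right split: prod.splits)
      also have "\<dots> = ennreal c1 * (\<integral>\<^sup>+(t, x, y). (indicator A (t, x) + indicator A (t, y)) * f (x, y) \<partial>lborel)"
        unfolding split_beta' by (rule nn_integral_cmult) measurable
      also have "\<dots> \<le> ennreal c1 * (2 * ennreal (Ck * L powr \<sigma>) * emeasure lborel A)"
        by (intro mult_left_mono nn_integral_touch)
          (use Ck(2)[OF L] in \<open>auto simp: f_def fker_def norm_minus_commute\<close>)
      also have "emeasure lborel A = ennreal m"
        using superlevel_finite by (simp add: A_def m_def emeasure_eq_ennreal_measure less_top)
      also have "ennreal c1 * (2 * ennreal (Ck * L powr \<sigma>) * ennreal m) = ennreal (c1 * (2 * (Ck * L powr \<sigma>) * m))"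
        using c12 Ck m by (simp add: ennreal_mult)
      finally show ?thesis by (simp add: mult_ac)
    qed
    have Er_integrable: "integrable lborel Er"
      by (rule real_nn_bound_integrable[where G="\<lambda>z. ennreal (Er z)"])
        (use Er_nn Er_int in \<open>auto intro: le_less_trans\<close>)
    have Er_le: "(\<integral>z. Er z \<partial>lborel) \<le> 2 * c1 * Ck * L powr \<sigma> * m"
    proof -
      have "ennreal (\<integral>z. Er z \<partial>lborel) \<le> ennreal (2 * c1 * Ck * L powr \<sigma> * m)"
        using Er_int Er_nn Er_integrable by (subst nn_integral_eq_integral[symmetric]) auto
      then show ?thesis using c12 Ck m by (simp add: ennreal_le_iff)
    qed
    have ell_int: "integrable lborel (elliptic g)"
      using \<alpha>\<beta> de gsupp by (intro elliptic_integrable[where R=R] R gfin) (auto simp: a_def)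
    define J where "J z = (k' - k) powr p / \<Lambda> * jump (\<alpha> + 2 * d) \<tau> R' k k' z" for z
    have [measurable]: "J \<in> borel_measurable borel" unfolding J_def by measurable
    have J_nn: "0 \<le> J z" for z using \<Lambda> by (auto simp: J_def jump_def fker_nonneg split: prod.splits)
    \<comment> \<open>Only now, with g itself in place of its averages, does the tested form have
      the structure of \<open>truncated_form_lower\<close>. The lower kernel bound serves the gain,
      where \<open>\<xi> t\<close> and \<open>\<eta> x\<close> are 1; the upper kernel bound serves
      the error.\<close>
    have J_le: "J z \<le> elliptic g z + Er z" for z
    proof -
      obtain t x y where z: "z = (t, x, y)" by (cases z) auto
      define form where "form = spow (p - 1) (V (t, x) - V (t, y)) * (max 0 (V (t, x) - k) * \<eta> x powr p - max 0 (V (t, y) - k) * \<eta> y powr p)"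
      define j where "j = (if k' < V (t, x) \<and> V (t, y) \<le> k then (k' - k) powr p * \<eta> x powr p else 0)"
      define er where "er = (if k < V (t, x) \<and> k < V (t, y) then p powr p * (2 * M) powr p * \<bar>\<eta> x - \<eta> y\<bar> powr p else 0)"
      have form: "j - er \<le> form"
        unfolding j_def er_def form_def
        using p \<eta> V[of "(t, x)"] V[of "(t, y)"] kk by (intro truncated_form_lower) auto
      have ell: "elliptic g z = \<xi> t * \<kappa> (t, x, y) * form"
        by (simp add: z elliptic_def g_def truncation_def form_def algebra_simps)
      have \<xi>\<kappa>: "0 \<le> \<xi> t * \<kappa> (t, x, y)" using \<xi> \<kappa>_nonneg by simp
      have "\<xi> t * \<kappa> (t, x, y) * (j - er) \<le> elliptic g z" unfolding ell using \<xi>\<kappa> form by (rule mult_left_mono[rotated])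
      then have 1: "\<xi> t * \<kappa> (t, x, y) * j - \<xi> t * \<kappa> (t, x, y) * er \<le> elliptic g z" by (simp add: right_diff_distrib)
      have 2: "J z \<le> \<xi> t * \<kappa> (t, x, y) * j"
      proof (cases "(t, x) \<in> superlevel (\<alpha> + 2 * d) \<tau> R' k' \<and> V (t, y) \<le> k")
        case True
        then have "\<xi> t = 1" "j = (k' - k) powr p" using \<xi>1 \<eta>1 by (auto simp: j_def superlevel_def)
        moreover have "(k' - k) powr p * (fker \<sigma> (x, y) / \<Lambda>) \<le> (k' - k) powr p * \<kappa> (t, x, y)"
          by (intro mult_left_mono \<kappa>) auto
        ultimately show ?thesis using True by (simp add: J_def jump_def z mult.commute)
      next
        case False
        then have "J z = 0" by (auto simp: J_def jump_def z)
        moreover have "0 \<le> j" by (auto simp: j_def)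
        ultimately show ?thesis using \<xi>\<kappa> by simp
      qed
      \<comment> \<open>The error lives where both values exceed k and one of the points lies in the
        ball, so at least one of (t, x), (t, y) belongs to A, and the error is charged to the
        measure of A.\<close>
      have 3: "\<xi> t * \<kappa> (t, x, y) * er \<le> Er z"
      proof (cases "a \<le> t \<and> t \<le> \<tau> + e \<and> k < V (t, x) \<and> k < V (t, y) \<and> (x \<in> ball x0 R \<or> y \<in> ball x0 R)")
        case True
        then have ind: "1 \<le> indicat_real A (t, x) + indicat_real A (t, y)"
          using de by (auto simp: A_def superlevel_def a_def indicator_def)
        have er: "er \<le> p powr p * (2 * M) powr p * min 1 (L * norm (x - y)) powr p"
          using True p space_cutoff_diff[OF R(1), of x0 x y] by (auto simp: er_def \<eta>_def L_def intro!: mult_left_mono powr_mono2)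
        have "0 \<le> er" "0 \<le> \<Lambda> * fker \<sigma> (x, y)" using \<Lambda> by (auto simp: er_def fker_nonneg)
        have "\<xi> t * \<kappa> (t, x, y) * er \<le> (1 * (\<Lambda> * fker \<sigma> (x, y))) * (p powr p * (2 * M) powr p * min 1 (L * norm (x - y)) powr p)"
          using \<xi> \<kappa> \<kappa>_nonneg \<Lambda> \<open>0 \<le> er\<close> \<open>0 \<le> \<Lambda> * fker \<sigma> (x, y)\<close> er by (intro mult_mono) auto
        also have "\<dots> = 1 * (c1 * (min 1 (L * norm (x - y)) powr p * fker \<sigma> (x, y)))" by (simp add: c1_def mult_ac)
        also have "\<dots> \<le> (indicat_real A (t, x) + indicat_real A (t, y)) * (c1 * (min 1 (L * norm (x - y)) powr p * fker \<sigma> (x, y)))"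
          using ind c12 by (intro mult_right_mono) (auto simp: fker_nonneg)
        finally show ?thesis by (simp add: Er_def z mult_ac)
      next
        case False
        then have "\<xi> t * er = 0" using \<xi>0 \<eta>0 p by (auto simp: er_def)
        then have "\<xi> t * \<kappa> (t, x, y) * er = 0" by auto
        then show ?thesis using Er_nn[of z] by (simp only:)
      qed
      show ?thesis using 1 2 3 by linarith
    qed
    define s where "s = (\<integral>z. elliptic g z \<partial>lborel) + (\<integral>z. Er z \<partial>lborel)"
    have s_eq: "s = (\<integral>z. elliptic g z + Er z \<partial>lborel)" using ell_int Er_integrable by (simp add: s_def)
    have s0: "0 \<le> s" unfolding s_eq
      by (rule Bochner_Integration.integral_nonneg) (rule order_trans[OF J_nn J_le])
    have "s + c / e * m' \<le> c2 / d * m + 2 * c1 * Ck * L powr \<sigma> * m" using ell_le Er_le by (simp add: s_def B_def)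
    also have "\<dots> = (c2 * (1 / d) + (2 * c1 * Ck) * L powr \<sigma>) * m" by (simp add: algebra_simps)
    also have "\<dots> \<le> (C * (1 / d) + C * L powr \<sigma>) * m"
      using c12 Ck m de by (intro mult_right_mono add_mono) (auto simp: C_def divide_right_mono intro!: mult_right_mono)
    finally have total: "s + c / e * m' \<le> C * (1 / d + L powr \<sigma>) * m" by (simp add: distrib_left)
    have "ennreal ((k' - k) powr p / \<Lambda>) * (\<integral>\<^sup>+z. ennreal (jump (\<alpha> + 2 * d) \<tau> R' k k' z) \<partial>lborel) = (\<integral>\<^sup>+z. ennreal (J z) \<partial>lborel)"
      unfolding J_def using \<Lambda>
      by (subst nn_integral_cmult[symmetric], measurable) (intro nn_integral_cong ennreal_mult'[symmetric], simp)
    also have "\<dots> \<le> (\<integral>\<^sup>+z. ennreal (elliptic g z + Er z) \<partial>lborel)"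
      by (intro nn_integral_mono ennreal_leI J_le)
    also have "\<dots> = ennreal s"
      unfolding s_eq by (intro nn_integral_eq_integral Bochner_Integration.integrable_add ell_int Er_integrable AE_I2 order_trans[OF J_nn J_le])
    finally have "ennreal ((k' - k) powr p / \<Lambda>) * (\<integral>\<^sup>+z. ennreal (jump (\<alpha> + 2 * d) \<tau> R' k k' z) \<partial>lborel) + ennreal (c / e * m')
      \<le> ennreal s + ennreal (c / e * m')" by (rule add_right_mono)
    also have "\<dots> = ennreal (s + c / e * m')" using s0 c m de by (simp add: ennreal_plus)
    also have "\<dots> \<le> ennreal (C * (1 / d + L powr \<sigma>) * m)" using total by (rule ennreal_leI)
    finally show ?thesis by (simp add: c_def m_def m'_def L_def)
  qed
  qed
qed

end

section \<open>De Giorgi iteration\<close>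

context nonlocal_subsolution
begin

section \<open>Slices of superlevel sets at a fixed time\<close>

definition slice_set :: "real \<Rightarrow> real \<Rightarrow> real \<Rightarrow> 'a set" where
  "slice_set R k t = {x \<in> ball x0 R. k < V (t, x)}"

definition slice :: "real \<Rightarrow> real \<Rightarrow> real \<Rightarrow> real" where
  "slice R k t = measure lborel (slice_set R k t)"

lemma slice_set_measurable [measurable]: "slice_set R k t \<in> sets borel"
  unfolding slice_set_def by measurable

lemma emeasure_slice: "emeasure lborel (slice_set R k t) = ennreal (slice R k t)"
proof -
  have "emeasure lborel (slice_set R k t) < \<infinity>"
    by (rule emeasure_bounded_finite) (rule bounded_subset[OF bounded_ball[of x0 R]], auto simp: slice_set_def)
  then show ?thesis by (simp add: slice_def emeasure_eq_ennreal_measure less_top)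
qed

lemma slice_measurable [measurable]: "slice R k \<in> borel_measurable borel"
proof -
  have "(\<lambda>t. \<integral>\<^sup>+x. indicator {z. snd z \<in> ball x0 R \<and> k < V z} (t, x) \<partial>lborel) \<in> borel_measurable borel"
    by measurable
  also have "(\<lambda>t. \<integral>\<^sup>+x. indicator {z. snd z \<in> ball x0 R \<and> k < V z} (t, x) \<partial>lborel) = (\<lambda>t. emeasure lborel (slice_set R k t))"
  proof
    fix t
    have "(\<integral>\<^sup>+x. indicator {z. snd z \<in> ball x0 R \<and> k < V z} (t, x) \<partial>lborel) = (\<integral>\<^sup>+x. indicator (slice_set R k t) x \<partial>lborel)"
      by (intro nn_integral_cong) (auto simp: slice_set_def split: split_indicator)
    also have "\<dots> = emeasure lborel (slice_set R k t)" by (rule nn_integral_indicator) measurable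
    finally show "(\<integral>\<^sup>+x. indicator {z. snd z \<in> ball x0 R \<and> k < V z} (t, x) \<partial>lborel) = emeasure lborel (slice_set R k t)" .
  qed
  finally show ?thesis by (simp add: slice_def[abs_def] measure_def)
qed

lemma slice_nonneg: "0 \<le> slice R k t"
  by (simp add: slice_def)

lemma slice_le_ball: "slice R k t \<le> measure lborel (ball x0 R)"
  unfolding slice_def using emeasure_lborel_ball_finite[of x0 R]
  by (intro measure_mono_fmeasurable) (auto simp: fmeasurable_def slice_set_def)

lemma emeasure_superlevel: "emeasure lborel (superlevel \<alpha> \<beta> R k) = (\<integral>\<^sup>+t. indicator {\<alpha><..<\<beta>} t * ennreal (slice R k t) \<partial>lborel)"
proof -
  have "emeasure lborel (superlevel \<alpha> \<beta> R k) = (\<integral>\<^sup>+t. (\<integral>\<^sup>+x. indicator (superlevel \<alpha> \<beta> R k) (t, x) \<partial>lborel) \<partial>lborel)"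
    by (subst nn_integral_lborel_pair[symmetric]) auto
  also have "\<dots> = (\<integral>\<^sup>+t. (\<integral>\<^sup>+x. indicator {\<alpha><..<\<beta>} t * indicator (slice_set R k t) x \<partial>lborel) \<partial>lborel)"
    by (intro nn_integral_cong) (auto simp: superlevel_def slice_set_def split: split_indicator)
  also have "\<dots> = (\<integral>\<^sup>+t. indicator {\<alpha><..<\<beta>} t * ennreal (slice R k t) \<partial>lborel)"
    by (simp add: nn_integral_cmult emeasure_slice)
  finally show ?thesis .
qed

lemma superlevel_mono:
  assumes "\<alpha> \<le> \<alpha>'" "\<beta>' \<le> \<beta>" "R' \<le> R" "k \<le> k'"
  shows "measure lborel (superlevel \<alpha>' \<beta>' R' k') \<le> measure lborel (superlevel \<alpha> \<beta> R k)"
  by (rule measure_mono_fmeasurable)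
     (use assms superlevel_finite in \<open>auto simp: superlevel_def fmeasurable_def\<close>)

text \<open>Differentiation in time: \<open>steklov_tendsto\<close> is applied to a function that
  does not depend on x, whose averages are the measures of the superlevel sets over short time
  intervals, divided by their lengths. The dummy variable x is the reason why the statement speaks
  of almost every z.\<close>

lemma AE_slice_le:
  assumes le: "\<And>\<tau>. \<alpha> < \<tau> \<Longrightarrow> \<tau> < \<beta> \<Longrightarrow> \<exists>e0>0. \<forall>e. 0 < e \<and> e < e0 \<longrightarrow> measure lborel (superlevel \<tau> (\<tau> + e) R k) \<le> S * e"
  shows "AE z in (lborel :: (real \<times> 'a) measure). \<alpha> < fst z \<and> fst z < \<beta> \<longrightarrow> slice R k (fst z) \<le> S"
proof -
  define g :: "real \<times> 'a \<Rightarrow> real" where "g z = slice R k (fst z)" for z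
  have [measurable]: "g \<in> borel_measurable borel" unfolding g_def by measurable
  define h :: "nat \<Rightarrow> real" where "h n = 1 / real (Suc n)" for n
  have h: "0 < h n" for n by (simp add: h_def)
  have h0: "h \<longlonglongrightarrow> 0" unfolding h_def using lim_const_over_n[of 1] LIMSEQ_Suc by blast
  have gb: "\<bar>g z\<bar> \<le> measure lborel (ball x0 R)" for z using slice_nonneg slice_le_ball by (simp add: g_def)
  have "AE z in lborel. (\<lambda>n. steklov (h n) g z) \<longlonglongrightarrow> g z"
    by (rule steklov_tendsto[OF _ gb h h0]) measurable
  then show ?thesis
  proof eventually_elim
    case (elim z)
    obtain t x where z: "z = (t, x)" by (cases z)
    show ?case
    proof (intro impI)
      assume t: "\<alpha> < fst z \<and> fst z < \<beta>"
      then obtain e0 where e0: "e0 > 0" "\<And>e. 0 < e \<Longrightarrow> e < e0 \<Longrightarrow> measure lborel (superlevel t (t + e) R k) \<le> S * e"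
        using le[of t] by (auto simp: z)
      have "steklov e g z \<le> S" if e: "0 < e" "e < e0" for e
      proof -
        have int: "integrable lborel (\<lambda>\<tau>. indicator {0..e} \<tau> * g (t + \<tau>, x))"
          by (rule steklov_section_integrable[OF _ gb]) measurable
        have "ennreal (\<integral>\<tau>. indicator {0..e} \<tau> * g (t + \<tau>, x) \<partial>lborel) = (\<integral>\<^sup>+\<tau>. ennreal (indicator {0..e} \<tau> * g (t + \<tau>, x)) \<partial>lborel)"
          by (rule nn_integral_eq_integral[symmetric, OF int]) (auto simp: g_def slice_nonneg)
        also have "\<dots> = (\<integral>\<^sup>+\<tau>. indicator {t..t + e} (t + \<tau>) * ennreal (slice R k (t + \<tau>)) \<partial>lborel)"
          by (intro nn_integral_cong) (auto simp: g_def split: split_indicator)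
        also have "\<dots> = (\<integral>\<^sup>+\<tau>. indicator {t..t + e} \<tau> * ennreal (slice R k \<tau>) \<partial>lborel)"
          by (rule nn_integral_lborel_shift) measurable
        also have "\<dots> = (\<integral>\<^sup>+\<tau>. indicator {t<..<t + e} \<tau> * ennreal (slice R k \<tau>) \<partial>lborel)"
          by (rule nn_integral_cong_AE, use AE_lborel_singleton[of t] AE_lborel_singleton[of "t + e"] in eventually_elim)
             (auto split: split_indicator)
        also have "\<dots> = ennreal (measure lborel (superlevel t (t + e) R k))"
          using superlevel_finite by (simp add: emeasure_superlevel[symmetric] emeasure_eq_ennreal_measure less_top)
        finally have "(\<integral>\<tau>. indicator {0..e} \<tau> * g (t + \<tau>, x) \<partial>lborel) = measure lborel (superlevel t (t + e) R k)"
          by (subst (asm) ennreal_inj) (auto intro!: Bochner_Integration.integral_nonneg simp: g_def slice_nonneg)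
        then show ?thesis using e0(2)[OF e] e by (simp add: z steklov_def divide_le_eq)
      qed
      moreover have "\<forall>\<^sub>F n in sequentially. h n < e0" using h0 e0(1) by (rule order_tendstoD)
      ultimately have "\<forall>\<^sub>F n in sequentially. steklov (h n) g z \<le> S"
        using h by (auto elim: eventually_mono)
      then show "slice R k (fst z) \<le> S"
        using tendsto_upperbound[OF elim] by (auto simp: g_def)
    qed
  qed
qed

text \<open>\<rho> is the radius at which a ball has measure 2S. A slice has measure at most S, so a
  part of measure at least S of the ball around x lies where V \<le> k, and the kernel there is at
  least \<rho>^(-(n + \<sigma>)); by the choice of \<rho> the product is half the unit ball volume
  times \<rho>^(-\<sigma>). The condition R' + \<rho> \<le> R keeps these balls in the region of the
  slice bound.\<close>

lemma jump_lower:
  assumes slice: "AE z in (lborel :: (real \<times> 'a) measure). \<alpha> < fst z \<and> fst z < \<beta> \<longrightarrow> slice R k (fst z) \<le> S"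
    and \<rho>: "0 < \<rho>" "R' + \<rho> \<le> R" "unit_ball_vol (real DIM('a)) * \<rho> powr real DIM('a) = 2 * S"
  shows "ennreal (unit_ball_vol (real DIM('a)) / 2 * \<rho> powr (- \<sigma>) * measure lborel (superlevel \<alpha> \<beta> R' k'))
    \<le> (\<integral>\<^sup>+z. ennreal (jump \<alpha> \<beta> R' k k' z) \<partial>lborel)"
proof -
  define n where "n = real DIM('a)"
  define \<omega> where "\<omega> = unit_ball_vol n"
  have \<omega>: "0 < \<omega>" by (simp add: \<omega>_def n_def)
  define A where "A = superlevel \<alpha> \<beta> R' k'"
  have [measurable]: "A \<in> sets borel" by (simp add: A_def)
  define c where "c = \<omega> / 2 * \<rho> powr (- \<sigma>)"
  have c: "0 \<le> c" using \<omega> by (simp add: c_def)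
  have S: "0 < S" using \<rho>(3) \<rho>(1) \<omega> by (metis \<omega>_def n_def mult_pos_pos powr_gt_zero zero_less_mult_pos zero_less_numeral less_irrefl)
  have ptw: "ennreal c \<le> (\<integral>\<^sup>+y. ennreal (jump \<alpha> \<beta> R' k k' (t, x, y)) \<partial>lborel)"
    if z: "(t, x) \<in> A" and st: "slice R k t \<le> S" for t x
  proof -
    define D where "D = ball x \<rho> - slice_set R k t"
    have [measurable]: "D \<in> sets borel" unfolding D_def by (intro sets.Diff) measurable
    have sub: "ball x \<rho> \<subseteq> ball x0 R"
    proof
      fix y assume "y \<in> ball x \<rho>"
      moreover have "dist x0 x < R'" using z by (simp add: A_def superlevel_def)
      ultimately show "y \<in> ball x0 R" using dist_triangle[of x0 y x] \<rho>(2) by simp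
    qed
    have "ennreal S \<le> emeasure lborel (ball x \<rho>) - emeasure lborel (slice_set R k t)"
    proof -
      have "emeasure lborel (ball x \<rho>) = ennreal (2 * S)" using \<rho>(1,3) by (simp add: emeasure_ball_powr)
      then show ?thesis using st S slice_nonneg
        by (auto simp: emeasure_slice ennreal_minus intro!: ennreal_leI)
    qed
    also have "\<dots> \<le> emeasure lborel D"
    proof -
      have "emeasure lborel (ball x \<rho>) \<le> emeasure lborel (slice_set R k t \<union> D)"
        by (rule emeasure_mono) (auto simp: D_def)
      also have "\<dots> \<le> emeasure lborel (slice_set R k t) + emeasure lborel D"
        by (rule emeasure_subadditive) auto
      finally show ?thesis by (simp add: ennreal_minus_le_iff emeasure_slice)
    qed
    finally have D: "ennreal S \<le> emeasure lborel D" .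
    have "c = \<rho> powr (- (n + \<sigma>)) * S"
    proof -
      have "\<rho> powr (- (n + \<sigma>)) * (2 * S) = \<omega> * (\<rho> powr (- (n + \<sigma>)) * \<rho> powr n)"
        using \<rho>(3) by (simp add: \<omega>_def n_def)
      also have "\<rho> powr (- (n + \<sigma>)) * \<rho> powr n = \<rho> powr (- \<sigma>)" by (simp add: powr_add[symmetric])
      finally show ?thesis by (simp add: c_def)
    qed
    then have "ennreal c = ennreal (\<rho> powr (- (n + \<sigma>))) * ennreal S" using S by (simp add: ennreal_mult)
    also have "\<dots> \<le> ennreal (\<rho> powr (- (n + \<sigma>))) * emeasure lborel D" by (intro mult_left_mono D) auto
    also have "\<dots> = (\<integral>\<^sup>+y. ennreal (\<rho> powr (- (n + \<sigma>))) * indicator D y \<partial>lborel)"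
      by (rule nn_integral_cmult_indicator[symmetric]) measurable
    also have "\<dots> \<le> (\<integral>\<^sup>+y. ennreal (jump \<alpha> \<beta> R' k k' (t, x, y)) \<partial>lborel)"
    proof (rule nn_integral_mono_AE, use AE_lborel_singleton[of x] in eventually_elim)
      case (elim y)
      show ?case
      proof (cases "y \<in> D")
        case True
        then have y: "norm (x - y) < \<rho>" "V (t, y) \<le> k" using sub by (auto simp: D_def slice_set_def dist_norm)
        have "\<rho> powr (- (n + \<sigma>)) \<le> norm (x - y) powr (- (n + \<sigma>))"
          using y elim \<sigma> by (intro powr_mono2') (auto simp: n_def)
        also have "\<dots> = jump \<alpha> \<beta> R' k k' (t, x, y)"
          using y z by (simp only: powr_minus_divide) (simp add: jump_def A_def fker_def n_def)
        finally show ?thesis using True by (simp add: ennreal_leI)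
      qed simp
    qed
    finally show ?thesis .
  qed
  have "ennreal (c * measure lborel A) = ennreal c * emeasure lborel A"
    using c superlevel_finite by (simp add: A_def emeasure_eq_ennreal_measure less_top ennreal_mult)
  also have "\<dots> = (\<integral>\<^sup>+z. ennreal c * indicator A z \<partial>lborel)"
    by (rule nn_integral_cmult_indicator[symmetric]) measurable
  also have "\<dots> \<le> (\<integral>\<^sup>+z. (\<integral>\<^sup>+y. ennreal (jump \<alpha> \<beta> R' k k' (fst z, snd z, y)) \<partial>lborel) \<partial>lborel)"
  proof (rule nn_integral_mono_AE, use slice in eventually_elim)
    case (elim z)
    then show ?case using ptw[of "fst z" "snd z"]
      by (cases "z \<in> A") (auto simp: A_def superlevel_def)
  qed
  also have "\<dots> = (\<integral>\<^sup>+z. ennreal (jump \<alpha> \<beta> R' k k' z) \<partial>lborel)"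
    by (subst nn_integral_lborel_pair, measurable) (simp add: nn_integral_lborel_triple)
  finally show ?thesis by (simp add: c_def A_def \<omega>_def n_def mult.assoc)
qed

text \<open>One cycle takes two steps. From j to j + 1 the energy estimate bounds almost every
  slice; from j + 1 to j + 2 this bound, expressed as a radius \<rho>, makes the jump energy strong.
  With \<gamma> = \<sigma> / n and y_j = a_j / r^(n + \<sigma>) the outcome is a_(j+2) \<le> K B^j
  y_j^\<gamma> a_j, a superlinear recursion for every second term. In these scale invariant units
  the constants depend neither on r nor on t0.\<close>

lemma de_giorgi:
  assumes c0: "0 < c0" and slope: "\<And>x y. k0 \<le> x \<Longrightarrow> x \<le> y \<Longrightarrow> y \<le> k1 \<Longrightarrow> c0 * (y - x) \<le> spow q y - spow q x"
    and kk: "k0 < k1" "\<bar>k0\<bar> \<le> M" "\<bar>k1\<bar> \<le> M" and \<theta>: "0 < \<theta>"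
  obtains \<nu> where "0 < \<nu>"
    "\<And>r t0. \<lbrakk>0 < r; r < R0; t1 \<le> t0 - \<theta> * r powr \<sigma>; t0 + \<theta> * r powr \<sigma> \<le> t2;
       measure lborel (superlevel (t0 - \<theta> * r powr \<sigma>) (t0 + \<theta> * r powr \<sigma>) r k0) \<le> \<nu> * r powr (real DIM('a) + \<sigma>)\<rbrakk>
       \<Longrightarrow> measure lborel (superlevel (t0 - \<theta> * r powr \<sigma> / 2) (t0 + \<theta> * r powr \<sigma> / 2) (r / 2) k1) = 0"
proof -
  define n where "n = real DIM('a)"
  define \<omega> where "\<omega> = unit_ball_vol n"
  have n: "0 < n" and \<omega>: "0 < \<omega>" by (auto simp: \<omega>_def n_def)
  define \<gamma> where "\<gamma> = \<sigma> / n"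
  have \<gamma>: "0 < \<gamma>" using \<sigma> n by (simp add: \<gamma>_def)
  define \<Delta> where "\<Delta> = k1 - k0"
  have \<Delta>: "0 < \<Delta>" using kk by (simp add: \<Delta>_def)
  obtain C where C: "0 < C"
    and cacc: "\<And>c0 k k' R R' \<alpha> \<beta> d \<tau> e. \<lbrakk>0 \<le> c0; \<And>x y. k \<le> x \<Longrightarrow> x \<le> y \<Longrightarrow> y \<le> k' \<Longrightarrow> c0 * (y - x) \<le> spow q y - spow q x;
       k < k'; \<bar>k\<bar> \<le> M; R' < R; R < R0; t1 \<le> \<alpha>; \<beta> \<le> t2; 0 < d; 0 < e; \<alpha> + 2 * d < \<tau>; \<tau> + e < \<beta>\<rbrakk> \<Longrightarrow>
     ennreal ((k' - k) powr p / \<Lambda>) * (\<integral>\<^sup>+z. ennreal (jump (\<alpha> + 2 * d) \<tau> R' k k' z) \<partial>lborel)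
       + ennreal (c0 * (k' - k)\<^sup>2 / 4 / e * measure lborel (superlevel \<tau> (\<tau> + e / 2) R' k'))
     \<le> ennreal (C * (1 / d + (1 / (R - R')) powr \<sigma>) * measure lborel (superlevel \<alpha> \<beta> R k))"
    using caccioppoli by blast
  \<comment> \<open>Below, x_j = 2^j: the time gap costs x_j and the space gap x_j^\<sigma>, and
    x_j^m bounds both. C1 belongs to the energy estimate, C2 to the slices, C3 to the power
    \<rho>^\<sigma>, C4 to the jump energy, and B dominates all powers of x_j that occur.\<close>
  define m where "m = 1 + \<sigma>"
  define C1 where "C1 = C * (8 / \<theta> + 4 powr \<sigma>)"
  \<comment> \<open>32 = 8 * 4: the 8 comes from the factor 1 / 4 and the descent length 2e in the
    energy estimate, the 4 from squaring the level gap \<Delta> 2^(-j) / 2.\<close>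
  define C2 where "C2 = 32 * C1 / (c0 * \<Delta>\<^sup>2)"
  define C3 where "C3 = (2 * C2 / \<omega>) powr \<gamma>"
  define C4 where "C4 = 2 * \<Lambda> / \<omega> * (4 / \<Delta>) powr p * (C1 * 2 powr m)"
  define K where "K = C4 * C3 + 8 powr \<sigma> * C3"
  define B where "B = 2 powr (m + p + \<sigma> + (m + 2) * \<gamma>)"
  have C1: "0 < C1" using C \<theta> by (auto simp: C1_def intro!: mult_pos_pos add_pos_pos)
  have C2: "0 < C2" using C1 c0 \<Delta> by (simp add: C2_def)
  have C3: "0 < C3" using C2 \<omega> by (simp add: C3_def)
  have C4: "0 < C4" using C1 \<omega> \<Lambda> \<Delta> by (simp add: C4_def)
  have K: "0 < K" using C3 C4 by (simp add: K_def add_pos_pos)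
  have B: "1 < B" unfolding B_def using \<sigma> p \<gamma> by (intro gr_one_powr) (auto simp: m_def intro!: add_pos_pos mult_pos_pos)
  \<comment> \<open>The threshold of \<open>fast_geometric_convergence\<close> for the base B^2, as
    only every second index is followed.\<close>
  define \<nu> where "\<nu> = ((B\<^sup>2) powr (- 1 / \<gamma>) / K) powr (1 / \<gamma>)"
  have "0 < \<nu>" using B K by (simp add: \<nu>_def)
  then show ?thesis
  proof (rule that)
    show "measure lborel (superlevel (t0 - \<theta> * r powr \<sigma> / 2) (t0 + \<theta> * r powr \<sigma> / 2) (r / 2) k1) = 0"
    if r: "0 < r" "r < R0" and t0: "t1 \<le> t0 - \<theta> * r powr \<sigma>" "t0 + \<theta> * r powr \<sigma> \<le> t2"
      and small: "measure lborel (superlevel (t0 - \<theta> * r powr \<sigma>) (t0 + \<theta> * r powr \<sigma>) r k0) \<le> \<nu> * r powr (real DIM('a) + \<sigma>)"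
    for r t0
  proof -
    define i2 where "i2 j = (1/2::real) ^ j" for j :: nat
    \<comment> \<open>Half heights and radii shrink towards one half of their initial values while
      the levels rise from k0 towards k1, so all these sets contain the one in the
      conclusion.\<close>
    define s where "s j = \<theta> * r powr \<sigma> * (1 + i2 j) / 2" for j
    define Rj where "Rj j = r * (1 + i2 j) / 2" for j
    define kj where "kj j = k1 - \<Delta> * i2 j" for j
    define a where "a j = measure lborel (superlevel (t0 - s j) (t0 + s j) (Rj j) (kj j))" for j
    define x where "x j = (2::real) powr real j" for j :: nat
    have x: "0 < x j" "1 \<le> x j" for j by (auto simp: x_def ge_one_powr_ge_zero)
    have i2: "0 < i2 j" "i2 j \<le> 1" "i2 (Suc j) = i2 j / 2" for j by (auto simp: i2_def power_le_one)
    have i2x: "i2 j = 1 / x j" for j by (simp add: i2_def x_def powr_realpow power_one_over)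
    have r\<sigma>: "0 < r powr \<sigma>" "0 < r powr n" using r by auto
    have s_diff: "s j - s (Suc j) = \<theta> * r powr \<sigma> * i2 j / 4" for j by (simp add: s_def i2 field_simps)
    have R_diff: "Rj j - Rj (Suc j) = r * i2 j / 4" for j by (simp add: Rj_def i2 field_simps)
    have k_diff: "kj (Suc j) - kj j = \<Delta> * i2 j / 2" for j by (simp add: kj_def i2 field_simps)
    have s_le: "s j \<le> \<theta> * r powr \<sigma>" "0 < s j" for j
    proof -
      have "\<theta> * r powr \<sigma> * (1 + i2 j) \<le> \<theta> * r powr \<sigma> * 2" "0 < \<theta> * r powr \<sigma> * (1 + i2 j)"
        using i2[of j] \<theta> r\<sigma> by (auto intro!: mult_left_mono mult_pos_pos)
      then show "s j \<le> \<theta> * r powr \<sigma>" "0 < s j" by (auto simp: s_def)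
    qed
    have R_le: "Rj j \<le> r" for j using i2[of j] r by (simp add: Rj_def field_simps)
    have kj: "k0 \<le> kj j" "kj j < k1" "\<bar>kj j\<bar> \<le> M" for j
    proof -
      have "\<Delta> * i2 j \<le> \<Delta> * 1" "0 < \<Delta> * i2 j" using i2[of j] \<Delta> by (auto intro!: mult_left_mono)
      then show "k0 \<le> kj j" "kj j < k1" by (auto simp: kj_def \<Delta>_def)
      then show "\<bar>kj j\<bar> \<le> M" using kk by linarith
    qed
    have incr: "s (Suc j) < s j" "Rj (Suc j) < Rj j" "kj j < kj (Suc j)" for j
    proof -
      have "0 < \<theta> * r powr \<sigma> * i2 j" "0 < r * i2 j" "0 < \<Delta> * i2 j"
        using i2(1)[of j] \<theta> r r\<sigma> \<Delta> by (intro mult_pos_pos; simp)+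
      then show "s (Suc j) < s j" "Rj (Suc j) < Rj j" "kj j < kj (Suc j)"
        using s_diff[of j] R_diff[of j] k_diff[of j] by linarith+
    qed
    have a_nn: "0 \<le> a j" for j by (simp add: a_def)
    have a_Suc: "a (Suc j) \<le> a j" for j
      unfolding a_def using incr[of j] by (intro superlevel_mono) auto
    have energy_bound: "C * (1 / (\<theta> * r powr \<sigma> * i2 j / 8) + (1 / (Rj j - Rj (Suc j))) powr \<sigma>) * a j
       \<le> C1 * r powr (- \<sigma>) * x j powr m * a j" (is "?E \<le> _") for j
    proof -
      have 1: "1 / (\<theta> * r powr \<sigma> * i2 j / 8) = 8 / \<theta> * r powr (- \<sigma>) * x j"
        using x by (simp add: i2x powr_minus_divide)
      have 2: "(1 / (Rj j - Rj (Suc j))) powr \<sigma> = 4 powr \<sigma> * r powr (- \<sigma>) * x j powr \<sigma>"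
        using x r by (simp add: R_diff i2x powr_mult powr_divide powr_minus_divide)
      have 3: "x j \<le> x j powr m" "x j powr \<sigma> \<le> x j powr m"
        using x[of j] \<sigma> powr_mono[of 1 m "x j"] by (auto simp: m_def intro!: powr_mono)
      have "8 / \<theta> * r powr (- \<sigma>) * x j + 4 powr \<sigma> * r powr (- \<sigma>) * x j powr \<sigma>
        \<le> 8 / \<theta> * r powr (- \<sigma>) * x j powr m + 4 powr \<sigma> * r powr (- \<sigma>) * x j powr m"
        using 3 \<theta> by (intro add_mono mult_left_mono) auto
      also have "\<dots> = (8 / \<theta> + 4 powr \<sigma>) * r powr (- \<sigma>) * x j powr m" by (simp add: algebra_simps)
      finally have "?E \<le> C * ((8 / \<theta> + 4 powr \<sigma>) * r powr (- \<sigma>) * x j powr m) * a j"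
        unfolding 1 2 using C a_nn by (intro mult_right_mono mult_left_mono) auto
      then show ?thesis by (simp add: C1_def mult_ac)
    qed
    define y where "y j = a j / r powr (n + \<sigma>)" for j
    have y_nn: "0 \<le> y j" for j using a_nn by (simp add: y_def)
    have step: "a (Suc (Suc j)) \<le> K * B ^ j * y j powr \<gamma> * a j" for j
    \<comment> \<open>A vanishing term stays zero by monotonicity; otherwise S > 0, which makes
      \<rho> positive.\<close>
    proof (cases "a j = 0")
      case True
      then show ?thesis using a_Suc[of j] a_Suc[of "Suc j"] a_nn[of "Suc (Suc j)"] by simp
    next
      case False
      then have aj: "0 < a j" using a_nn[of j] by simp
      define E where "E = C1 * r powr (- \<sigma>) * x j powr m * a j"
      define S where "S = C2 * r powr (- \<sigma>) * x j powr (m + 2) * a j"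
      have S: "0 < S" unfolding S_def using C2 r x(1)[of j] aj by (intro mult_pos_pos) auto
      have E: "0 < E" unfolding E_def using C1 r x(1)[of j] aj by (intro mult_pos_pos) auto
      have slices: "AE z in (lborel :: (real \<times> 'a) measure). t0 - s (Suc j) < fst z \<and> fst z < t0 + s (Suc j) \<longrightarrow> slice (Rj (Suc j)) (kj (Suc j)) (fst z) \<le> S"
      proof (rule AE_slice_le)
        fix \<tau> assume \<tau>: "t0 - s (Suc j) < \<tau>" "\<tau> < t0 + s (Suc j)"
        show "\<exists>e0>0. \<forall>e. 0 < e \<and> e < e0 \<longrightarrow> measure lborel (superlevel \<tau> (\<tau> + e) (Rj (Suc j)) (kj (Suc j))) \<le> S * e"
        proof (intro exI conjI allI impI)
          show "0 < (s j - s (Suc j)) / 2" using incr[of j] by simp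
          fix e assume e: "0 < e \<and> e < (s j - s (Suc j)) / 2"
          \<comment> \<open>2d is exactly the gap s_j - s_(j+1), so the ascent is complete when the
            smaller cylinder begins and \<tau> may be any time inside it.\<close>
          define d where "d = \<theta> * r powr \<sigma> * i2 j / 8"
          have d: "0 < d" "2 * d = s j - s (Suc j)" using \<theta> r\<sigma> i2(1)[of j] by (auto simp: d_def s_diff)
          \<comment> \<open>The estimate is used with 2e in place of e, since it counts only the
            first half of the descent.\<close>
          let ?\<mu> = "measure lborel (superlevel \<tau> (\<tau> + (2 * e) / 2) (Rj (Suc j)) (kj (Suc j)))"
          have "ennreal ((kj (Suc j) - kj j) powr p / \<Lambda>) * (\<integral>\<^sup>+z. ennreal (jump ((t0 - s j) + 2 * d) \<tau> (Rj (Suc j)) (kj j) (kj (Suc j)) z) \<partial>lborel)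
             + ennreal (c0 * (kj (Suc j) - kj j)\<^sup>2 / 4 / (2 * e) * ?\<mu>)
            \<le> ennreal (C * (1 / d + (1 / (Rj j - Rj (Suc j))) powr \<sigma>) * a j)"
            unfolding a_def
          proof (rule cacc)
            show "c0 * (y - x) \<le> spow q y - spow q x" if "kj j \<le> x" "x \<le> y" "y \<le> kj (Suc j)" for x y
              using that kj[of j] kj[of "Suc j"] by (intro slope) auto
            show "Rj j < R0" using R_le[of j] r by simp
            show "t1 \<le> t0 - s j" "t0 + s j \<le> t2" using s_le(1)[of j] t0 by auto
            show "t0 - s j + 2 * d < \<tau>" "\<tau> + 2 * e < t0 + s j" using d(2) \<tau> e by auto
          qed (use c0 incr kj d e in auto)
          also have "\<dots> \<le> ennreal E"
            unfolding d_def E_def by (rule ennreal_leI[OF energy_bound])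
          finally have "ennreal (c0 * (kj (Suc j) - kj j)\<^sup>2 / 4 / (2 * e) * ?\<mu>) \<le> ennreal E"
            by (rule order_trans[OF add_increasing[OF zero_le order_refl]])
          then have "c0 * (kj (Suc j) - kj j)\<^sup>2 / 4 / (2 * e) * ?\<mu> \<le> E" using E by (simp add: ennreal_le_iff)
          then have "c0 * (\<Delta> * i2 j / 2)\<^sup>2 * ?\<mu> \<le> 8 * E * e" using e by (simp add: k_diff field_simps)
          moreover have "8 * E * e = c0 * (\<Delta> * i2 j / 2)\<^sup>2 * (S * e)"
          proof -
            have "x j powr (m + 2) = x j powr m * (x j)\<^sup>2" using x[of j] by (simp add: powr_add powr_numeral)
            then have "c0 * (\<Delta> * i2 j / 2)\<^sup>2 * S = c0 * \<Delta>\<^sup>2 / 4 * (C2 * r powr (- \<sigma>) * x j powr m * a j)"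
              using x[of j] by (simp add: S_def i2x power2_eq_square field_simps)
            also have "\<dots> = (c0 * \<Delta>\<^sup>2 * C2) / 4 * (r powr (- \<sigma>) * x j powr m * a j)" by simp
            also have "c0 * \<Delta>\<^sup>2 * C2 = 32 * C1" using c0 \<Delta> by (simp add: C2_def)
            finally show ?thesis by (simp add: E_def)
          qed
          ultimately have "c0 * (\<Delta> * i2 j / 2)\<^sup>2 * ?\<mu> \<le> c0 * (\<Delta> * i2 j / 2)\<^sup>2 * (S * e)" by simp
          moreover have "0 < c0 * (\<Delta> * i2 j / 2)\<^sup>2" using c0 \<Delta> i2(1)[of j] by simp
          ultimately have "?\<mu> \<le> S * e" by (rule mult_left_le_imp_le)
          then show "measure lborel (superlevel \<tau> (\<tau> + e) (Rj (Suc j)) (kj (Suc j))) \<le> S * e" by simp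
        qed
      qed
      define \<rho> where "\<rho> = (2 * S / \<omega>) powr (1 / n)"
      have \<rho>: "0 < \<rho>" using S \<omega> by (simp add: \<rho>_def)
      have \<rho>n: "\<omega> * \<rho> powr n = 2 * S" using S \<omega> n by (simp add: \<rho>_def powr_powr)
      have \<rho>\<sigma>: "\<rho> powr \<sigma> = C3 * r powr \<sigma> * x j powr ((m + 2) * \<gamma>) * y j powr \<gamma>"
      proof -
        have "S = C2 * x j powr (m + 2) * r powr n * y j"
        proof -
          have "a j = r powr (n + \<sigma>) * y j" using r by (simp add: y_def)
          moreover have "r powr (- \<sigma>) * r powr (n + \<sigma>) = r powr n" by (simp add: powr_add[symmetric])
          ultimately show ?thesis by (simp add: S_def mult_ac)
        qed
        then have S': "2 * S / \<omega> = (2 * C2 / \<omega>) * x j powr (m + 2) * r powr n * y j" by simp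
        have "\<rho> powr \<sigma> = (2 * S / \<omega>) powr \<gamma>" by (simp add: \<rho>_def powr_powr \<gamma>_def mult.commute)
        also have "\<dots> = (2 * C2 / \<omega>) powr \<gamma> * (x j powr (m + 2)) powr \<gamma> * (r powr n) powr \<gamma> * y j powr \<gamma>"
        proof -
          have "(a1 * a2 * a3 * a4) powr \<gamma> = a1 powr \<gamma> * a2 powr \<gamma> * a3 powr \<gamma> * a4 powr \<gamma>"
            if "0 \<le> a1" "0 \<le> a2" "0 \<le> a3" "0 \<le> a4" for a1 a2 a3 a4 :: real
            using that by (simp add: powr_mult)
          then show ?thesis unfolding S' using C2 \<omega> y_nn by (metis divide_nonneg_pos less_imp_le mult_nonneg_nonneg powr_ge_zero zero_le_numeral)
        qed
        also have "(r powr n) powr \<gamma> = r powr \<sigma>" using n by (simp add: powr_powr \<gamma>_def)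
        finally show ?thesis by (simp add: C3_def powr_powr mult_ac)
      qed
      have xB: "x j powr q' \<le> B ^ j" if "q' \<le> m + p + \<sigma> + (m + 2) * \<gamma>" for q'
      proof -
        have "x j powr q' \<le> x j powr (m + p + \<sigma> + (m + 2) * \<gamma>)" using that x by (intro powr_mono) auto
        also have "\<dots> = B ^ j" by (simp add: B_def x_def powr_powr powr_realpow[symmetric] mult.commute)
        finally show ?thesis .
      qed
      have rr: "r powr \<sigma> * r powr (- \<sigma>) = 1" using r by (simp add: powr_add[symmetric])
      show ?thesis
      \<comment> \<open>r 2^(-(j+1)) / 4 is the gap between the radii of steps j + 1 and j + 2, the
        room in which the balls of radius \<rho> must fit. If \<rho> is larger, then y_j is so large
        that the factor in front of a_j is at least 1 and monotonicity suffices.\<close>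
      proof (cases "\<rho> \<le> r * i2 (Suc j) / 4")
        case True
        define d where "d = \<theta> * r powr \<sigma> * i2 (Suc j) / 8"
        have d: "0 < d" "2 * d = s (Suc j) - s (Suc (Suc j))" using \<theta> r\<sigma> i2(1)[of "Suc j"] by (auto simp: d_def s_diff)
        let ?J = "\<integral>\<^sup>+z. ennreal (jump (t0 - s (Suc (Suc j))) (t0 + s (Suc (Suc j))) (Rj (Suc (Suc j))) (kj (Suc j)) (kj (Suc (Suc j))) z) \<partial>lborel"
        \<comment> \<open>Here the jump term is the one kept: \<tau> is the end of the smaller
          cylinder, and e = d is chosen to fit into the gap 2d that follows it.\<close>
        have "ennreal ((kj (Suc (Suc j)) - kj (Suc j)) powr p / \<Lambda>) * (\<integral>\<^sup>+z. ennreal (jump ((t0 - s (Suc j)) + 2 * d) (t0 + s (Suc (Suc j))) (Rj (Suc (Suc j))) (kj (Suc j)) (kj (Suc (Suc j))) z) \<partial>lborel)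
             + ennreal (c0 * (kj (Suc (Suc j)) - kj (Suc j))\<^sup>2 / 4 / d * measure lborel (superlevel (t0 + s (Suc (Suc j))) (t0 + s (Suc (Suc j)) + d / 2) (Rj (Suc (Suc j))) (kj (Suc (Suc j)))))
            \<le> ennreal (C * (1 / d + (1 / (Rj (Suc j) - Rj (Suc (Suc j)))) powr \<sigma>) * a (Suc j))"
          unfolding a_def
        proof (rule cacc)
          show "c0 * (y - x) \<le> spow q y - spow q x" if "kj (Suc j) \<le> x" "x \<le> y" "y \<le> kj (Suc (Suc j))" for x y
            using that kj[of "Suc j"] kj[of "Suc (Suc j)"] by (intro slope) auto
          show "Rj (Suc j) < R0" using R_le[of "Suc j"] r by simp
          show "t1 \<le> t0 - s (Suc j)" "t0 + s (Suc j) \<le> t2" using s_le(1)[of "Suc j"] t0 by auto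
          show "t0 - s (Suc j) + 2 * d < t0 + s (Suc (Suc j))" "t0 + s (Suc (Suc j)) + d < t0 + s (Suc j)"
            using d s_le(2)[of "Suc (Suc j)"] by auto
        qed (use c0 incr kj d in auto)
        also have "\<dots> \<le> ennreal (C1 * r powr (- \<sigma>) * x (Suc j) powr m * a (Suc j))"
          unfolding d_def by (rule ennreal_leI[OF energy_bound])
        also have "\<dots> \<le> ennreal (2 powr m * E)"
        proof (rule ennreal_leI)
          have "x (Suc j) = 2 * x j" by (simp add: x_def powr_add)
          then have "x (Suc j) powr m = 2 powr m * x j powr m" using x[of j] by (simp add: powr_mult)
          then show "C1 * r powr (- \<sigma>) * x (Suc j) powr m * a (Suc j) \<le> 2 powr m * E"
            using mult_left_mono[OF a_Suc[of j], of "C1 * r powr (- \<sigma>) * (2 powr m * x j powr m)"] C1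
            by (simp add: E_def mult_ac)
        qed
        finally have "ennreal ((kj (Suc (Suc j)) - kj (Suc j)) powr p / \<Lambda>) * (\<integral>\<^sup>+z. ennreal (jump ((t0 - s (Suc j)) + 2 * d) (t0 + s (Suc (Suc j))) (Rj (Suc (Suc j))) (kj (Suc j)) (kj (Suc (Suc j))) z) \<partial>lborel) \<le> ennreal (2 powr m * E)"
          by (rule order_trans[OF add_increasing2[OF zero_le order_refl]])
        moreover have "(t0 - s (Suc j)) + 2 * d = t0 - s (Suc (Suc j))" using d(2) by simp
        ultimately have "ennreal ((kj (Suc (Suc j)) - kj (Suc j)) powr p / \<Lambda>) * ?J \<le> ennreal (2 powr m * E)"
          by simp
        moreover have "ennreal (\<omega> / 2 * \<rho> powr (- \<sigma>) * a (Suc (Suc j))) \<le> ?J"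
          unfolding a_def \<omega>_def n_def
        proof (rule jump_lower[OF _ \<rho>])
          show "AE z in (lborel :: (real \<times> 'a) measure). t0 - s (Suc (Suc j)) < fst z \<and> fst z < t0 + s (Suc (Suc j)) \<longrightarrow> slice (Rj (Suc j)) (kj (Suc j)) (fst z) \<le> S"
            using slices by eventually_elim (use incr[of "Suc j"] in auto)
          show "Rj (Suc (Suc j)) + \<rho> \<le> Rj (Suc j)" using True R_diff[of "Suc j"] by simp
          show "unit_ball_vol (real DIM('a)) * \<rho> powr real DIM('a) = 2 * S" using \<rho>n by (simp add: \<omega>_def n_def)
        qed
        ultimately have "ennreal ((kj (Suc (Suc j)) - kj (Suc j)) powr p / \<Lambda>) * ennreal (\<omega> / 2 * \<rho> powr (- \<sigma>) * a (Suc (Suc j))) \<le> ennreal (2 powr m * E)"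
          by (meson mult_left_mono order_trans zero_le)
        then have "(kj (Suc (Suc j)) - kj (Suc j)) powr p / \<Lambda> * (\<omega> / 2 * \<rho> powr (- \<sigma>) * a (Suc (Suc j))) \<le> 2 powr m * E"
          using \<Lambda> \<omega> a_nn E by (subst (asm) ennreal_mult[symmetric]) (auto simp: ennreal_le_iff)
        moreover have "(kj (Suc (Suc j)) - kj (Suc j)) powr p = (\<Delta> / 4) powr p * x j powr (- p)"
          using \<Delta> x[of j] by (simp add: k_diff i2x[of "Suc j"] x_def powr_add powr_mult powr_divide powr_minus_divide)
        ultimately have le: "(\<Delta> / 4) powr p * x j powr (- p) / \<Lambda> * (\<omega> / 2 * \<rho> powr (- \<sigma>) * a (Suc (Suc j))) \<le> 2 powr m * E" by simp
        have "a (Suc (Suc j)) = (2 * \<Lambda> / \<omega> * (4 / \<Delta>) powr p * x j powr p * \<rho> powr \<sigma>) * ((\<Delta> / 4) powr p * x j powr (- p) / \<Lambda> * (\<omega> / 2 * \<rho> powr (- \<sigma>) * a (Suc (Suc j))))"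
          using \<Lambda> \<omega> \<Delta> x[of j] \<rho> by (simp add: powr_minus_divide powr_divide)
        also have "\<dots> \<le> (2 * \<Lambda> / \<omega> * (4 / \<Delta>) powr p * x j powr p * \<rho> powr \<sigma>) * (2 powr m * E)"
          using \<Lambda> \<omega> by (intro mult_left_mono le) auto
        also have "\<dots> = C4 * C3 * (r powr \<sigma> * r powr (- \<sigma>)) * (x j powr p * x j powr m * x j powr ((m + 2) * \<gamma>)) * y j powr \<gamma> * a j"
          by (simp add: E_def C4_def \<rho>\<sigma> mult_ac)
        also have "\<dots> = C4 * C3 * x j powr (p + m + (m + 2) * \<gamma>) * y j powr \<gamma> * a j"
          unfolding rr by (simp add: powr_add mult_ac)
        also have "\<dots> \<le> K * B ^ j * y j powr \<gamma> * a j"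
          using C3 C4 a_nn \<sigma> by (intro mult_right_mono mult_mono xB) (auto simp: K_def)
        finally show ?thesis .
      next
        case False
        then have "r * i2 j / 8 \<le> \<rho>" by (simp add: i2)
        then have "(r * i2 j / 8) powr \<sigma> \<le> \<rho> powr \<sigma>" using r i2(1)[of j] \<sigma> by (intro powr_mono2) auto
        then have "8 powr \<sigma> * r powr (- \<sigma>) * x j powr \<sigma> * (r * i2 j / 8) powr \<sigma> \<le> 8 powr \<sigma> * r powr (- \<sigma>) * x j powr \<sigma> * \<rho> powr \<sigma>"
          by (intro mult_left_mono) auto
        moreover have "8 powr \<sigma> * r powr (- \<sigma>) * x j powr \<sigma> * (r * i2 j / 8) powr \<sigma> = 1"
          using r x[of j] by (simp add: i2x powr_divide powr_mult powr_minus_divide)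
        ultimately have "1 \<le> 8 powr \<sigma> * r powr (- \<sigma>) * x j powr \<sigma> * \<rho> powr \<sigma>" by simp
        also have "\<dots> = 8 powr \<sigma> * C3 * (r powr \<sigma> * r powr (- \<sigma>)) * (x j powr \<sigma> * x j powr ((m + 2) * \<gamma>)) * y j powr \<gamma>"
          by (simp add: \<rho>\<sigma> mult_ac)
        also have "\<dots> = 8 powr \<sigma> * C3 * x j powr (\<sigma> + (m + 2) * \<gamma>) * y j powr \<gamma>"
          unfolding rr by (simp add: powr_add mult_ac)
        also have "\<dots> \<le> K * B ^ j * y j powr \<gamma>"
          using C3 C4 p \<sigma> by (intro mult_right_mono mult_mono xB) (auto simp: K_def m_def)
        finally have "1 * a j \<le> K * B ^ j * y j powr \<gamma> * a j" using a_nn by (intro mult_right_mono)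
        then show ?thesis using a_Suc[of j] a_Suc[of "Suc j"] by simp
      qed
    qed
    have "(\<lambda>i. y (2 * i)) \<longlonglongrightarrow> 0"
    proof (rule fast_geometric_convergence[OF _ K _ \<gamma>])
      show "0 \<le> y (2 * i)" for i by (rule y_nn)
      show "1 < B\<^sup>2" using B by (simp add: power2_eq_square less_1_mult)
      show "y (2 * Suc i) \<le> K * B\<^sup>2 ^ i * y (2 * i) powr (1 + \<gamma>)" for i
      proof -
        have "y (2 * Suc i) \<le> K * B ^ (2 * i) * y (2 * i) powr \<gamma> * a (2 * i) / r powr (n + \<sigma>)"
          using step[of "2 * i"] by (simp add: y_def divide_right_mono)
        also have "\<dots> = K * B\<^sup>2 ^ i * (y (2 * i) powr \<gamma> * y (2 * i))"
          by (simp add: y_def power_mult)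
        also have "y (2 * i) powr \<gamma> * y (2 * i) = y (2 * i) powr (1 + \<gamma>)"
          using y_nn[of "2 * i"] by (cases "y (2 * i) = 0") (auto simp: powr_add)
        finally show ?thesis .
      qed
      have "a 0 \<le> \<nu> * r powr (n + \<sigma>)"
        using small by (simp add: a_def s_def Rj_def kj_def i2_def \<Delta>_def n_def)
      then show "y (2 * 0) \<le> ((B\<^sup>2) powr (- 1 / \<gamma>) / K) powr (1 / \<gamma>)"
        using r by (simp add: y_def \<nu>_def divide_le_eq)
    qed
    then have "(\<lambda>i. y (2 * i) * r powr (n + \<sigma>)) \<longlonglongrightarrow> 0 * r powr (n + \<sigma>)" by (intro tendsto_intros)
    moreover have "y i * r powr (n + \<sigma>) = a i" for i using r by (simp add: y_def)
    ultimately have "(\<lambda>i. a (2 * i)) \<longlonglongrightarrow> 0" by simp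
    moreover have "measure lborel (superlevel (t0 - \<theta> * r powr \<sigma> / 2) (t0 + \<theta> * r powr \<sigma> / 2) (r / 2) k1) \<le> a j" for j
      unfolding a_def
    proof (rule superlevel_mono)
      have "\<theta> * r powr \<sigma> * 1 \<le> \<theta> * r powr \<sigma> * (1 + i2 j)" "r * 1 \<le> r * (1 + i2 j)"
        using \<theta> r r\<sigma> i2(1)[of j] by (intro mult_left_mono, auto)+
      then show "t0 - s j \<le> t0 - \<theta> * r powr \<sigma> / 2" "t0 + \<theta> * r powr \<sigma> / 2 \<le> t0 + s j" "r / 2 \<le> Rj j"
        by (auto simp: s_def Rj_def)
      show "kj j \<le> k1" using kj(2)[of j] by simp
    qed
    ultimately have "measure lborel (superlevel (t0 - \<theta> * r powr \<sigma> / 2) (t0 + \<theta> * r powr \<sigma> / 2) (r / 2) k1) \<le> 0"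
      by (intro LIMSEQ_le_const) auto
    then show ?thesis by (simp add: measure_le_0_iff)
  qed
  qed
qed

end

section \<open>Borel versions and the weak formulation\<close>

lemma borel_imp_lebesgue_on:
  assumes "f \<in> borel_measurable borel"
  shows "f \<in> borel_measurable (lebesgue_on S)"
  using assms by (intro measurable_restrict_space1 measurable_completion) simp

text \<open>Completeness of the Lebesgue measure supplies the measurability of f, which equals a
  Borel function almost everywhere.\<close>

lemma integral_lebesgue_AE_eq:
  fixes f g :: "'a::euclidean_space \<Rightarrow> real"
  assumes g [measurable]: "g \<in> borel_measurable borel" and ae: "AE y in lborel. f y = g y"
  shows "(\<integral>y. f y \<partial>lebesgue) = (\<integral>y. g y \<partial>lborel)"
proof -
  have gl: "g \<in> borel_measurable lebesgue" by (intro measurable_completion) simp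
  have aeL: "AE y in lebesgue. f y = g y" using ae by (rule AE_completion)
  have fl: "f \<in> borel_measurable lebesgue"
  proof (rule measurableI)
    fix A :: "real set" assume A: "A \<in> sets borel"
    have "g -` A \<inter> space lebesgue \<in> sets lebesgue" using gl A by (rule measurable_sets)
    then show "f -` A \<inter> space lebesgue \<in> sets lebesgue"
      by (rule completion.in_sets_AE[rotated]) (use aeL in \<open>auto elim: eventually_mono\<close>)
  qed simp
  have "(\<integral>y. f y \<partial>lebesgue) = (\<integral>y. g y \<partial>lebesgue)"
    by (rule integral_cong_AE[OF fl gl aeL])
  also have "\<dots> = (\<integral>y. g y \<partial>lborel)" by (rule integral_completion) simp
  finally show ?thesis .
qed

lemma iterated_integral_lebesgue2:
  fixes F :: "'b::euclidean_space \<times> 'c::euclidean_space \<Rightarrow> real"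
  assumes F: "integrable lborel F" and ae: "AE t in lborel. AE x in lborel. f t x = F (t, x)"
  shows "(\<integral>t. (\<integral>x. f t x \<partial>lebesgue) \<partial>lebesgue) = (\<integral>z. F z \<partial>lborel)"
proof -
  have [measurable]: "F \<in> borel_measurable borel" using F by auto
  have "(\<integral>t. (\<integral>x. f t x \<partial>lebesgue) \<partial>lebesgue) = (\<integral>t. (\<integral>x. F (t, x) \<partial>lborel) \<partial>lborel)"
  proof (rule integral_lebesgue_AE_eq)
    show "AE t in lborel. (\<integral>x. f t x \<partial>lebesgue) = (\<integral>x. F (t, x) \<partial>lborel)"
      using ae by eventually_elim (rule integral_lebesgue_AE_eq, simp_all)
  qed measurable
  also have "\<dots> = (\<integral>z. F z \<partial>lborel)"
    using lborel_pair.integral_fst'[of F] F by (simp add: lborel_prod)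
  finally show ?thesis .
qed

text \<open>The nested assumption is the form in which the equalities for \<open>u\<close> and
  \<open>K\<close> are available; almost every t has an integrable section of F, to which the case
  of two variables applies.\<close>

lemma iterated_integral_lebesgue3:
  fixes F :: "'b::euclidean_space \<times> 'c::euclidean_space \<times> 'd::euclidean_space \<Rightarrow> real"
  assumes F: "integrable lborel F" and ae: "AE t in lborel. AE x in lborel. AE y in lborel. f t x y = F (t, x, y)"
  shows "(\<integral>t. (\<integral>x. (\<integral>y. f t x y \<partial>lebesgue) \<partial>lebesgue) \<partial>lebesgue) = (\<integral>z. F z \<partial>lborel)"
proof -
  have [measurable]: "F \<in> borel_measurable borel" using F by auto
  have "AE t in lborel. integrable lborel (\<lambda>w. F (t, w))"
    using lborel_pair.AE_integrable_fst'[of F] F by (simp add: lborel_prod)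
  with ae have "AE t in lborel. (\<integral>x. (\<integral>y. f t x y \<partial>lebesgue) \<partial>lebesgue) = (\<integral>w. F (t, w) \<partial>lborel)"
    by eventually_elim (rule iterated_integral_lebesgue2)
  then have "(\<integral>t. (\<integral>x. (\<integral>y. f t x y \<partial>lebesgue) \<partial>lebesgue) \<partial>lebesgue) = (\<integral>t. (\<integral>w. F (t, w) \<partial>lborel) \<partial>lborel)"
    by (intro integral_lebesgue_AE_eq) auto
  also have "\<dots> = (\<integral>z. F z \<partial>lborel)"
    using lborel_pair.integral_fst'[of F] F by (simp add: lborel_prod)
  finally show ?thesis .
qed

lemma bounded_L_L:
  fixes v :: "'a::euclidean_space \<times> real \<Rightarrow> real"
  assumes [measurable]: "v \<in> borel_measurable borel" and v: "\<And>z. \<bar>v z\<bar> \<le> C" and r: "0 < r" and "bounded D" "open D"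
  shows "v \<in> L_L a b r D"
proof -
  have [measurable]: "D \<in> sets borel" using assms(5) by (rule borel_open)
  have fin: "emeasure lborel D < \<infinity>" using assms(4) by (rule emeasure_bounded_finite)
  have "(\<integral>\<^sup>+t\<in>{a<..<b}. (\<integral>\<^sup>+x\<in>D. ennreal (\<bar>v (x, t)\<bar> powr r) \<partial>lebesgue) \<partial>lebesgue)
    \<le> (\<integral>\<^sup>+t\<in>{a<..<b}. (\<integral>\<^sup>+x\<in>D. ennreal (C powr r) \<partial>lebesgue) \<partial>lebesgue)"
    using v r by (intro nn_integral_mono mult_right_mono ennreal_leI powr_mono2) auto
  also have "\<dots> = (\<integral>\<^sup>+t. (ennreal (C powr r) * emeasure lborel D) * indicator {a<..<b} t \<partial>lborel)"
    by (simp add: nn_integral_completion nn_integral_cmult_indicator)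
  also have "\<dots> = (ennreal (C powr r) * emeasure lborel D) * emeasure lborel {a<..<b}"
    by (rule nn_integral_cmult_indicator) simp
  also have "\<dots> < \<infinity>"
    using fin emeasure_bounded_finite[of "{a<..<b}"] by (simp add: ennreal_mult_less_top)
  finally show ?thesis using borel_imp_lebesgue_on[OF assms(1)] by (simp add: L_L_def)
qed

context nonlocal_energy
begin

text \<open>The test function is the average with its coordinates swapped back to (x, t). It
  vanishes near t1 and t2, so both boundary terms are limits of zero; its weak time derivative is
  the difference quotient on the right; and it lies in the test space because it is bounded with
  bounded support and averaging does not increase \<open>seminorm\<close>.\<close>

lemma weak_inequality:
  fixes u :: "'a \<times> real \<Rightarrow> real" and K :: "'a \<times> 'a \<times> real \<Rightarrow> real"
  assumes \<sigma>s: "\<sigma> = p * s" and sub: "weak_subsolution s p q K \<Omega> T u"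
    and cyl: "inner_cylinder \<Omega> T (ball x0 R0) t1 t2"
    and uV: "AE t in lborel. 0 < t \<and> t < T \<longrightarrow> (AE x in lborel. u (x, t) = V (t, x))"
    and K\<kappa>: "AE t in lborel. 0 < t \<and> t < T \<longrightarrow> (AE x in lborel. AE y in lborel. K (x, y, t) = \<kappa> (t, x, y))"
    and g [measurable]: "g \<in> borel_measurable borel" and g0: "\<And>z. 0 \<le> g z" and gC: "\<And>z. g z \<le> C"
    and h: "0 < h" "t1 < a - h" and ab: "a \<le> b" "b < t2" and R: "R < R0"
    and supp: "\<And>t x. \<not> (a \<le> t \<and> t \<le> b) \<or> x \<notin> ball x0 R \<Longrightarrow> g (t, x) = 0" and fin: "seminorm g < \<infinity>"
  shows "(\<integral>z. elliptic (steklov h g) z \<partial>lborel) \<le> (\<integral>z. spow q (V z) * ((g (fst z + h, snd z) - g z) / h) \<partial>lborel)"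
proof -
  let ?D = "ball x0 R0"
  have T: "0 < t1" "t2 < T" using cyl by (auto simp: inner_cylinder_def)
  define st where "st = steklov h g"
  have [measurable]: "st \<in> borel_measurable borel" by (simp add: st_def)
  have gabs: "\<bar>g z\<bar> \<le> C" for z using g0 gC by simp
  have C: "0 \<le> C" using order_trans[OF g0 gC] .
  have st_le: "\<bar>st z\<bar> \<le> C" for z unfolding st_def by (rule steklov_abs_le[OF g gabs h(1)])
  have st_nn: "0 \<le> st z" for z unfolding st_def by (rule steklov_nonneg[OF g0 h(1)])
  have st0: "st (t, x) = 0" if "\<not> (a - h \<le> t \<and> t \<le> b) \<or> x \<notin> ball x0 R" for t x
    unfolding st_def using that by (intro steklov_eq_0 supp) auto
  have st_supp: "\<And>t x. \<not> (t1 < t \<and> t < t2) \<or> x \<notin> ball x0 R \<Longrightarrow> st (t, x) = 0"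
    using h ab by (intro st0) auto
  have st_fin: "seminorm st < \<infinity>"
    using seminorm_steklov[OF g h(1) gabs] fin by (simp add: st_def le_less_trans)
  define \<phi> where "\<phi> z = st (snd z, fst z)" for z :: "'a \<times> real"
  define d where "d z = (g (fst z + h, snd z) - g z) / h" for z
  define \<psi> where "\<psi> z = d (snd z, fst z)" for z :: "'a \<times> real"
  have [measurable]: "\<phi> \<in> borel_measurable borel" "d \<in> borel_measurable borel" "\<psi> \<in> borel_measurable borel"
    unfolding \<phi>_def d_def \<psi>_def by measurable
  have d_le: "\<bar>d z\<bar> \<le> 2 * C / h" for z
    using gabs[of "(fst z + h, snd z)"] gabs[of z] h(1) by (simp add: d_def abs_divide divide_le_cancel)
  have d0: "d (t, x) = 0" if "\<not> (a - h \<le> t \<and> t \<le> b) \<or> x \<notin> ball x0 R" for t x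
  proof -
    have "g (t + h, x) = 0" "g (t, x) = 0" using that h by (auto intro!: supp)
    then show ?thesis by (simp add: d_def)
  qed
  have deriv: "W1r_loc_deriv T (q + 1) ?D \<phi> \<psi>"
    unfolding W1r_loc_deriv_def
  proof (intro conjI allI impI ballI)
    fix c e
    show "\<phi> \<in> L_L c e (q + 1) ?D" using st_le q by (intro bounded_L_L[where C=C]) (auto simp: \<phi>_def)
    show "\<psi> \<in> L_L c e (q + 1) ?D" using d_le q by (intro bounded_L_L[where C="2 * C / h"]) (auto simp: \<psi>_def)
  next
    fix \<eta> assume \<eta>: "\<eta> \<in> test_fun_time T"
    have "(\<integral>t\<in>{0<..<T}. \<phi> (x, t) * deriv \<eta> t \<partial>lebesgue) = - (\<integral>t\<in>{0<..<T}. \<psi> (x, t) * \<eta> t \<partial>lebesgue)" for x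
    proof -
      have "(\<integral>t\<in>{0<..<T}. steklov h g (t, x) * deriv \<eta> t \<partial>lebesgue) = - (\<integral>t\<in>{0<..<T}. (g (t + h, x) - g (t, x)) / h * \<eta> t \<partial>lebesgue)"
        using h T ab by (intro steklov_weak_derivative[OF g gabs _ h(1) _ _ \<eta>, where a=a and b=b] supp) auto
      then show ?thesis by (simp add: \<phi>_def \<psi>_def st_def d_def)
    qed
    then show "AE x in lebesgue_on ?D. (\<integral>t\<in>{0<..<T}. \<phi> (x, t) * deriv \<eta> t \<partial>lebesgue) = - (\<integral>t\<in>{0<..<T}. \<psi> (x, t) * \<eta> t \<partial>lebesgue)"
      by (intro AE_I2)
  qed
  \<comment> \<open>One bound over all times covers every time interval, so the interval in the
    membership claim \<open>W0\<close> can be arbitrary.\<close>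
  have W: "(\<integral>\<^sup>+t. Wsp_norm_pow s p UNIV (\<lambda>x. \<phi> (x, t)) \<partial>lborel) < \<infinity>"
    and W_measurable: "(\<lambda>t. Wsp_norm_pow s p UNIV (\<lambda>x. \<phi> (x, t))) \<in> borel_measurable borel"
  proof -
    have eq: "Wsp_norm_pow s p UNIV (\<lambda>x. \<phi> (x, t)) = (\<integral>\<^sup>+x. ennreal (\<bar>st (t, x)\<bar> powr p) \<partial>lborel)
      + (\<integral>\<^sup>+x. (\<integral>\<^sup>+y. ennreal (\<bar>st (t, x) - st (t, y)\<bar> powr p) * ennreal (fker \<sigma> (x, y)) \<partial>lborel) \<partial>lborel)" for t
      by (simp add: Wsp_norm_pow_def \<phi>_def nn_integral_completion fker_def \<sigma>s ennreal_mult'[symmetric])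
    show "(\<lambda>t. Wsp_norm_pow s p UNIV (\<lambda>x. \<phi> (x, t))) \<in> borel_measurable borel" unfolding eq by measurable
    have "(\<integral>\<^sup>+t. Wsp_norm_pow s p UNIV (\<lambda>x. \<phi> (x, t)) \<partial>lborel) = (\<integral>\<^sup>+t. (\<integral>\<^sup>+x. ennreal (\<bar>st (t, x)\<bar> powr p) \<partial>lborel) \<partial>lborel) + seminorm st"
    proof -
      have m: "(\<lambda>(t, x, y). ennreal (\<bar>st (t, x) - st (t, y)\<bar> powr p) * ennreal (fker \<sigma> (x, y))) \<in> borel_measurable borel"
        unfolding split_beta' by measurable
      have "seminorm st = (\<integral>\<^sup>+t. (\<integral>\<^sup>+x. (\<integral>\<^sup>+y. ennreal (\<bar>st (t, x) - st (t, y)\<bar> powr p) * ennreal (fker \<sigma> (x, y)) \<partial>lborel) \<partial>lborel) \<partial>lborel)"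
        unfolding seminorm_def nn_integral_lborel_triple[OF m] by simp
      then show ?thesis unfolding eq by (simp add: nn_integral_add)
    qed
    moreover have "(\<integral>\<^sup>+t. (\<integral>\<^sup>+x. ennreal (\<bar>st (t, x)\<bar> powr p) \<partial>lborel) \<partial>lborel) < \<infinity>"
    proof -
      have "(\<integral>\<^sup>+t. (\<integral>\<^sup>+x. ennreal (\<bar>st (t, x)\<bar> powr p) \<partial>lborel) \<partial>lborel) = (\<integral>\<^sup>+z. ennreal (\<bar>st z\<bar> powr p) \<partial>lborel)"
        by (subst nn_integral_lborel_pair) auto
      also have "\<dots> \<le> (\<integral>\<^sup>+z. ennreal (C powr p) * indicator ({a - h..b} \<times> ball x0 R) z \<partial>lborel)"
      proof (rule nn_integral_mono)
        fix z
        show "ennreal (\<bar>st z\<bar> powr p) \<le> ennreal (C powr p) * indicator ({a - h..b} \<times> ball x0 R) z"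
          using st_le[of z] st0[of "fst z" "snd z"] p by (cases z) (auto simp: indicator_def intro!: ennreal_leI powr_mono2)
      qed
      also have "\<dots> = ennreal (C powr p) * emeasure lborel ({a - h..b} \<times> ball x0 R)"
        by (rule nn_integral_cmult_indicator) (simp add: borel_prod[symmetric])
      also have "\<dots> < \<infinity>"
        using emeasure_bounded_finite[of "{a - h..b} \<times> ball x0 R"] by (auto simp: ennreal_mult_less_top bounded_Times)
      finally show ?thesis .
    qed
    ultimately show "(\<integral>\<^sup>+t. Wsp_norm_pow s p UNIV (\<lambda>x. \<phi> (x, t)) \<partial>lborel) < \<infinity>" using st_fin by simp
  qed
  have W0: "\<phi> \<in> L_W0sp c e s p ?D" for c e
    unfolding L_W0sp_def L_Wsp_def
  proof (intro CollectI conjI)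
    show "\<phi> \<in> borel_measurable (lebesgue_on (UNIV \<times> {c<..<e}))" by (rule borel_imp_lebesgue_on) measurable
    have "(\<integral>\<^sup>+t\<in>{c<..<e}. Wsp_norm_pow s p UNIV (\<lambda>x. \<phi> (x, t)) \<partial>lebesgue) \<le> (\<integral>\<^sup>+t. Wsp_norm_pow s p UNIV (\<lambda>x. \<phi> (x, t)) \<partial>lborel)"
      unfolding nn_integral_completion by (intro nn_integral_mono) (auto simp: indicator_def)
    then show "(\<integral>\<^sup>+t\<in>{c<..<e}. Wsp_norm_pow s p UNIV (\<lambda>x. \<phi> (x, t)) \<partial>lebesgue) < \<infinity>" using W by (rule le_less_trans)
    have "AE t in lborel. Wsp_norm_pow s p UNIV (\<lambda>x. \<phi> (x, t)) \<noteq> \<infinity>"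
      by (rule nn_integral_PInf_AE) (use W W_measurable in auto)
    then have "AE t in lborel. (\<lambda>x. \<phi> (x, t)) \<in> W0sp s p ?D"
    proof eventually_elim
      case (elim t)
      have "(\<lambda>x. \<phi> (x, t)) \<in> borel_measurable (lebesgue_on UNIV)" by (rule borel_imp_lebesgue_on) measurable
      moreover have "\<phi> (x, t) = 0" if "x \<notin> ?D" for x using that R by (auto simp: \<phi>_def intro!: st0)
      ultimately show ?case using elim by (auto simp: W0sp_def Wsp_def less_top)
    qed
    then show "AE t in lebesgue_on {c<..<e}. (\<lambda>x. \<phi> (x, t)) \<in> W0sp s p ?D"
      by (simp add: AE_restrict_space_iff AE_completion_iff) (auto elim: eventually_mono)
  qed
  have nn: "AE z in lebesgue_on (UNIV \<times> {0<..<T}). 0 \<le> \<phi> z" using st_nn by (simp add: \<phi>_def)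
  from sub have "\<And>D t1 t2 \<phi> \<psi>.
        inner_cylinder \<Omega> T D t1 t2 \<and> W1r_loc_deriv T (q + 1) D \<phi> \<psi> \<and>
        (\<forall>a b. 0 < a \<and> a < b \<and> b < T \<longrightarrow> \<phi> \<in> L_W0sp a b s p D) \<and>
        (AE z in lebesgue_on (UNIV \<times> {0<..<T}). 0 \<le> \<phi> z) \<longrightarrow>
        (\<exists>B1 B2.
           ((\<lambda>h. 1 / h * (\<integral>t\<in>{t1..t1 + h}. (\<integral>x\<in>D. spow q (u (x, t)) * \<phi> (x, t) \<partial>lebesgue) \<partial>lebesgue)) \<longlongrightarrow> B1) (at_right 0) \<and>
           ((\<lambda>h. 1 / h * (\<integral>t\<in>{t2 - h..t2}. (\<integral>x\<in>D. spow q (u (x, t)) * \<phi> (x, t) \<partial>lebesgue) \<partial>lebesgue)) \<longlongrightarrow> B2) (at_right 0) \<and>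
           (\<integral>t\<in>{t1..t2}. (\<integral>x. (\<integral>y. spow (p - 1) (u (x, t) - u (y, t)) * (\<phi> (x, t) - \<phi> (y, t)) * K (x, y, t) \<partial>lebesgue) \<partial>lebesgue) \<partial>lebesgue)
           - (\<integral>t\<in>{t1..t2}. (\<integral>x\<in>D. spow q (u (x, t)) * \<psi> (x, t) \<partial>lebesgue) \<partial>lebesgue)
           + B2 - B1 \<le> 0)"
    unfolding weak_subsolution_def by blast
  then obtain B1 B2 where
    B1: "((\<lambda>h. 1 / h * (\<integral>t\<in>{t1..t1 + h}. (\<integral>x\<in>?D. spow q (u (x, t)) * \<phi> (x, t) \<partial>lebesgue) \<partial>lebesgue)) \<longlongrightarrow> B1) (at_right 0)" and
    B2: "((\<lambda>h. 1 / h * (\<integral>t\<in>{t2 - h..t2}. (\<integral>x\<in>?D. spow q (u (x, t)) * \<phi> (x, t) \<partial>lebesgue) \<partial>lebesgue)) \<longlongrightarrow> B2) (at_right 0)" and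
    ineq: "(\<integral>t\<in>{t1..t2}. (\<integral>x. (\<integral>y. spow (p - 1) (u (x, t) - u (y, t)) * (\<phi> (x, t) - \<phi> (y, t)) * K (x, y, t) \<partial>lebesgue) \<partial>lebesgue) \<partial>lebesgue)
           - (\<integral>t\<in>{t1..t2}. (\<integral>x\<in>?D. spow q (u (x, t)) * \<psi> (x, t) \<partial>lebesgue) \<partial>lebesgue) + B2 - B1 \<le> 0"
    using cyl deriv W0 nn by blast
  have zero: "(\<integral>t\<in>I. (\<integral>x\<in>?D. spow q (u (x, t)) * \<phi> (x, t) \<partial>lebesgue) \<partial>lebesgue) = 0"
    if "\<And>t. t \<in> I \<Longrightarrow> \<not> (a - h \<le> t \<and> t \<le> b)" for I
  proof -
    have "(\<integral>t\<in>I. (\<integral>x\<in>?D. spow q (u (x, t)) * \<phi> (x, t) \<partial>lebesgue) \<partial>lebesgue) = (\<integral>t. 0 \<partial>(lebesgue :: real measure))"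
      unfolding set_lebesgue_integral_def
      by (rule Bochner_Integration.integral_cong) (use that in \<open>auto simp: \<phi>_def st0 indicator_def\<close>)
    then show ?thesis by simp
  qed
  \<comment> \<open>The support of \<open>\<phi>\<close> begins at a - h > t1, so the averages over
    short intervals after t1 are exactly 0, and the limit is unique.\<close>
  have "B1 = 0"
  proof (rule tendsto_unique[OF _ B1])
    have "\<forall>\<^sub>F k in at_right 0. k < a - h - t1" using h by (intro eventually_at_rightI[of 0 "a - h - t1"]) auto
    then have "\<forall>\<^sub>F k in at_right 0. 0 = 1 / k * (\<integral>t\<in>{t1..t1 + k}. (\<integral>x\<in>?D. spow q (u (x, t)) * \<phi> (x, t) \<partial>lebesgue) \<partial>lebesgue)"
      by eventually_elim (subst zero, auto)
    then show "((\<lambda>k. 1 / k * (\<integral>t\<in>{t1..t1 + k}. (\<integral>x\<in>?D. spow q (u (x, t)) * \<phi> (x, t) \<partial>lebesgue) \<partial>lebesgue)) \<longlongrightarrow> 0) (at_right 0)"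
      by (rule Lim_transform_eventually[OF tendsto_const])
  qed simp
  moreover have "B2 = 0"
  proof (rule tendsto_unique[OF _ B2])
    have "\<forall>\<^sub>F k in at_right 0. k < t2 - b" using ab by (intro eventually_at_rightI[of 0 "t2 - b"]) auto
    then have "\<forall>\<^sub>F k in at_right 0. 0 = 1 / k * (\<integral>t\<in>{t2 - k..t2}. (\<integral>x\<in>?D. spow q (u (x, t)) * \<phi> (x, t) \<partial>lebesgue) \<partial>lebesgue)"
      by eventually_elim (subst zero, auto)
    then show "((\<lambda>k. 1 / k * (\<integral>t\<in>{t2 - k..t2}. (\<integral>x\<in>?D. spow q (u (x, t)) * \<phi> (x, t) \<partial>lebesgue) \<partial>lebesgue)) \<longlongrightarrow> 0) (at_right 0)"
      by (rule Lim_transform_eventually[OF tendsto_const])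
  qed simp
  moreover have "(\<integral>t\<in>{t1..t2}. (\<integral>x. (\<integral>y. spow (p - 1) (u (x, t) - u (y, t)) * (\<phi> (x, t) - \<phi> (y, t)) * K (x, y, t) \<partial>lebesgue) \<partial>lebesgue) \<partial>lebesgue)
    = (\<integral>z. elliptic st z \<partial>lborel)"
  proof -
    have "AE t in lborel. AE x in lborel. AE y in lborel.
      indicat_real {t1..t2} t * (spow (p - 1) (u (x, t) - u (y, t)) * (\<phi> (x, t) - \<phi> (y, t)) * K (x, y, t)) = elliptic st (t, x, y)"
      using uV K\<kappa>
    proof eventually_elim
      case (elim t)
      show ?case
      proof (cases "t \<in> {t1..t2}")
        case False
        then have "elliptic st (t, x, y) = 0" for x y using st_supp[of t x] st_supp[of t y] by (auto simp: elliptic_def)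
        then show ?thesis using False by simp
      next
        case True
        then have u: "AE x in lborel. u (x, t) = V (t, x)" and k: "AE x in lborel. AE y in lborel. K (x, y, t) = \<kappa> (t, x, y)"
          using elim T by auto
        from u k show ?thesis
        proof eventually_elim
          case (elim x)
          from u elim(2) show ?case
            by eventually_elim (use elim(1) True in \<open>simp add: elliptic_def \<phi>_def\<close>)
        qed
      qed
    qed
    from iterated_integral_lebesgue3[OF elliptic_integrable[OF _ R st_fin st_supp] this]
    show ?thesis by (simp add: set_lebesgue_integral_def)
  qed
  moreover have "(\<integral>t\<in>{t1..t2}. (\<integral>x\<in>?D. spow q (u (x, t)) * \<psi> (x, t) \<partial>lebesgue) \<partial>lebesgue) = (\<integral>z. spow q (V z) * d z \<partial>lborel)"
  proof -
    have int: "integrable lborel (\<lambda>z. spow q (V z) * d z)"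
    proof (rule integrable_bounded_support[of _ "{a - h..b} \<times> ball x0 R" "M powr q * (2 * C / h)"])
      show "\<bar>spow q (V z) * d z\<bar> \<le> M powr q * (2 * C / h)" for z
        unfolding abs_mult using V[of z] q d_le[of z] by (intro mult_mono) (auto simp: abs_spow intro: powr_mono2)
      show "spow q (V z) * d z = 0" if "z \<notin> {a - h..b} \<times> ball x0 R" for z
        using that d0[of "fst z" "snd z"] by (cases z) auto
    next
      show "{a - h..b} \<times> ball x0 R \<in> sets borel" by (simp add: borel_prod[symmetric])
    qed (measurable, auto simp: bounded_Times)
    have "AE t in lborel. AE x in lborel. indicat_real {t1..t2} t * (indicat_real ?D x * (spow q (u (x, t)) * \<psi> (x, t))) = spow q (V (t, x)) * d (t, x)"
      using uV
    proof eventually_elim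
      case (elim t)
      show ?case
      proof (cases "t \<in> {t1..t2}")
        case False
        then have "d (t, x) = 0" for x using h ab by (intro d0) auto
        then show ?thesis using False by simp
      next
        case True
        then have "AE x in lborel. u (x, t) = V (t, x)" using elim T by auto
        then show ?thesis
        proof eventually_elim
          case (elim x)
          have "d (t, x) = 0" if "x \<notin> ?D" using that R by (intro d0) auto
          then show ?case using elim True by (cases "x \<in> ?D") (auto simp: \<psi>_def)
        qed
      qed
    qed
    from iterated_integral_lebesgue2[OF int this]
    show ?thesis by (simp add: set_lebesgue_integral_def)
  qed
  ultimately show ?thesis using ineq by (simp add: st_def d_def)
qed

end

text \<open>P itself may define no measurable set, so the argument runs on a Borel null set
  containing the exceptional points; Tonelli with reordered variables brings the time to the
  front.\<close>

lemma AE_triple_rotate: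
  fixes P :: "'b::euclidean_space \<times> 'c::euclidean_space \<times> 'd::euclidean_space \<Rightarrow> bool"
  assumes "AE w in lborel. P w"
  shows "AE t in lborel. AE x in lborel. AE y in lborel. P (x, y, t)"
proof -
  obtain N where N: "N \<in> sets borel" "emeasure lborel N = 0" "{w. \<not> P w} \<subseteq> N"
    using assms unfolding eventually_ae_filter by (auto simp: null_sets_def)
  have [measurable]: "N \<in> sets borel" by fact
  have "0 = (\<integral>\<^sup>+w. indicator N w \<partial>lborel)" using N by simp
  also have "\<dots> = (\<integral>\<^sup>+x. (\<integral>\<^sup>+w. indicator N (x, w) \<partial>lborel) \<partial>lborel)" by (rule nn_integral_lborel_pair) measurable
  also have "\<dots> = (\<integral>\<^sup>+x. (\<integral>\<^sup>+t. (\<integral>\<^sup>+y. indicator N (x, y, t) \<partial>lborel) \<partial>lborel) \<partial>lborel)"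
    by (intro nn_integral_cong nn_integral_lborel_pair_snd) measurable
  also have "\<dots> = (\<integral>\<^sup>+t. (\<integral>\<^sup>+x. (\<integral>\<^sup>+y. indicator N (x, y, t) \<partial>lborel) \<partial>lborel) \<partial>lborel)"
    by (rule lborel_pair.Fubini'[symmetric]) measurable
  finally have "AE t in lborel. (\<integral>\<^sup>+x. (\<integral>\<^sup>+y. indicator N (x, y, t) \<partial>lborel) \<partial>lborel) = 0"
    by (subst (asm) eq_commute, subst (asm) nn_integral_0_iff_AE) auto
  then show ?thesis
  proof eventually_elim
    case (elim t)
    then have "AE x in lborel. (\<integral>\<^sup>+y. indicator N (x, y, t) \<partial>lborel) = 0"
      by (subst (asm) nn_integral_0_iff_AE) auto
    then show ?case
    proof eventually_elim
      case (elim x)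
      then have "AE y in lborel. indicator N (x, y, t) = (0 :: ennreal)"
        by (subst (asm) nn_integral_0_iff_AE) auto
      then show ?case by eventually_elim (use N(3) in \<open>auto simp: indicator_def split: if_splits\<close>)
    qed
  qed
qed

lemma AE_pair_rotate:
  fixes P :: "'b::euclidean_space \<times> 'c::euclidean_space \<Rightarrow> bool"
  assumes "AE w in lborel. P w"
  shows "AE t in lborel. AE x in lborel. P (x, t)"
proof -
  obtain N where N: "N \<in> sets borel" "emeasure lborel N = 0" "{w. \<not> P w} \<subseteq> N"
    using assms unfolding eventually_ae_filter by (auto simp: null_sets_def)
  have [measurable]: "N \<in> sets borel" by fact
  have "0 = (\<integral>\<^sup>+w. indicator N w \<partial>lborel)" using N by simp
  also have "\<dots> = (\<integral>\<^sup>+t. (\<integral>\<^sup>+x. indicator N (x, t) \<partial>lborel) \<partial>lborel)" by (rule nn_integral_lborel_pair_snd) measurable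
  finally have "AE t in lborel. (\<integral>\<^sup>+x. indicator N (x, t) \<partial>lborel) = 0"
    by (subst (asm) eq_commute, subst (asm) nn_integral_0_iff_AE) auto
  then show ?thesis
  proof eventually_elim
    case (elim t)
    then have "AE x in lborel. indicator N (x, t) = (0 :: ennreal)"
      by (subst (asm) nn_integral_0_iff_AE) auto
    then show ?case by eventually_elim (use N(3) in \<open>auto simp: indicator_def split: if_splits\<close>)
  qed
qed

lemma lebesgue_on_borel_version:
  fixes f :: "'a::euclidean_space \<Rightarrow> real"
  assumes "f \<in> borel_measurable (lebesgue_on S)" "S \<in> sets lebesgue"
  obtains f' where "f' \<in> borel_measurable borel" "AE z in lborel. z \<in> S \<longrightarrow> f z = f' z"
proof -
  have "(\<lambda>z. if z \<in> S then f z else 0) \<in> borel_measurable lebesgue"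
    using assms by (intro borel_measurable_if_I) auto
  from completion_ex_borel_measurable_real[OF this] obtain f' where
    "f' \<in> borel_measurable lborel" "AE z in lborel. (if z \<in> S then f z else 0) = f' z" by blast
  then show ?thesis by (intro that[of f']) (auto elim: eventually_mono)
qed

text \<open>The bounds on \<open>u\<close> and \<open>K\<close> hold almost everywhere, whereas the
  locale demands them at every point; Borel versions are therefore clamped to the allowed ranges,
  which changes them only on null sets. M may be any number from M0 on, because later it must also
  dominate the levels.\<close>

lemma weak_subsolution_borel:
  fixes u :: "'a::euclidean_space \<times> real \<Rightarrow> real" and K :: "'a \<times> 'a \<times> real \<Rightarrow> real"
  assumes p: "1 < p" and q: "0 < q" and s: "0 < s" "s < 1" and \<Lambda>: "1 \<le> \<Lambda>"
    and K: "nonlocal_kernel s p \<Lambda> T K" and sub: "weak_subsolution s p q K \<Omega> T u"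
  obtains V \<kappa> M0 where "V \<in> borel_measurable borel" "\<And>w. \<bar>V w\<bar> \<le> M0" "AE z in lborel. snd z \<in> {0<..<T} \<longrightarrow> u z = V (snd z, fst z)"
    "\<And>M x0 R0 t1 t2. M0 \<le> M \<Longrightarrow> 0 < R0 \<Longrightarrow> cball x0 R0 \<subseteq> \<Omega> \<Longrightarrow> 0 < t1 \<Longrightarrow> t1 < t2 \<Longrightarrow> t2 < T \<Longrightarrow>
       nonlocal_subsolution p (p * s) q \<Lambda> M \<kappa> V x0 R0 t1 t2"
proof -
  have "open (UNIV \<times> {0<..<T} :: ('a \<times> real) set)" by (intro open_Times) auto
  then obtain u1 where u1 [measurable]: "u1 \<in> borel_measurable borel"
    and u1_ae: "AE z in lborel. z \<in> UNIV \<times> {0<..<T} \<longrightarrow> u z = u1 z"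
    using sub lebesgue_on_borel_version[of u "UNIV \<times> {0<..<T}"] unfolding weak_subsolution_def by auto
  obtain M' where M': "AE t in lebesgue_on {0<..<T}. AE x in lebesgue. \<bar>u (x, t)\<bar> \<le> M'"
    using sub unfolding weak_subsolution_def by blast
  define M0 where "M0 = max M' 0"
  define V where "V w = max (- M0) (min M0 (u1 (snd w, fst w)))" for w :: "real \<times> 'a"
  have [measurable]: "V \<in> borel_measurable borel" unfolding V_def by measurable
  have V: "\<bar>V w\<bar> \<le> M0" for w by (auto simp: V_def M0_def)
  have uV: "AE t in lborel. 0 < t \<and> t < T \<longrightarrow> (AE x in lborel. u (x, t) = V (t, x))"
  proof -
    have "AE t in lborel. 0 < t \<and> t < T \<longrightarrow> (AE x in lborel. \<bar>u (x, t)\<bar> \<le> M')"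
      using M' by (simp add: AE_restrict_space_iff AE_completion_iff)
    then show ?thesis using AE_pair_rotate[OF u1_ae]
    proof eventually_elim
      case (elim t)
      show ?case
      proof
        assume t: "0 < t \<and> t < T"
        then have "AE x in lborel. \<bar>u (x, t)\<bar> \<le> M'" using elim(1) by simp
        then show "AE x in lborel. u (x, t) = V (t, x)" using elim(2)
          by eventually_elim (use t in \<open>auto simp: V_def M0_def\<close>)
      qed
    qed
  qed
  \<comment> \<open>The bound on \<open>u\<close> is given in nested form, for almost every x at
    almost every t. It becomes a joint statement once the predicate is measurable, so
    \<open>u1\<close> and V are compared first and \<open>u\<close> is put back at the end.\<close>
  have uV2: "AE z in lborel. snd z \<in> {0<..<T} \<longrightarrow> u z = V (snd z, fst z)"
  proof -
    have "AE t in lborel. AE x in lborel. 0 < t \<and> t < T \<longrightarrow> u1 (x, t) = V (t, x)"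
      using AE_pair_rotate[OF u1_ae] uV
    proof eventually_elim
      case (elim t)
      show ?case
      proof (cases "0 < t \<and> t < T")
        case True
        then have "AE x in lborel. u (x, t) = V (t, x)" using elim by simp
        then show ?thesis using elim(1) by eventually_elim (use True in auto)
      qed auto
    qed
    then have ae: "AE x in lborel. AE t in lborel. 0 < t \<and> t < T \<longrightarrow> u1 (x, t) = V (t, x)"
      by (subst lborel_pair.AE_commute) (unfold lborel_prod, measurable)
    have "AE z in lborel \<Otimes>\<^sub>M lborel. 0 < snd z \<and> snd z < T \<longrightarrow> u1 z = V (snd z, fst z)"
    proof (rule lborel_pair.AE_pair_measure)
      show "{z \<in> space (lborel \<Otimes>\<^sub>M lborel). 0 < snd z \<and> snd z < T \<longrightarrow> u1 z = V (snd z, fst z)} \<in> sets (lborel \<Otimes>\<^sub>M lborel)"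
        unfolding lborel_prod by measurable
      show "AE x in lborel. AE t in lborel. 0 < snd (x, t) \<and> snd (x, t) < T \<longrightarrow> u1 (x, t) = V (snd (x, t), fst (x, t))"
        using ae by simp
    qed
    then have "AE z in lborel. 0 < snd z \<and> snd z < T \<longrightarrow> u1 z = V (snd z, fst z)" unfolding lborel_prod .
    with u1_ae show ?thesis by eventually_elim auto
  qed
  have "open (UNIV \<times> UNIV \<times> {0<..<T} :: ('a \<times> 'a \<times> real) set)" by (intro open_Times) auto
  then obtain K1 where K1 [measurable]: "K1 \<in> borel_measurable borel"
    and K1_ae: "AE w in lborel. w \<in> UNIV \<times> UNIV \<times> {0<..<T} \<longrightarrow> K w = K1 w"
    using K lebesgue_on_borel_version[of K "UNIV \<times> UNIV \<times> {0<..<T}"] unfolding nonlocal_kernel_def by auto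
  define \<sigma> where "\<sigma> = p * s"
  have \<sigma>: "0 < \<sigma>" "\<sigma> < p" using p s by (auto simp: \<sigma>_def)
  \<comment> \<open>The clamping range is nonempty by \<Lambda> \<ge> 1. At each t the bounds on
    \<open>K\<close> hold for almost every pair, so \<kappa> agrees with \<open>K\<close> in the
    nested sense.\<close>
  define \<kappa> where "\<kappa> w = max (fker \<sigma> (snd w) / \<Lambda>) (min (\<Lambda> * fker \<sigma> (snd w)) (K1 (fst (snd w), snd (snd w), fst w)))" for w :: "real \<times> 'a \<times> 'a"
  have [measurable]: "\<kappa> \<in> borel_measurable borel" unfolding \<kappa>_def by measurable
  have fker_le: "fker \<sigma> w / \<Lambda> \<le> \<Lambda> * fker \<sigma> w" for w :: "'a \<times> 'a"
  proof -
    have "fker \<sigma> w / \<Lambda> \<le> fker \<sigma> w / 1" using \<Lambda> fker_nonneg[of \<sigma> w] by (intro divide_left_mono) auto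
    also have "\<dots> \<le> \<Lambda> * fker \<sigma> w" using mult_right_mono[OF \<Lambda> fker_nonneg[of \<sigma> w]] by simp
    finally show ?thesis .
  qed
  have K\<kappa>: "AE t in lborel. 0 < t \<and> t < T \<longrightarrow> (AE x in lborel. AE y in lborel. K (x, y, t) = \<kappa> (t, x, y))"
    using AE_triple_rotate[OF K1_ae]
  proof eventually_elim
    case (elim t)
    show ?case
    proof
      assume t: "0 < t \<and> t < T"
      then have "AE z in lebesgue. case z of (x, y) \<Rightarrow>
        inverse \<Lambda> / norm (x - y) powr (real DIM('a) + p * s) \<le> K (x, y, t) \<and>
        K (x, y, t) \<le> \<Lambda> / norm (x - y) powr (real DIM('a) + p * s)"
        using K unfolding nonlocal_kernel_def by auto
      then have "AE z in lborel \<Otimes>\<^sub>M lborel. fker \<sigma> z / \<Lambda> \<le> K (fst z, snd z, t) \<and> K (fst z, snd z, t) \<le> \<Lambda> * fker \<sigma> z"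
        unfolding AE_completion_iff lborel_prod
        by eventually_elim (auto simp: fker_def \<sigma>_def divide_inverse mult_ac split: prod.splits)
      from lborel_pair.AE_pair[OF this]
      show "AE x in lborel. AE y in lborel. K (x, y, t) = \<kappa> (t, x, y)" using elim
      proof eventually_elim
        case (elim x)
        from elim show ?case
          by eventually_elim (use t in \<open>auto simp: \<kappa>_def\<close>)
      qed
    qed
  qed
  show ?thesis
  proof (rule that[OF _ V uV2])
    fix M x0 R0 t1 t2 assume M: "M0 \<le> M" and R0: "0 < R0" "cball x0 R0 \<subseteq> \<Omega>" and t12: "0 < t1" "t1 < t2" "t2 < T"
    have cyl: "inner_cylinder \<Omega> T (ball x0 R0) t1 t2"
      using R0 t12 by (simp add: inner_cylinder_def closure_ball)
    have energy: "(\<integral>\<^sup>+(t, x, y). indicator {t1<..<t2} t * indicator (ball x0 R0) x * indicator (ball x0 R0) y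
        * ennreal (\<bar>V (t, x) - V (t, y)\<bar> powr p * fker \<sigma> (x, y)) \<partial>lborel) < \<infinity>"
    proof -
      have m: "(\<lambda>(t, x, y). indicator {t1<..<t2} t * indicator (ball x0 R0) x * indicator (ball x0 R0) y
        * ennreal (\<bar>V (t, x) - V (t, y)\<bar> powr p * fker \<sigma> (x, y))) \<in> borel_measurable borel"
        unfolding split_beta' by measurable
      have "(\<integral>\<^sup>+(t, x, y). indicator {t1<..<t2} t * indicator (ball x0 R0) x * indicator (ball x0 R0) y
        * ennreal (\<bar>V (t, x) - V (t, y)\<bar> powr p * fker \<sigma> (x, y)) \<partial>lborel)
        = (\<integral>\<^sup>+t. (\<integral>\<^sup>+x. (\<integral>\<^sup>+y. indicator {t1<..<t2} t * indicator (ball x0 R0) x * indicator (ball x0 R0) y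
        * ennreal (\<bar>V (t, x) - V (t, y)\<bar> powr p * fker \<sigma> (x, y)) \<partial>lborel) \<partial>lborel) \<partial>lborel)"
        unfolding nn_integral_lborel_triple[OF m] by simp
      also have "\<dots> = (\<integral>\<^sup>+t. (\<integral>\<^sup>+x. (\<integral>\<^sup>+y. indicator {t1<..<t2} t * indicator (ball x0 R0) x * indicator (ball x0 R0) y
        * ennreal (\<bar>u (x, t) - u (y, t)\<bar> powr p * fker \<sigma> (x, y)) \<partial>lborel) \<partial>lborel) \<partial>lborel)"
      proof (rule nn_integral_cong_AE, use uV in eventually_elim)
        case (elim t)
        show ?case
        proof (cases "t \<in> {t1<..<t2}")
          case True
          then have u: "AE x in lborel. u (x, t) = V (t, x)" using elim t12 by auto
          show ?thesis
          proof (rule nn_integral_cong_AE, use u in eventually_elim)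
            case (elim x)
            show ?case by (rule nn_integral_cong_AE, use u in eventually_elim) (simp add: elim)
          qed
        qed simp
      qed
      also have "\<dots> \<le> (\<integral>\<^sup>+t\<in>{t1<..<t2}. Wsp_norm_pow s p (ball x0 R0) (\<lambda>x. u (x, t)) \<partial>lebesgue)"
        unfolding nn_integral_completion Wsp_norm_pow_def
      proof (intro nn_integral_mono)
        fix t
        have "(\<integral>\<^sup>+x. (\<integral>\<^sup>+y. indicator {t1<..<t2} t * indicator (ball x0 R0) x * indicator (ball x0 R0) y
          * ennreal (\<bar>u (x, t) - u (y, t)\<bar> powr p * fker \<sigma> (x, y)) \<partial>lborel) \<partial>lborel)
          = (\<integral>\<^sup>+x\<in>ball x0 R0. (\<integral>\<^sup>+y\<in>ball x0 R0. ennreal (\<bar>u (x, t) - u (y, t)\<bar> powr p / norm (x - y) powr (real DIM('a) + p * s)) \<partial>lborel) \<partial>lborel)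
            * indicator {t1<..<t2} t"
          by (cases "t \<in> {t1<..<t2}")
             (auto simp: fker_def \<sigma>_def mult_ac intro!: nn_integral_cong split: split_indicator)
        also have "\<dots> \<le> ((\<integral>\<^sup>+x\<in>ball x0 R0. ennreal (\<bar>u (x, t)\<bar> powr p) \<partial>lborel) + (\<integral>\<^sup>+x\<in>ball x0 R0. (\<integral>\<^sup>+y\<in>ball x0 R0. ennreal (\<bar>u (x, t) - u (y, t)\<bar> powr p / norm (x - y) powr (real DIM('a) + p * s)) \<partial>lborel) \<partial>lborel))
            * indicator {t1<..<t2} t"
          by (intro mult_right_mono add_increasing) auto
        finally show "(\<integral>\<^sup>+x. (\<integral>\<^sup>+y. indicator {t1<..<t2} t * indicator (ball x0 R0) x * indicator (ball x0 R0) y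
          * ennreal (\<bar>u (x, t) - u (y, t)\<bar> powr p * fker \<sigma> (x, y)) \<partial>lborel) \<partial>lborel) \<le> \<dots>" .
      qed
      also have "\<dots> < \<infinity>" using sub cyl unfolding weak_subsolution_def L_Wsp_def by blast
      finally show ?thesis .
    qed
    interpret E: nonlocal_energy p \<sigma> q \<Lambda> M \<kappa> V x0 R0 t1 t2
      using p \<sigma> q \<Lambda> t12 energy V M fker_le
      by unfold_locales (auto simp: \<kappa>_def intro: order_trans)
    show "nonlocal_subsolution p (p * s) q \<Lambda> M \<kappa> V x0 R0 t1 t2"
      unfolding \<sigma>_def[symmetric]
    proof (rule nonlocal_subsolution.intro[OF E.nonlocal_energy_axioms], rule nonlocal_subsolution_axioms.intro)
      fix g C a b R h
      assume "g \<in> borel_measurable borel" "\<And>z. 0 \<le> g z" "\<And>z. g z \<le> C" "0 < h" "t1 < a - h" "a \<le> b" "b < t2" "R < R0"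
        "\<And>t x. \<not> (a \<le> t \<and> t \<le> b) \<or> x \<notin> ball x0 R \<Longrightarrow> g (t, x) = 0" "E.seminorm g < \<infinity>"
      then show "(\<integral>z. E.elliptic (steklov h g) z \<partial>lborel) \<le> (\<integral>z. spow q (V z) * ((g (fst z + h, snd z) - g z) / h) \<partial>lborel)"
        by (rule E.weak_inequality[OF \<sigma>_def sub cyl uV K\<kappa>])
    qed
  qed measurable
qed

section \<open>Cylinders, density and the upper semicontinuous regularization\<close>

lemma open_cylinder: "open (cylinder s p \<theta> z r)"
  unfolding cylinder_def by (intro open_Times) auto

lemma cylinder_borel [measurable]: "cylinder s p \<theta> z r \<in> sets borel"
  by (rule borel_open[OF open_cylinder])

lemma bounded_cylinder: "bounded (cylinder s p \<theta> z r)"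
  unfolding cylinder_def by (intro bounded_Times) auto

lemma center_in_cylinder: "0 < r \<Longrightarrow> 0 < \<theta> \<Longrightarrow> z \<in> cylinder s p \<theta> z r"
  unfolding cylinder_def by (cases z) auto

lemma cylinder_mono:
  assumes "0 < s * p" "0 < \<theta>" "0 < r" "r \<le> r'"
  shows "cylinder s p \<theta> z r \<subseteq> cylinder s p \<theta> z r'"
proof -
  define h where "h \<rho> = \<theta> * \<rho> powr (s * p)" for \<rho>
  have "h r \<le> h r'"
    unfolding h_def using assms by (intro mult_left_mono powr_mono2) auto
  then show ?thesis using assms(4) unfolding cylinder_def h_def[symmetric] by auto
qed

lemma cylinder_translate: "w \<in> cylinder s p \<theta> z r \<longleftrightarrow> w - z \<in> cylinder s p \<theta> 0 r"
  by (cases w; cases z) (auto simp: cylinder_def dist_norm norm_minus_commute)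

lemma cylinder_eventually_subset:
  fixes z :: "'a::euclidean_space \<times> real"
  assumes "0 < s * p" "0 < \<theta>" "open N" "z \<in> N"
  shows "\<forall>\<^sub>F r in at_right 0. cylinder s p \<theta> z r \<subseteq> N"
proof -
  obtain x t where z: "z = (x, t)" by (cases z)
  obtain A B where AB: "open A" "open B" "x \<in> A" "t \<in> B" "A \<times> B \<subseteq> N"
    using assms(3,4) z by (auto elim: open_prod_elim)
  obtain d where d: "0 < d" "ball x d \<subseteq> A" using AB by (auto simp: open_contains_ball)
  obtain e where e: "0 < e" "ball t e \<subseteq> B" using AB by (auto simp: open_contains_ball)
  have "((\<lambda>r. \<theta> * r powr (s * p)) \<longlongrightarrow> \<theta> * 0) (at_right 0)"
  proof (intro tendsto_intros)
    show "((\<lambda>r. r powr (s * p)) \<longlongrightarrow> 0) (at_right 0)"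
    proof -
      have "\<forall>\<^sub>F r in at_right (0::real). 0 \<le> r" using eventually_at_right_less[of 0] by eventually_elim simp
      then show ?thesis
        using tendsto_powr'[of "\<lambda>r. r" 0 "at_right (0::real)" "\<lambda>_. s * p" "s * p"] assms(1) by simp
    qed
  qed
  then have "\<forall>\<^sub>F r in at_right 0. \<theta> * r powr (s * p) < e" using e(1) by (intro order_tendstoD) auto
  moreover have "\<forall>\<^sub>F r in at_right 0. r < d" using d(1) by (intro eventually_at_rightI[of 0 d]) auto
  ultimately show ?thesis
  proof eventually_elim
    case (elim r)
    have "ball x r \<subseteq> A" using elim d(2) by (auto dest: subsetD)
    moreover have "{t - \<theta> * r powr (s * p)<..<t + \<theta> * r powr (s * p)} \<subseteq> B"
    proof
      fix \<tau> assume "\<tau> \<in> {t - \<theta> * r powr (s * p)<..<t + \<theta> * r powr (s * p)}"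
      then have "\<tau> \<in> ball t e" using elim by (auto simp: dist_real_def abs_less_iff)
      then show "\<tau> \<in> B" using e(2) by blast
    qed
    ultimately show ?case using AB(5) by (auto simp: cylinder_def z)
  qed
qed

lemma measure_cylinder:
  fixes z :: "'a::euclidean_space \<times> real"
  assumes "0 < r" "0 < \<theta>"
  shows "emeasure lborel (cylinder s p \<theta> z r) = ennreal (unit_ball_vol (real DIM('a)) * 2 * \<theta> * r powr (real DIM('a) + s * p))"
proof -
  let ?I = "{snd z - \<theta> * r powr (s * p)<..<snd z + \<theta> * r powr (s * p)}"
  have "emeasure lborel (cylinder s p \<theta> z r) = emeasure (lborel \<Otimes>\<^sub>M lborel) (ball (fst z) r \<times> ?I)"
    by (simp add: cylinder_def lborel_prod)
  also have "\<dots> = emeasure lborel (ball (fst z) r) * emeasure lborel ?I"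
    by (rule lborel.emeasure_pair_measure_Times) auto
  also have "\<dots> = ennreal (unit_ball_vol (real DIM('a)) * r powr real DIM('a)) * ennreal (2 * \<theta> * r powr (s * p))"
    using assms by (simp add: emeasure_ball_powr mult.assoc)
  also have "\<dots> = ennreal (unit_ball_vol (real DIM('a)) * 2 * \<theta> * r powr (real DIM('a) + s * p))"
    using assms by (subst ennreal_mult[symmetric]) (auto simp: powr_add mult_ac)
  finally show ?thesis .
qed

lemma emeasure_swap_lborel:
  fixes A :: "('b::euclidean_space \<times> 'c::euclidean_space) set"
  assumes [measurable]: "A \<in> sets borel"
  shows "emeasure lborel A = emeasure lborel {w. (snd w, fst w) \<in> A}"
proof -
  have "emeasure lborel A = (\<integral>\<^sup>+z. indicator A z \<partial>lborel)" by simp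
  also have "\<dots> = (\<integral>\<^sup>+x. (\<integral>\<^sup>+y. indicator A (x, y) \<partial>lborel) \<partial>lborel)"
    by (rule nn_integral_lborel_pair) measurable
  also have "\<dots> = (\<integral>\<^sup>+w. indicator A (snd w, fst w) \<partial>lborel)"
  proof -
    have m: "(\<lambda>w. indicator A (snd w, fst w) :: ennreal) \<in> borel_measurable borel" by measurable
    show ?thesis using nn_integral_lborel_pair_snd[OF m] by simp
  qed
  also have "\<dots> = (\<integral>\<^sup>+w. indicator {w. (snd w, fst w) \<in> A} w \<partial>lborel)"
    by (intro nn_integral_cong) (auto split: split_indicator)
  also have "\<dots> = emeasure lborel {w. (snd w, fst w) \<in> A}"
    by (rule nn_integral_indicator) measurable
  finally show ?thesis .
qed

text \<open>Regularity of the measure: squeeze E between a compact F and an open O', each with error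
  below \<eta> / 2. If z + v lies in F and v is short, then z lies in O'; otherwise z + v lies in E
  - F. Both cases have small measure, the second by translation invariance.\<close>

lemma translation_continuous_measure:
  fixes E :: "'b::euclidean_space set"
  assumes [measurable]: "E \<in> sets borel" and E: "bounded E" and \<eta>: "0 < \<eta>"
  obtains \<delta> where "0 < \<delta>" "\<And>v. norm v < \<delta> \<Longrightarrow> emeasure lborel {z. z \<notin> E \<and> z + v \<in> E} \<le> ennreal \<eta>"
proof -
  obtain O' where O': "open O'" "E \<subseteq> O'" "emeasure lborel (O' - E) < ennreal (\<eta> / 2)"
    using outer_regular_lborel[OF assms(1), of "\<eta> / 2"] \<eta> by auto
  have El: "E \<in> sets lebesgue" and \<eta>2: "0 < \<eta> / 2" using \<eta> by simp_all
  obtain F where F: "closed F" "F \<subseteq> E" "E - F \<in> lmeasurable" "emeasure lebesgue (E - F) < ennreal (\<eta> / 2)"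
    by (rule sets_lebesgue_inner_closed[OF El \<eta>2])
  have [measurable]: "F \<in> sets borel" "O' \<in> sets borel"
    using borel_closed[OF F(1)] borel_open[OF O'(1)] by simp_all
  have "compact F" using F E bounded_subset compact_eq_bounded_closed by blast
  then obtain \<delta> where \<delta>: "0 < \<delta>" "(\<Union>x\<in>F. ball x \<delta>) \<subseteq> O'"
    using compact_subset_open_imp_ball_epsilon_subset[of F O'] O' F by (metis subset_trans)
  show ?thesis
  proof (rule that[OF \<delta>(1)])
    fix v :: 'b assume v: "norm v < \<delta>"
    have sub: "{z. z \<notin> E \<and> z + v \<in> E} \<subseteq> {z. v + z \<in> E - F} \<union> (O' - E)"
    proof
      fix z assume z: "z \<in> {z. z \<notin> E \<and> z + v \<in> E}"
      show "z \<in> {z. v + z \<in> E - F} \<union> (O' - E)"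
      proof (cases "z + v \<in> F")
        case True
        have "z \<in> ball (z + v) \<delta>" using v by (simp add: dist_norm)
        then show ?thesis using True \<delta>(2) z by blast
      next
        case False then show ?thesis using z by (auto simp: add.commute)
      qed
    qed
    have shift: "emeasure lborel {z. v + z \<in> E - F} = emeasure lborel (E - F)"
    proof -
      have "emeasure lborel {z. v + z \<in> E - F} = (\<integral>\<^sup>+z. indicator {z. v + z \<in> E - F} z \<partial>lborel)"
        by (rule nn_integral_indicator[symmetric]) measurable
      also have "\<dots> = (\<integral>\<^sup>+z. indicator (E - F) (v + z) \<partial>lborel)"
        by (intro nn_integral_cong) (auto split: split_indicator)
      also have "\<dots> = (\<integral>\<^sup>+z. indicator (E - F) z \<partial>lborel)" by (rule nn_integral_lborel_shift) measurable
      finally show ?thesis by simp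
    qed
    have "emeasure lborel {z. z \<notin> E \<and> z + v \<in> E} \<le> emeasure lborel ({z. v + z \<in> E - F} \<union> (O' - E))"
      by (rule emeasure_mono[OF sub]) measurable
    also have "\<dots> \<le> emeasure lborel {z. v + z \<in> E - F} + emeasure lborel (O' - E)"
      by (rule emeasure_subadditive) measurable
    also have "\<dots> \<le> ennreal (\<eta> / 2) + ennreal (\<eta> / 2)"
      unfolding shift using O' F by (intro add_mono) (auto simp: less_imp_le)
    also have "\<dots> = ennreal \<eta>" using \<eta> by (subst ennreal_plus[symmetric]) auto
    finally show "emeasure lborel {z. z \<notin> E \<and> z + v \<in> E} \<le> ennreal \<eta>" .
  qed
qed

text \<open>A substitute for the density theorem along the cylinders, which do not have bounded
  eccentricity: averaging over \<open>z\<close> reduces it to the continuity of translations.\<close>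

lemma AE_small_density_aux:
  fixes E :: "('a::euclidean_space \<times> real) set"
  assumes [measurable]: "E \<in> sets borel" and E: "bounded E" and sp: "0 < s * p" and \<theta>: "0 < \<theta>"
    and \<nu>: "0 < \<nu>" and r1: "0 < r1"
  shows "AE z in lborel. z \<notin> E \<longrightarrow> (\<exists>r>0. r < r1 \<and> emeasure lborel (E \<inter> cylinder s p \<theta> z r) \<le> ennreal (\<nu> * r powr (real DIM('a) + s * p)))"
proof -
  define m where "m = real DIM('a) + s * p"
  define c where "c = unit_ball_vol (real DIM('a)) * 2 * \<theta>"
  have c: "0 < c" using \<theta> by (simp add: c_def)
  \<comment> \<open>The measure of E in the cylinder around z, written as an integral over the
    offset v, so that the order of z and v can be interchanged.\<close>
  define f where "f r z = (\<integral>\<^sup>+v. indicator (cylinder s p \<theta> 0 r) v * indicator E (z + v) \<partial>lborel)" for r and z :: "'a \<times> real"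
  have [measurable]: "f r \<in> borel_measurable borel" for r unfolding f_def by measurable
  have f_eq: "emeasure lborel (E \<inter> cylinder s p \<theta> z r) = f r z" for r z
  proof -
    have "emeasure lborel (E \<inter> cylinder s p \<theta> z r) = (\<integral>\<^sup>+w. indicator (E \<inter> cylinder s p \<theta> z r) w \<partial>lborel)" by simp
    also have "\<dots> = (\<integral>\<^sup>+v. indicator (E \<inter> cylinder s p \<theta> z r) (z + v) \<partial>lborel)"
      by (rule nn_integral_lborel_shift[symmetric]) measurable
    also have "\<dots> = f r z" unfolding f_def
    proof (rule nn_integral_cong)
      fix v
      show "indicator (E \<inter> cylinder s p \<theta> z r) (z + v) = (indicator (cylinder s p \<theta> 0 r) v * indicator E (z + v) :: ennreal)"
        using cylinder_translate[of "z + v" s p \<theta> z r] by (auto split: split_indicator)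
    qed
    finally show ?thesis .
  qed
  define Bad where "Bad r = {z. z \<notin> E \<and> ennreal (\<nu> * r powr m) \<le> f r z}" for r
  have [measurable]: "Bad r \<in> sets borel" for r unfolding Bad_def by measurable
  \<comment> \<open>A countable sequence of radii suffices; the index j + 2 keeps every radius
    strictly below r1.\<close>
  define N where "N = (\<Inter>j. Bad (r1 / real (Suc (Suc j))))"
  have [measurable]: "N \<in> sets borel" unfolding N_def by measurable
  have N_le: "emeasure lborel N \<le> ennreal e" if e: "0 < e" for e
  proof -
    \<comment> \<open>Chebyshev: the integral of f over the complement of E is at most \<eta> times
      the volume c r^m of the cylinder, which equals \<nu> r^m e by this choice.\<close>
    define \<eta> where "\<eta> = e * \<nu> / c"
    have \<eta>: "0 < \<eta>" using e \<nu> c by (simp add: \<eta>_def)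
    obtain \<delta> where \<delta>: "0 < \<delta>" "\<And>v. norm v < \<delta> \<Longrightarrow> emeasure lborel {z. z \<notin> E \<and> z + v \<in> E} \<le> ennreal \<eta>"
      using translation_continuous_measure[OF assms(1) E \<eta>] by blast
    have "\<forall>\<^sub>F r in at_right 0. cylinder s p \<theta> (0 :: 'a \<times> real) r \<subseteq> ball 0 \<delta>"
      using \<delta>(1) by (intro cylinder_eventually_subset sp \<theta>) auto
    moreover have "filterlim (\<lambda>j. r1 / real (Suc (Suc j))) (at_right 0) sequentially"
    proof -
      have "(\<lambda>j. r1 / real (Suc (Suc j))) \<longlonglongrightarrow> 0"
        using LIMSEQ_Suc[OF LIMSEQ_Suc[OF lim_const_over_n[of r1]]] by simp
      then show ?thesis using r1 by (simp add: filterlim_at)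
    qed
    ultimately have "\<forall>\<^sub>F j in sequentially. cylinder s p \<theta> (0 :: 'a \<times> real) (r1 / real (Suc (Suc j))) \<subseteq> ball 0 \<delta>"
      by (rule eventually_compose_filterlim)
    then obtain j where j: "cylinder s p \<theta> (0 :: 'a \<times> real) (r1 / real (Suc (Suc j))) \<subseteq> ball 0 \<delta>"
      by (auto simp: eventually_sequentially)
    define r where "r = r1 / real (Suc (Suc j))"
    have r: "0 < r" using r1 by (simp add: r_def)
    have cyl: "cylinder s p \<theta> (0 :: 'a \<times> real) r \<subseteq> ball 0 \<delta>" using j by (simp add: r_def)
    have "ennreal (\<nu> * r powr m) * emeasure lborel N \<le> ennreal (\<nu> * r powr m) * emeasure lborel (Bad r)"
      by (intro mult_left_mono emeasure_mono) (auto simp: N_def r_def)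
    also have "\<dots> = (\<integral>\<^sup>+z. ennreal (\<nu> * r powr m) * indicator (Bad r) z \<partial>lborel)"
      by (rule nn_integral_cmult_indicator[symmetric]) measurable
    also have "\<dots> \<le> (\<integral>\<^sup>+z. indicator (- E) z * f r z \<partial>lborel)"
      by (intro nn_integral_mono) (auto simp: Bad_def split: split_indicator)
    also have "\<dots> = (\<integral>\<^sup>+z. (\<integral>\<^sup>+v. indicator (- E) z * (indicator (cylinder s p \<theta> 0 r) v * indicator E (z + v)) \<partial>lborel) \<partial>lborel)"
      by (simp add: f_def nn_integral_cmult)
    also have "\<dots> = (\<integral>\<^sup>+v. (\<integral>\<^sup>+z. indicator (- E) z * (indicator (cylinder s p \<theta> 0 r) v * indicator E (z + v)) \<partial>lborel) \<partial>lborel)"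
      by (rule lborel_pair.Fubini'[symmetric]) measurable
    also have "\<dots> = (\<integral>\<^sup>+v. indicator (cylinder s p \<theta> 0 r) v * emeasure lborel {z. z \<notin> E \<and> z + v \<in> E} \<partial>lborel)"
    proof (rule nn_integral_cong)
      fix v :: "'a \<times> real"
      have "(\<integral>\<^sup>+z. indicator (- E) z * (indicator (cylinder s p \<theta> 0 r) v * indicator E (z + v)) \<partial>lborel)
        = (\<integral>\<^sup>+z. indicator (cylinder s p \<theta> 0 r) v * indicator {z. z \<notin> E \<and> z + v \<in> E} z \<partial>lborel)"
        by (intro nn_integral_cong) (auto split: split_indicator)
      also have "\<dots> = indicator (cylinder s p \<theta> 0 r) v * emeasure lborel {z. z \<notin> E \<and> z + v \<in> E}"
        by (rule nn_integral_cmult_indicator) measurable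
      finally show "(\<integral>\<^sup>+z. indicator (- E) z * (indicator (cylinder s p \<theta> 0 r) v * indicator E (z + v)) \<partial>lborel)
        = indicator (cylinder s p \<theta> 0 r) v * emeasure lborel {z. z \<notin> E \<and> z + v \<in> E}" .
    qed
    also have "\<dots> \<le> (\<integral>\<^sup>+v. ennreal \<eta> * indicator (cylinder s p \<theta> (0 :: 'a \<times> real) r) v \<partial>lborel)"
    proof (rule nn_integral_mono)
      fix v :: "'a \<times> real"
      show "indicator (cylinder s p \<theta> 0 r) v * emeasure lborel {z. z \<notin> E \<and> z + v \<in> E} \<le> ennreal \<eta> * indicator (cylinder s p \<theta> 0 r) v"
        using \<delta>(2)[of v] cyl by (cases "v \<in> cylinder s p \<theta> 0 r") auto
    qed
    also have "\<dots> = ennreal \<eta> * ennreal (c * r powr m)"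
      by (subst nn_integral_cmult_indicator) (auto simp: measure_cylinder[OF r \<theta>] c_def m_def)
    also have "\<dots> = ennreal (\<nu> * r powr m) * ennreal e"
      using \<eta> c \<nu> e by (simp add: ennreal_mult[symmetric] \<eta>_def mult_ac)
    finally have "ennreal (\<nu> * r powr m) * emeasure lborel N \<le> ennreal (\<nu> * r powr m) * ennreal e" .
    moreover have "0 < \<nu> * r powr m" using \<nu> r by simp
    ultimately show ?thesis by (subst (asm) ennreal_mult_le_mult_iff) auto
  qed
  have "emeasure lborel N \<le> 0" by (rule ennreal_le_epsilon) (use N_le in simp)
  then have "N \<in> null_sets lborel" by (auto simp: null_sets_def)
  then have "AE z in lborel. z \<notin> N" by (rule AE_not_in)
  then show ?thesis
  proof eventually_elim
    case (elim z)
    show ?case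
    proof
      assume "z \<notin> E"
      then obtain j where "\<not> ennreal (\<nu> * (r1 / real (Suc (Suc j))) powr m) \<le> f (r1 / real (Suc (Suc j))) z"
        using elim by (auto simp: N_def Bad_def)
      then show "\<exists>r>0. r < r1 \<and> emeasure lborel (E \<inter> cylinder s p \<theta> z r) \<le> ennreal (\<nu> * r powr (real DIM('a) + s * p))"
        using r1 by (intro exI[of _ "r1 / real (Suc (Suc j))"]) (auto simp: f_eq m_def divide_less_eq)
    qed
  qed
qed

lemma AE_small_density:
  fixes E :: "('a::euclidean_space \<times> real) set"
  assumes "E \<in> sets borel" "bounded E" "0 < s * p" "0 < \<theta>"
  shows "AE z in lborel. z \<notin> E \<longrightarrow> (\<forall>\<nu>>0. \<forall>r1>0. \<exists>r>0. r < r1 \<and> emeasure lborel (E \<inter> cylinder s p \<theta> z r) \<le> ennreal (\<nu> * r powr (real DIM('a) + s * p)))"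
proof -
  have "AE z in lborel. \<forall>i j. z \<notin> E \<longrightarrow> (\<exists>r>0. r < inverse (real (Suc j)) \<and>
    emeasure lborel (E \<inter> cylinder s p \<theta> z r) \<le> ennreal (inverse (real (Suc i)) * r powr (real DIM('a) + s * p)))"
    by (simp only: AE_all_countable) (intro allI AE_small_density_aux assms, auto)
  then show ?thesis
  proof eventually_elim
    case (elim z)
    show ?case
    proof (intro impI allI)
      fix \<nu> r1 :: real assume z: "z \<notin> E" and pos: "0 < \<nu>" "0 < r1"
      obtain i j where ij: "inverse (real (Suc i)) < \<nu>" "inverse (real (Suc j)) < r1"
        using reals_Archimedean pos by meson
      obtain r where r: "0 < r" "r < inverse (real (Suc j))"
        "emeasure lborel (E \<inter> cylinder s p \<theta> z r) \<le> ennreal (inverse (real (Suc i)) * r powr (real DIM('a) + s * p))"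
        using elim z by blast
      have "ennreal (inverse (real (Suc i)) * r powr (real DIM('a) + s * p)) \<le> ennreal (\<nu> * r powr (real DIM('a) + s * p))"
        using ij by (intro ennreal_leI mult_right_mono) auto
      then show "\<exists>r>0. r < r1 \<and> emeasure lborel (E \<inter> cylinder s p \<theta> z r) \<le> ennreal (\<nu> * r powr (real DIM('a) + s * p))"
        using r ij by (intro exI[of _ r]) auto
    qed
  qed
qed

text \<open>The essential suprema shrink with r, so the limit is their infimum, and comparisons with
  it can be expressed by open neighborhoods. In this form \<theta> disappears, and estimates on
  cylinders of another shape become applicable.\<close>

lemma usc_reg_char:
  fixes u :: "'a::euclidean_space \<times> real \<Rightarrow> real"
  assumes sp: "0 < s * p" and \<theta>: "0 < \<theta>" and Q: "open Q" "z \<in> Q" and u: "u \<in> borel_measurable (lebesgue_on Q)"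
  shows usc_reg_lessD: "usc_reg s p \<theta> u z < c \<Longrightarrow> \<exists>N c'. open N \<and> z \<in> N \<and> N \<subseteq> Q \<and> c' < c \<and> (AE w in lborel. w \<in> N \<longrightarrow> ereal (u w) \<le> c')"
    and usc_reg_leI: "open N \<Longrightarrow> z \<in> N \<Longrightarrow> (AE w in lborel. w \<in> N \<longrightarrow> ereal (u w) \<le> d) \<Longrightarrow> usc_reg s p \<theta> u z \<le> d"
proof -
  define ess where "ess r = esssup (lebesgue_on (cylinder s p \<theta> z r)) (\<lambda>w. ereal (u w))" for r
  have "\<forall>\<^sub>F r in at_right 0. cylinder s p \<theta> z r \<subseteq> Q" by (intro cylinder_eventually_subset sp \<theta> Q)
  then obtain r1 where r1: "0 < r1" "\<And>r. 0 < r \<Longrightarrow> r < r1 \<Longrightarrow> cylinder s p \<theta> z r \<subseteq> Q"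
    by (auto simp: eventually_at_right_field)
  \<comment> \<open>\<open>esssup\<close> has its intended value for measurable functions, and the
    measurability of \<open>u\<close> is available inside Q; hence the restriction to r <
    r1.\<close>
  have meas: "(\<lambda>w. ereal (u w)) \<in> borel_measurable (lebesgue_on (cylinder s p \<theta> z r))" if "0 < r" "r < r1" for r
    using measurable_restrict_mono[OF u r1(2)[OF that]] by simp
  have le_iff: "ess r \<le> d \<longleftrightarrow> (AE w in lborel. w \<in> cylinder s p \<theta> z r \<longrightarrow> ereal (u w) \<le> d)" if r: "0 < r" "r < r1" for r d
  proof -
    have cl: "cylinder s p \<theta> z r \<in> sets lebesgue" by simp
    have "ess r \<le> d \<longleftrightarrow> (AE w in lebesgue_on (cylinder s p \<theta> z r). ereal (u w) \<le> d)"
    proof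
      assume d: "ess r \<le> d"
      show "AE w in lebesgue_on (cylinder s p \<theta> z r). ereal (u w) \<le> d"
        using esssup_AE[where M="lebesgue_on (cylinder s p \<theta> z r)" and f="\<lambda>w. ereal (u w)"]
        by eventually_elim (use d in \<open>auto simp: ess_def\<close>)
    next
      assume "AE w in lebesgue_on (cylinder s p \<theta> z r). ereal (u w) \<le> d"
      then show "ess r \<le> d" unfolding ess_def by (rule esssup_I[OF meas[OF r]])
    qed
    also have "\<dots> \<longleftrightarrow> (AE w in lborel. w \<in> cylinder s p \<theta> z r \<longrightarrow> ereal (u w) \<le> d)"
      using cl by (simp add: AE_restrict_space_iff AE_completion_iff)
    finally show ?thesis .
  qed
  have mono: "ess r \<le> ess r'" if r: "0 < r" "r \<le> r'" "r' < r1" for r r'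
  proof -
    have r': "0 < r'" "r < r1" using r by auto
    have "AE w in lborel. w \<in> cylinder s p \<theta> z r' \<longrightarrow> ereal (u w) \<le> ess r'" using le_iff[OF r'(1) r(3)] by blast
    then show ?thesis
      unfolding le_iff[OF r(1) r'(2)] by eventually_elim (use cylinder_mono[OF sp \<theta> r(1,2), of z] in auto)
  qed
  define L where "L = (INF r\<in>{0<..<r1}. ess r)"
  have "(ess \<longlongrightarrow> L) (at_right 0)"
  proof (rule order_tendstoI)
    fix a assume a: "a < L"
    have "a < ess r" if "0 < r" "r < r1" for r
    proof -
      have "L \<le> ess r" unfolding L_def using that by (intro INF_lower) auto
      then show ?thesis using a by simp
    qed
    then show "\<forall>\<^sub>F r in at_right 0. a < ess r"
      using r1(1) by (intro eventually_at_rightI[of 0 r1]) auto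
  next
    fix a assume "L < a"
    then obtain r' where r': "0 < r'" "r' < r1" "ess r' < a" by (auto simp: L_def INF_less_iff)
    have "ess r < a" if "0 < r" "r < r'" for r
      using mono[of r r'] that r' by (auto intro: le_less_trans)
    then show "\<forall>\<^sub>F r in at_right 0. ess r < a"
      using r'(1) by (intro eventually_at_rightI[of 0 r']) auto
  qed
  then have L: "usc_reg s p \<theta> u z = L"
    unfolding usc_reg_def ess_def by (intro tendsto_Lim) auto
  show "usc_reg s p \<theta> u z < c \<Longrightarrow> \<exists>N c'. open N \<and> z \<in> N \<and> N \<subseteq> Q \<and> c' < c \<and> (AE w in lborel. w \<in> N \<longrightarrow> ereal (u w) \<le> c')"
  proof -
    assume "usc_reg s p \<theta> u z < c"
    then obtain r where r: "0 < r" "r < r1" "ess r < c" by (auto simp: L L_def INF_less_iff)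
    have "AE w in lborel. w \<in> cylinder s p \<theta> z r \<longrightarrow> ereal (u w) \<le> ess r" using le_iff[OF r(1,2)] by blast
    then show ?thesis
      by (intro exI[of _ "cylinder s p \<theta> z r"] exI[of _ "ess r"] conjI open_cylinder
          center_in_cylinder[OF r(1) \<theta>] r1(2)[OF r(1,2)] r(3))
  qed
  show "usc_reg s p \<theta> u z \<le> d" if N: "open N" "z \<in> N" and ae: "AE w in lborel. w \<in> N \<longrightarrow> ereal (u w) \<le> d"
  proof -
    have "\<forall>\<^sub>F r in at_right 0. cylinder s p \<theta> z r \<subseteq> N" by (intro cylinder_eventually_subset sp \<theta> N)
    then obtain r2 where r2: "0 < r2" "\<And>r. 0 < r \<Longrightarrow> r < r2 \<Longrightarrow> cylinder s p \<theta> z r \<subseteq> N"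
      by (auto simp: eventually_at_right_field)
    define r where "r = min r1 r2 / 2"
    have r: "0 < r" "r < r1" "r < r2" using r1(1) r2(1) by (auto simp: r_def min_def)
    have "ess r \<le> d" unfolding le_iff[OF r(1,2)]
      using ae by eventually_elim (use r2(2)[OF r(1,3)] in auto)
    moreover have "L \<le> ess r" unfolding L_def using r by (intro INF_lower) auto
    ultimately show ?thesis unfolding L by simp
  qed
qed

text \<open>\<open>de_giorgi\<close> around z with levels between c and c + \<epsilon>: smallness at
  level c implies smallness at k0 \<ge> c, and the half cylinder on which V \<le> k1 holds almost
  everywhere is the desired open neighborhood.\<close>

lemma local_upper_bound:
  fixes V :: "real \<times> 'a::euclidean_space \<Rightarrow> real" and z :: "'a \<times> real"
  assumes V [measurable]: "V \<in> borel_measurable borel"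
    and sol: "\<And>M x0 R0 t1 t2. M0 \<le> M \<Longrightarrow> 0 < R0 \<Longrightarrow> cball x0 R0 \<subseteq> \<Omega> \<Longrightarrow> 0 < t1 \<Longrightarrow> t1 < t2 \<Longrightarrow> t2 < T \<Longrightarrow>
       nonlocal_subsolution p (s * p) q \<Lambda> M \<kappa> V x0 R0 t1 t2"
    and \<Omega>: "open \<Omega>" and z: "z \<in> \<Omega> \<times> {0<..<T}" and q: "0 < q" and sp: "0 < s * p" and \<theta>: "0 < \<theta>" and \<epsilon>: "0 < \<epsilon>"
  shows "\<exists>\<nu>>0. \<exists>r1>0. \<forall>r. 0 < r \<and> r < r1 \<and>
      emeasure lborel {w \<in> cylinder s p \<theta> z r. c < V (snd w, fst w)} \<le> ennreal (\<nu> * r powr (real DIM('a) + s * p)) \<longrightarrow>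
      (\<exists>N. open N \<and> z \<in> N \<and> (AE w in lborel. w \<in> N \<longrightarrow> V (snd w, fst w) \<le> c + \<epsilon>))"
proof -
  obtain x0 t0 where z_eq: "z = (x0, t0)" by (cases z)
  have x0: "x0 \<in> \<Omega>" and t0: "0 < t0" "t0 < T" using z by (auto simp: z_eq)
  define \<sigma> where "\<sigma> = s * p"
  obtain R0 where R0: "0 < R0" "cball x0 R0 \<subseteq> \<Omega>" using \<Omega> x0 by (auto simp: open_contains_cball)
  define t1 where "t1 = t0 / 2"
  define t2 where "t2 = (t0 + T) / 2"
  have tt: "0 < t1" "t1 < t0" "t0 < t2" "t2 < T" using t0 by (auto simp: t1_def t2_def)
  \<comment> \<open>The interval [k0, k1] has to avoid 0: for c \<ge> 0 it starts strictly above c,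
    for c < 0 it ends at c / 2 at the latest.\<close>
  obtain k0 k1 where k: "c \<le> k0" "k0 < k1" "k1 \<le> c + \<epsilon>" "0 < k0 \<or> k1 < 0"
  proof (cases "0 \<le> c")
    case True then show ?thesis using \<epsilon> by (intro that[of "c + \<epsilon> / 2" "c + \<epsilon>"]) auto
  next
    case False then show ?thesis using \<epsilon> by (intro that[of c "min (c + \<epsilon>) (c / 2)"]) auto
  qed
  obtain c0 where c0: "0 < c0" "\<And>x y. k0 \<le> x \<Longrightarrow> x \<le> y \<Longrightarrow> y \<le> k1 \<Longrightarrow> c0 * (y - x) \<le> spow q y - spow q x"
    using spow_slope[OF q k(2,4)] by blast
  define M where "M = max M0 (max \<bar>k0\<bar> \<bar>k1\<bar>)"
  interpret nonlocal_subsolution p \<sigma> q \<Lambda> M \<kappa> V x0 R0 t1 t2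
    unfolding \<sigma>_def using R0 tt by (intro sol) (auto simp: M_def)
  have kM: "\<bar>k0\<bar> \<le> M" "\<bar>k1\<bar> \<le> M" by (auto simp: M_def)
  obtain \<nu> where \<nu>: "0 < \<nu>"
    "\<And>r t0. \<lbrakk>0 < r; r < R0; t1 \<le> t0 - \<theta> * r powr \<sigma>; t0 + \<theta> * r powr \<sigma> \<le> t2;
       measure lborel (superlevel (t0 - \<theta> * r powr \<sigma>) (t0 + \<theta> * r powr \<sigma>) r k0) \<le> \<nu> * r powr (real DIM('a) + \<sigma>)\<rbrakk>
       \<Longrightarrow> measure lborel (superlevel (t0 - \<theta> * r powr \<sigma> / 2) (t0 + \<theta> * r powr \<sigma> / 2) (r / 2) k1) = 0"
    using de_giorgi[OF c0 k(2) kM \<theta>] by blast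
  have "\<forall>\<^sub>F r in at_right 0. cylinder s p \<theta> z r \<subseteq> ball x0 R0 \<times> {t1<..<t2}"
    using R0 tt by (intro cylinder_eventually_subset sp \<theta> open_Times) (auto simp: z_eq)
  then obtain r1 where r1: "0 < r1" "\<And>r. 0 < r \<Longrightarrow> r < r1 \<Longrightarrow> cylinder s p \<theta> z r \<subseteq> ball x0 R0 \<times> {t1<..<t2}"
    by (auto simp: eventually_at_right_field)
  have r1R0: "0 < min r1 R0" using r1 R0 by simp
  have main: "\<exists>N. open N \<and> z \<in> N \<and> (AE w in lborel. w \<in> N \<longrightarrow> V (snd w, fst w) \<le> c + \<epsilon>)"
    if A: "0 < r \<and> r < min r1 R0 \<and>
      emeasure lborel {w \<in> cylinder s p \<theta> z r. c < V (snd w, fst w)} \<le> ennreal (\<nu> * r powr (real DIM('a) + s * p))" for r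
  proof -
    from A have r: "0 < r" "r < r1" "r < R0" by auto
    define h where "h = \<theta> * r powr \<sigma>"
    have h: "0 < h" using \<theta> r by (simp add: h_def)
    have cyl: "cylinder s p \<theta> z r = ball x0 r \<times> {t0 - h<..<t0 + h}"
      by (simp add: cylinder_def z_eq h_def \<sigma>_def)
    have "{t0 - h<..<t0 + h} \<subseteq> {t1<..<t2}"
    proof
      fix t assume "t \<in> {t0 - h<..<t0 + h}"
      then have "(x0, t) \<in> ball x0 r \<times> {t0 - h<..<t0 + h}" using r(1) by simp
      then show "t \<in> {t1<..<t2}" using r1(2)[OF r(1,2)] unfolding cyl by blast
    qed
    then have bds: "t1 \<le> t0 - h" "t0 + h \<le> t2" using h by (auto simp: greaterThanLessThan_subseteq_greaterThanLessThan)
    have "emeasure lborel (superlevel (t0 - h) (t0 + h) r k0) = emeasure lborel {w. (snd w, fst w) \<in> superlevel (t0 - h) (t0 + h) r k0}"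
      by (rule emeasure_swap_lborel) measurable
    also have "\<dots> \<le> emeasure lborel {w \<in> cylinder s p \<theta> z r. c < V (snd w, fst w)}"
    proof (rule emeasure_mono)
      show "{w. (snd w, fst w) \<in> superlevel (t0 - h) (t0 + h) r k0} \<subseteq> {w \<in> cylinder s p \<theta> z r. c < V (snd w, fst w)}"
        using k(1) unfolding cyl by (auto simp: superlevel_def)
    qed measurable
    also have "\<dots> \<le> ennreal (\<nu> * r powr (real DIM('a) + \<sigma>))" using A by (simp add: \<sigma>_def)
    finally have "measure lborel (superlevel (t0 - h) (t0 + h) r k0) \<le> \<nu> * r powr (real DIM('a) + \<sigma>)"
      using \<nu>(1) by (simp add: measure_def enn2real_leI)
    from \<nu>(2)[OF r(1,3) bds[unfolded h_def] this[unfolded h_def]]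
    have "measure lborel (superlevel (t0 - h / 2) (t0 + h / 2) (r / 2) k1) = 0" by (simp add: h_def)
    then have "emeasure lborel (superlevel (t0 - h / 2) (t0 + h / 2) (r / 2) k1) = 0"
      using superlevel_finite[of "t0 - h / 2" "t0 + h / 2" "r / 2" k1] by (simp add: emeasure_eq_ennreal_measure less_top)
    then have "emeasure lborel {w. (snd w, fst w) \<in> superlevel (t0 - h / 2) (t0 + h / 2) (r / 2) k1} = 0"
      by (subst emeasure_swap_lborel[symmetric]) auto
    then have "AE w in lborel. (snd w, fst w) \<notin> superlevel (t0 - h / 2) (t0 + h / 2) (r / 2) k1"
      by (intro AE_I[where N="{w. (snd w, fst w) \<in> superlevel (t0 - h / 2) (t0 + h / 2) (r / 2) k1}"]) auto
    then have "AE w in lborel. w \<in> ball x0 (r / 2) \<times> {t0 - h / 2<..<t0 + h / 2} \<longrightarrow> V (snd w, fst w) \<le> c + \<epsilon>"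
      by eventually_elim (use k(3) in \<open>auto simp: superlevel_def not_less\<close>)
    moreover have "open (ball x0 (r / 2) \<times> {t0 - h / 2<..<t0 + h / 2})" by (intro open_Times) auto
    moreover have "z \<in> ball x0 (r / 2) \<times> {t0 - h / 2<..<t0 + h / 2}" using r h by (simp add: z_eq)
    ultimately show ?thesis by blast
  qed
  show ?thesis using \<nu>(1) r1R0 main by blast
qed

text \<open>The upper bound requires a small superlevel set in a single small cylinder around z: at
  a Lebesgue point Chebyshev's inequality provides it, and almost everywhere the density property of
  the superlevel sets does. For the lower bound, an essential bound below u(z) on a neighborhood of
  z contradicts the averages at a Lebesgue point; almost everywhere it is excluded by a countable
  cover.\<close>

theorem corollary2p13:
  fixes \<Omega> :: "'a::euclidean_space set"
    and T p q s \<Lambda> \<theta> \<theta>' :: real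
    and K :: "'a \<times> 'a \<times> real \<Rightarrow> real"
    and u :: "'a \<times> real \<Rightarrow> real"
  assumes "open \<Omega>" "connected \<Omega>" "bounded \<Omega>" "\<Omega> \<noteq> {}"
    and "0 < T" "1 < p" "0 < q" "0 < s" "s < 1" "1 \<le> \<Lambda>"
    and "nonlocal_kernel s p \<Lambda> T K"
    and "weak_subsolution s p q K \<Omega> T u"
    and "0 < \<theta>" "0 < \<theta>'"
  shows "(\<forall>z \<in> \<Omega> \<times> {0<..<T}. lebesgue_point s p \<theta>' u z \<longrightarrow> usc_reg s p \<theta> u z = ereal (u z)) \<and>
         usc_on (\<Omega> \<times> {0<..<T}) (usc_reg s p \<theta> u) \<and>
         (AE z in lebesgue_on (\<Omega> \<times> {0<..<T}). usc_reg s p \<theta> u z = ereal (u z))"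
proof -
  define Q where "Q = \<Omega> \<times> {0<..<T}"
  have Q: "open Q" "bounded Q"
    unfolding Q_def using assms(1,3) by (auto intro!: open_Times bounded_Times)
  have sp: "0 < s * p" using assms by simp
  have u_meas: "u \<in> borel_measurable (lebesgue_on Q)"
    by (rule measurable_restrict_mono[of _ _ "UNIV \<times> {0<..<T}"])
       (use assms(12) in \<open>auto simp: weak_subsolution_def Q_def\<close>)
  obtain V \<kappa> M0 where V [measurable]: "V \<in> borel_measurable borel" and VM: "\<And>w. \<bar>V w\<bar> \<le> M0"
    and uV: "AE z in lborel. snd z \<in> {0<..<T} \<longrightarrow> u z = V (snd z, fst z)"
    and sol: "\<And>M x0 R0 t1 t2. M0 \<le> M \<Longrightarrow> 0 < R0 \<Longrightarrow> cball x0 R0 \<subseteq> \<Omega> \<Longrightarrow> 0 < t1 \<Longrightarrow> t1 < t2 \<Longrightarrow> t2 < T \<Longrightarrow>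
       nonlocal_subsolution p (p * s) q \<Lambda> M \<kappa> V x0 R0 t1 t2"
    by (rule weak_subsolution_borel[OF assms(6-12)]) (rule that)
  define U where "U w = V (snd w, fst w)" for w
  have [measurable]: "U \<in> borel_measurable borel" unfolding U_def by measurable
  have uU: "AE w in lborel. w \<in> Q \<longrightarrow> u w = U w"
    using uV by eventually_elim (auto simp: Q_def U_def)
  note lessD = usc_reg_lessD[OF sp assms(13) Q(1) _ u_meas]
  note leI = usc_reg_leI[OF sp assms(13) Q(1) _ u_meas]
  \<comment> \<open>\<theta>'' is kept apart from \<theta>: smallness is tested on the cylinders of
    the Lebesgue point condition in one application and on those of \<open>usc_reg\<close> in the
    other.\<close>
  have upper: "\<exists>\<nu>>0. \<exists>r1>0. \<forall>r. 0 < r \<and> r < r1 \<and>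
      emeasure lborel {w \<in> cylinder s p \<theta>'' z r. c < U w} \<le> ennreal (\<nu> * r powr (real DIM('a) + s * p)) \<longrightarrow>
      usc_reg s p \<theta> u z \<le> ereal (c + \<epsilon>)"
    if z: "z \<in> Q" and \<epsilon>: "0 < \<epsilon>" and \<theta>'': "0 < \<theta>''" for z c \<epsilon> \<theta>''
  proof -
    have "\<exists>\<nu>>0. \<exists>r1>0. \<forall>r. 0 < r \<and> r < r1 \<and>
        emeasure lborel {w \<in> cylinder s p \<theta>'' z r. c < V (snd w, fst w)} \<le> ennreal (\<nu> * r powr (real DIM('a) + s * p)) \<longrightarrow>
        (\<exists>N. open N \<and> z \<in> N \<and> (AE w in lborel. w \<in> N \<longrightarrow> V (snd w, fst w) \<le> c + \<epsilon>))"
    proof (rule local_upper_bound[where ?M0.0=M0, OF V _ assms(1) z[unfolded Q_def] assms(7) sp \<theta>'' \<epsilon>])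
      fix M x0 R0 t1 t2
      assume "M0 \<le> M" "0 < R0" "cball x0 R0 \<subseteq> \<Omega>" "0 < t1" "t1 < t2" "t2 < T"
      then show "nonlocal_subsolution p (s * p) q \<Lambda> M \<kappa> V x0 R0 t1 t2"
        using sol by (simp add: mult.commute)
    qed
    then obtain \<nu> r1 where \<nu>: "0 < \<nu>" "0 < r1" and N: "\<forall>r. 0 < r \<and> r < r1 \<and>
        emeasure lborel {w \<in> cylinder s p \<theta>'' z r. c < V (snd w, fst w)} \<le> ennreal (\<nu> * r powr (real DIM('a) + s * p)) \<longrightarrow>
        (\<exists>N. open N \<and> z \<in> N \<and> (AE w in lborel. w \<in> N \<longrightarrow> V (snd w, fst w) \<le> c + \<epsilon>))"
      by (elim exE conjE) (rule that)
    have "usc_reg s p \<theta> u z \<le> ereal (c + \<epsilon>)"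
      if r: "0 < r" "r < r1" "emeasure lborel {w \<in> cylinder s p \<theta>'' z r. c < U w} \<le> ennreal (\<nu> * r powr (real DIM('a) + s * p))" for r
    proof -
      obtain N where N: "open N" "z \<in> N" "AE w in lborel. w \<in> N \<longrightarrow> V (snd w, fst w) \<le> c + \<epsilon>"
        using N[rule_format, OF conjI[OF r(1) conjI[OF r(2) r(3)[unfolded U_def]]]] by (elim exE conjE) (rule that)
      have ae: "AE w in lborel. w \<in> N \<inter> Q \<longrightarrow> ereal (u w) \<le> ereal (c + \<epsilon>)"
        using N(3) uU by eventually_elim (auto simp: U_def)
      show ?thesis by (rule leI[OF z _ _ ae]) (use N Q z in auto)
    qed
    then show ?thesis by (intro exI[of _ \<nu>] exI[of _ r1] conjI \<nu> allI impI) auto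
  qed
  have subQ: "\<exists>r2>0. \<forall>r. 0 < r \<and> r < r2 \<longrightarrow> cylinder s p \<theta>'' z r \<subseteq> Q" if "z \<in> Q" "0 < \<theta>''" for z \<theta>''
    using cylinder_eventually_subset[OF sp that(2) Q(1) that(1)] by (auto simp: eventually_at_right_field)
  have part1: "usc_reg s p \<theta> u z = ereal (u z)" if z: "z \<in> Q" and lp: "lebesgue_point s p \<theta>' u z" for z
  proof (rule antisym)
    define c\<omega> where "c\<omega> = unit_ball_vol (real DIM('a)) * 2 * \<theta>'"
    have c\<omega>: "0 < c\<omega>" using assms(14) by (simp add: c\<omega>_def)
    define m where "m = real DIM('a) + s * p"
    define A where "A r = 1 / measure lebesgue (cylinder s p \<theta>' z r) * (\<integral>w\<in>cylinder s p \<theta>' z r. \<bar>u z - u w\<bar> \<partial>lebesgue)" for r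
    define I where "I r = (\<integral>w. indicator (cylinder s p \<theta>' z r) w * \<bar>u z - U w\<bar> \<partial>lborel)" for r
    have A0: "(A \<longlongrightarrow> 0) (at_right 0)" using lp unfolding lebesgue_point_def A_def .
    have I_int: "integrable lborel (\<lambda>w. indicator (cylinder s p \<theta>' z r) w * \<bar>u z - U w\<bar>)" for r
    proof (rule integrable_bounded_support[OF _ cylinder_borel[of s p \<theta>' z r] bounded_cylinder])
      show "\<bar>indicator (cylinder s p \<theta>' z r) w * \<bar>u z - U w\<bar>\<bar> \<le> \<bar>u z\<bar> + M0" for w
        using VM[of "(snd w, fst w)"] by (auto simp: U_def indicator_def)
    qed auto
    have ind_int: "integrable lborel (indicat_real B)" if "B \<in> sets borel" "B \<subseteq> cylinder s p \<theta>' z r" for B r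
      using that bounded_subset[OF bounded_cylinder that(2)] by (intro integrable_real_indicator emeasure_bounded_finite) auto
    have meas_cyl: "measure lborel (cylinder s p \<theta>' z r) = c\<omega> * r powr m" if "0 < r" for r
      using measure_cylinder[OF that assms(14), of s p z] c\<omega> by (simp add: measure_def c\<omega>_def m_def)
    have A_eq: "I r = A r * (c\<omega> * r powr m)" if r: "0 < r" "cylinder s p \<theta>' z r \<subseteq> Q" for r
    proof -
      have "(\<integral>w\<in>cylinder s p \<theta>' z r. \<bar>u z - u w\<bar> \<partial>lebesgue) = I r"
        unfolding set_lebesgue_integral_def I_def
      proof (rule integral_lebesgue_AE_eq)
        show "AE w in lborel. indicat_real (cylinder s p \<theta>' z r) w *\<^sub>R \<bar>u z - u w\<bar> = indicator (cylinder s p \<theta>' z r) w * \<bar>u z - U w\<bar>"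
          using uU by eventually_elim (use r in \<open>auto simp: indicator_def\<close>)
      qed measurable
      moreover have "measure lebesgue (cylinder s p \<theta>' z r) = c\<omega> * r powr m"
        using meas_cyl[OF r(1)] by simp
      moreover have "c\<omega> * r powr m \<noteq> 0" using c\<omega> r by simp
      ultimately show ?thesis by (simp add: A_def)
    qed
    \<comment> \<open>Chebyshev's inequality; B is the whole cylinder in the proof of the lower
      bound and a superlevel set in the proof of the upper bound.\<close>
    have lower: "d * measure lborel B \<le> A r * (c\<omega> * r powr m)"
      if r: "0 < r" "cylinder s p \<theta>' z r \<subseteq> Q" and B: "B \<in> sets borel" "B \<subseteq> cylinder s p \<theta>' z r"
        and d: "AE w in lborel. w \<in> B \<longrightarrow> d \<le> \<bar>u z - U w\<bar>" for r B d
    proof -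
      have "d * measure lborel B = (\<integral>w. d * indicator B w \<partial>lborel)" using B by simp
      also have "\<dots> \<le> I r" unfolding I_def
      proof (rule integral_mono_AE)
        show "AE w in lborel. d * indicator B w \<le> indicator (cylinder s p \<theta>' z r) w * \<bar>u z - U w\<bar>"
          using d by eventually_elim (use B in \<open>auto simp: indicator_def\<close>)
      qed (use ind_int[OF B] I_int in auto)
      also have "\<dots> = A r * (c\<omega> * r powr m)" by (rule A_eq[OF r])
      finally show ?thesis .
    qed
    have small: "\<exists>r>0. r < r1 \<and> cylinder s p \<theta>' z r \<subseteq> N \<inter> Q \<and> A r < e"
      if "0 < r1" "0 < e" "open N" "z \<in> N" for r1 e N
    proof -
      have "\<forall>\<^sub>F r in at_right 0. cylinder s p \<theta>' z r \<subseteq> N \<inter> Q"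
        using that Q z by (intro cylinder_eventually_subset sp assms(14)) auto
      moreover have "\<forall>\<^sub>F r in at_right 0. A r < e" using A0 that(2) by (rule order_tendstoD)
      moreover have "\<forall>\<^sub>F r in at_right (0::real). r < r1" using that(1) by (intro eventually_at_rightI[of 0 r1]) auto
      moreover have "\<forall>\<^sub>F r in at_right (0::real). 0 < r" by (rule eventually_at_right_less)
      ultimately have "\<forall>\<^sub>F r in at_right 0. 0 < r \<and> r < r1 \<and> cylinder s p \<theta>' z r \<subseteq> N \<inter> Q \<and> A r < e"
        by eventually_elim auto
      then show ?thesis by (auto dest: eventually_happens)
    qed
    show "ereal (u z) \<le> usc_reg s p \<theta> u z"
    proof (rule ccontr)
      assume "\<not> ereal (u z) \<le> usc_reg s p \<theta> u z"
      then obtain N c' where N: "open N" "z \<in> N" "c' < ereal (u z)" "AE w in lborel. w \<in> N \<longrightarrow> ereal (u w) \<le> c'"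
        using lessD[OF z, of "ereal (u z)"] by (auto simp: not_le)
      obtain c'' where c'': "c' < ereal c''" "c'' < u z" using ereal_dense2[OF N(3)] by auto
      obtain r where r: "0 < r" "cylinder s p \<theta>' z r \<subseteq> N \<inter> Q" "A r < u z - c''"
        using small[of 1 "u z - c''" N] N c'' by auto
      have "AE w in lborel. w \<in> cylinder s p \<theta>' z r \<longrightarrow> u z - c'' \<le> \<bar>u z - U w\<bar>"
        using N(4) uU
      proof eventually_elim
        case (elim w)
        show ?case
        proof
          assume "w \<in> cylinder s p \<theta>' z r"
          then have "w \<in> N" "u w = U w" using r elim by auto
          then have "ereal (U w) \<le> ereal c''" using elim(1) c''(1) by (metis less_imp_le order_trans)
          then show "u z - c'' \<le> \<bar>u z - U w\<bar>" using c''(2) by simp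
        qed
      qed
      from lower[OF r(1) _ _ order_refl this]
      have "(u z - c'') * (c\<omega> * r powr m) \<le> A r * (c\<omega> * r powr m)" using r meas_cyl[OF r(1)] by simp
      moreover have "0 < c\<omega> * r powr m" using c\<omega> r by simp
      ultimately have "u z - c'' \<le> A r" by (rule mult_right_le_imp_le)
      then show False using r(3) by simp
    qed
    show "usc_reg s p \<theta> u z \<le> ereal (u z)"
    proof (rule ereal_le_epsilon2)
      fix \<epsilon> :: real assume \<epsilon>: "0 < \<epsilon>"
      obtain \<nu> r1 where \<nu>: "0 < \<nu>" "0 < r1" and le: "\<forall>r. 0 < r \<and> r < r1 \<and>
          emeasure lborel {w \<in> cylinder s p \<theta>' z r. u z + \<epsilon> / 2 < U w} \<le> ennreal (\<nu> * r powr m) \<longrightarrow>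
          usc_reg s p \<theta> u z \<le> ereal (u z + \<epsilon> / 2 + \<epsilon> / 2)"
        using upper[OF z half_gt_zero[OF \<epsilon>] assms(14), of "u z + \<epsilon> / 2", folded m_def]
        by (elim exE conjE) (rule that)
      \<comment> \<open>Makes e times the volume of the cylinder equal to \<epsilon> / 2 times the
        threshold \<nu> r^m, so Chebyshev gives exactly the required smallness.\<close>
      define e where "e = \<epsilon> / 2 * \<nu> / c\<omega>"
      have "0 < e" using \<epsilon> \<nu> c\<omega> by (simp add: e_def)
      then obtain r where r: "0 < r" "r < r1" "cylinder s p \<theta>' z r \<subseteq> Q" "A r < e"
        using small[of r1 e UNIV] \<nu> by auto
      define B where "B = {w \<in> cylinder s p \<theta>' z r. u z + \<epsilon> / 2 < U w}"
      have B: "B \<in> sets borel" "B \<subseteq> cylinder s p \<theta>' z r" unfolding B_def by auto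
      have "\<epsilon> / 2 * measure lborel B \<le> A r * (c\<omega> * r powr m)"
        by (rule lower[OF r(1,3) B], rule AE_I2) (use \<epsilon> in \<open>auto simp: B_def\<close>)
      also have "\<dots> \<le> e * (c\<omega> * r powr m)" using r c\<omega> by (intro mult_right_mono) auto
      also have "\<dots> = \<epsilon> / 2 * (\<nu> * r powr m)" using c\<omega> by (simp add: e_def)
      finally have "measure lborel B \<le> \<nu> * r powr m" using \<epsilon> by simp
      moreover have "emeasure lborel B = ennreal (measure lborel B)"
        using emeasure_bounded_finite[OF bounded_subset[OF bounded_cylinder B(2)]]
        by (intro emeasure_eq_ennreal_measure) (auto simp: less_top)
      ultimately have "emeasure lborel B \<le> ennreal (\<nu> * r powr m)" by (simp add: ennreal_leI)
      then have "usc_reg s p \<theta> u z \<le> ereal (u z + \<epsilon> / 2 + \<epsilon> / 2)" unfolding B_def by (intro le[rule_format, of r] conjI r(1,2))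
      then show "usc_reg s p \<theta> u z \<le> ereal (u z) + ereal \<epsilon>" by (simp add: add.commute)
    qed
  qed
  \<comment> \<open>The open set and the bound c' < c found at z serve at every other point of that
    set too, so semicontinuity follows from the description by neighborhoods.\<close>
  have part2: "usc_on Q (usc_reg s p \<theta> u)"
    unfolding usc_on_def
  proof (intro ballI allI impI)
    fix z c assume z: "z \<in> Q" and c: "usc_reg s p \<theta> u z < c"
    obtain N c' where N: "open N" "z \<in> N" "c' < c" "AE w in lborel. w \<in> N \<longrightarrow> ereal (u w) \<le> c'"
      using lessD[OF z c] by blast
    show "\<forall>\<^sub>F w in at z within Q. usc_reg s p \<theta> u w < c"
      unfolding eventually_at_topological
    proof (intro exI[of _ N] conjI ballI impI N)
      fix w assume "w \<in> N" "w \<in> Q"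
      then have "usc_reg s p \<theta> u w \<le> c'" using leI N by blast
      then show "usc_reg s p \<theta> u w < c" using N(3) by (rule le_less_trans)
    qed
  qed
  \<comment> \<open>Superlevel sets are used at rational levels, so that one null set serves all of
    them; they are bounded because Q is, as the density lemma requires.\<close>
  define E where "E c = {w \<in> Q. c < U w}" for c
  have E: "E c \<in> sets borel" "bounded (E c)" for c
  proof -
    have [measurable]: "Q \<in> sets borel" using Q(1) by (rule borel_open)
    show "E c \<in> sets borel" unfolding E_def by measurable
    show "bounded (E c)" by (rule bounded_subset[OF Q(2)]) (auto simp: E_def)
  qed
  have density: "AE z in lborel. \<forall>c::rat. z \<notin> E (of_rat c) \<longrightarrow> (\<forall>\<nu>>0. \<forall>r1>0. \<exists>r>0. r < r1 \<and>
      emeasure lborel (E (of_rat c) \<inter> cylinder s p \<theta> z r) \<le> ennreal (\<nu> * r powr (real DIM('a) + s * p)))"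
    unfolding AE_all_countable by (intro allI AE_small_density E sp assms(13))
  \<comment> \<open>The open sets on which u has the essential bound c. There may be uncountably
    many, but by Lindelof countably many cover their union, so u \<le> c holds almost everywhere on
    the whole union.\<close>
  define \<F> where "\<F> c = {N. open N \<and> (AE w in lborel. w \<in> N \<longrightarrow> u w \<le> c)}" for c :: real
  have cover: "AE z in lborel. \<forall>c::rat. z \<in> \<Union>(\<F> (of_rat c)) \<longrightarrow> u z \<le> of_rat c"
    unfolding AE_all_countable
  proof
    fix c :: rat
    obtain \<F>' where \<F>': "\<F>' \<subseteq> \<F> (of_rat c)" "countable \<F>'" "\<Union>\<F>' = \<Union>(\<F> (of_rat c))"
      by (rule Lindelof[of "\<F> (of_rat c)"]) (auto simp: \<F>_def)
    have "AE z in lborel. \<forall>N\<in>\<F>'. z \<in> N \<longrightarrow> u z \<le> of_rat c"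
      using \<F>'(1,2) by (subst AE_ball_countable) (auto simp: \<F>_def)
    then show "AE z in lborel. z \<in> \<Union>(\<F> (of_rat c)) \<longrightarrow> u z \<le> of_rat c"
      by eventually_elim (use \<F>'(3) in auto)
  qed
  have part3: "AE z in lborel. z \<in> Q \<longrightarrow> usc_reg s p \<theta> u z = ereal (u z)"
    using density cover uU
  proof eventually_elim
    case (elim z)
    show ?case
    proof (intro impI antisym)
      assume z: "z \<in> Q"
      then have Uz: "u z = U z" using elim by simp
      show "ereal (u z) \<le> usc_reg s p \<theta> u z"
      proof (rule ccontr)
        assume "\<not> ereal (u z) \<le> usc_reg s p \<theta> u z"
        then obtain N c' where N: "open N" "z \<in> N" "c' < ereal (u z)" "AE w in lborel. w \<in> N \<longrightarrow> ereal (u w) \<le> c'"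
          using lessD[OF z, of "ereal (u z)"] by (auto simp: not_le)
        obtain c'' where c'': "c' < ereal c''" "c'' < u z" using ereal_dense2[OF N(3)] by auto
        obtain c where c: "c'' < of_rat c" "of_rat c < u z" using of_rat_dense[OF c''(2)] by blast
        have "AE w in lborel. w \<in> N \<longrightarrow> u w \<le> of_rat c"
          using N(4)
        proof eventually_elim
          case (elim w)
          show ?case
          proof
            assume "w \<in> N"
            then have "ereal (u w) \<le> ereal c''" using elim c''(1) by (metis less_imp_le order_trans)
            then show "u w \<le> of_rat c" using c(1) by simp
          qed
        qed
        then have "z \<in> \<Union>(\<F> (of_rat c))" using N by (auto simp: \<F>_def)
        then show False using elim(2) c(2) by (meson not_le)
      qed
      show "usc_reg s p \<theta> u z \<le> ereal (u z)"
      proof (rule ereal_le_epsilon2)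
        fix \<epsilon> :: real assume \<epsilon>: "0 < \<epsilon>"
        obtain c where c: "u z < of_rat c" "of_rat c < u z + \<epsilon> / 2"
          using of_rat_dense[of "u z" "u z + \<epsilon> / 2"] \<epsilon> by auto
        have zE: "z \<notin> E (of_rat c)" using c Uz by (simp add: E_def)
        obtain \<nu> r1 where \<nu>: "0 < \<nu>" "0 < r1" and le: "\<forall>r. 0 < r \<and> r < r1 \<and>
            emeasure lborel {w \<in> cylinder s p \<theta> z r. of_rat c < U w} \<le> ennreal (\<nu> * r powr (real DIM('a) + s * p)) \<longrightarrow>
            usc_reg s p \<theta> u z \<le> ereal (of_rat c + \<epsilon> / 2)"
          using upper[OF z half_gt_zero[OF \<epsilon>] assms(13), of "of_rat c"] by (elim exE conjE) (rule that)
        obtain r2 where r2: "0 < r2" "\<And>r. 0 < r \<Longrightarrow> r < r2 \<Longrightarrow> cylinder s p \<theta> z r \<subseteq> Q"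
          using subQ[OF z assms(13)] by blast
        obtain r where r: "0 < r" "r < min r1 r2"
          "emeasure lborel (E (of_rat c) \<inter> cylinder s p \<theta> z r) \<le> ennreal (\<nu> * r powr (real DIM('a) + s * p))"
          using elim(1) zE \<nu> r2(1) by (metis min_less_iff_conj)
        have "{w \<in> cylinder s p \<theta> z r. of_rat c < U w} = E (of_rat c) \<inter> cylinder s p \<theta> z r"
          using r2(2)[of r] r by (auto simp: E_def)
        then have "usc_reg s p \<theta> u z \<le> ereal (of_rat c + \<epsilon> / 2)" using r by (intro le[rule_format, of r]) auto
        also have "\<dots> \<le> ereal (u z) + ereal \<epsilon>" using c by simp
        finally show "usc_reg s p \<theta> u z \<le> ereal (u z) + ereal \<epsilon>" .
      qed
    qed
  qed
  have "Q \<in> sets lebesgue" using Q(1) by simp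
  then have "AE z in lebesgue_on Q. usc_reg s p \<theta> u z = ereal (u z)"
    using part3 by (simp add: AE_restrict_space_iff AE_completion_iff)
  then show ?thesis using part1 part2 unfolding Q_def by blast
qed

end
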